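(* Fix $\ell\ge1$ and a word $w\in\{+,-\}^{2\ell}$. Let $T_w(q)$ be the generating function of pure steep tilings of the oblique strip of width $2\ell$ with asymptotic data $w$ (considered up to translation by integer multiples of $(1,1)$), where the exponent of $q$ is the minimal number of flips needed to obtain the tiling from the minimal tiling $T^w_{\min}$. Then $$T_w(q)=\prod_{\substack{i<j\\ w_i=+,\ w_j=-\\ j-i\text{ odd}}}\left(1+q^{j-i}\right)\prod_{\substack{i<j\\ w_i=+,\ w_j=-\\ j-i\text{ even}}}\frac{1}{1-q^{j-i}}.$$
   Context: A domino is a closed $2\times1$ or $1\times2$ rectangle with integer corners. A tiling of the oblique strip of width $2\ell$ is a set of dominos with disjoint interiors whose union $R$ satisfies $\{|x-y-\ell|\le\ell-1\}\subseteq R\subseteq\{|x-y-\ell|\le\ell+1\}$. A horizontal (resp. vertical) domino is north-going (resp. east-going) if the sum of the coordinates of its top left corner is odd, and south-going (resp. west-going) otherwise. The tiling is steep if for some $B$ all dominos in $\{x+y>B\}$ are north- or east-going and all dominos in $\{x+y<-B\}$ are south- or west-going. Its asymptotic data is the word $w\in\{+,-\}^{2\ell}$ such that for each $k\in\{1,\dots,\ell\}$: for all large enough $x$ the unit square with bottom right corner $(x,x-2k)$ is covered by a north-going domino if $w_{2k-1}=+$ and an east-going one if $w_{2k-1}=-$; for all negative enough $x$ the unit square with top left corner $(x,x-2k+2)$ is covered by a west-going domino if $w_{2k}=+$ and a south-going one if $w_{2k}=-$ (this word exists and is unique). The tiling is pure if there are half-integers $a,b$ such that, for $x\in\mathbb{Z}+\frac12$,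 the unit square centered at $(x,x)$ is covered iff $x\ge a$, and the unit square centered at $(x,x-2\ell)$ is covered iff $x\le b$. A flip replaces two horizontal dominos forming a $2\times2$ square by two vertical dominos, or vice versa; it is centered on the $k$-th diagonal if the center of the square lies on $y=x-k$. Particle configuration: a site is a point $(x,y)\in(\mathbb{Z}+\frac12)^2$ with $0\le x-y\le2\ell$; it is occupied if covered by a south- or west-going domino or if it is uncovered and lies on $y=x$, and empty if covered by a north- or east-going domino or if it is uncovered and lies on $y=x-2\ell$. Define integers $c_0=0$, $c_{2k-1}=c_{2k-2}+1$ if $w_{2k-1}=+$ and $c_{2k-1}=c_{2k-2}$ otherwise, $c_{2k}=c_{2k-1}$ if $w_{2k}=+$ and $c_{2k}=c_{2k-1}+1$ otherwise. The minimal tiling $T^w_{\min}$ is the steep tiling with asymptotic data $w$ in which, for every $m\in\{0,\dots,2\ell\}$ and $x\in\mathbb{Z}+\frac12$, the site $(x,x-m)$ is occupied iff $x<c_m$; it is pure. *)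

theory Defs
  imports
    "HOL-Analysis.Analysis"
    "HOL-Library.Extended_Nat"
    "HOL-Computational_Algebra.Formal_Power_Series"
begin

text \<open>
  A domino is represented by its orientation together with its top left corner; the
  closed rectangle itself is \<^term>\<open>rect d\<close>, defined below.
\<close>

datatype domino = Horizontal int int | Vertical int int

fun rect :: "domino \<Rightarrow> (real \<times> real) set" where
  "rect (Horizontal x y) = {of_int x .. of_int x + 2} \<times> {of_int y - 1 .. of_int y}"
| "rect (Vertical x y) = {of_int x .. of_int x + 1} \<times> {of_int y - 2 .. of_int y}"

fun north_going :: "domino \<Rightarrow> bool" where
  "north_going (Horizontal x y) \<longleftrightarrow> odd (x + y)"
| "north_going (Vertical x y) \<longleftrightarrow> False"

fun south_going :: "domino \<Rightarrow> bool" where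
  "south_going (Horizontal x y) \<longleftrightarrow> even (x + y)"
| "south_going (Vertical x y) \<longleftrightarrow> False"

fun east_going :: "domino \<Rightarrow> bool" where
  "east_going (Horizontal x y) \<longleftrightarrow> False"
| "east_going (Vertical x y) \<longleftrightarrow> odd (x + y)"

fun west_going :: "domino \<Rightarrow> bool" where
  "west_going (Horizontal x y) \<longleftrightarrow> False"
| "west_going (Vertical x y) \<longleftrightarrow> even (x + y)"

definition tiled_region :: "domino set \<Rightarrow> (real \<times> real) set" where
  "tiled_region T = (\<Union>d\<in>T. rect d)"

text \<open>The parameter \<open>l\<close> is half of the width of the strip.\<close>

definition strip_tiling :: "nat \<Rightarrow> domino set \<Rightarrow> bool" where
  "strip_tiling l T \<longleftrightarrow>
     (\<forall>d\<in>T. \<forall>d'\<in>T. d \<noteq> d' \<longrightarrow> interior (rect d) \<inter> interior (rect d') = {}) \<and>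
     {(x, y). \<bar>x - y - real l\<bar> \<le> real l - 1} \<subseteq> tiled_region T \<and>
     tiled_region T \<subseteq> {(x, y). \<bar>x - y - real l\<bar> \<le> real l + 1}"

definition steep :: "domino set \<Rightarrow> bool" where
  "steep T \<longleftrightarrow>
     (\<exists>B::real. \<forall>d\<in>T.
        (rect d \<subseteq> {(x, y). x + y > B} \<longrightarrow> north_going d \<or> east_going d) \<and>
        (rect d \<subseteq> {(x, y). x + y < - B} \<longrightarrow> south_going d \<or> west_going d))"

text \<open>\<open>unit_square a b\<close> is the closed unit square with bottom left corner \<open>(a, b)\<close>.\<close>

definition unit_square :: "real \<Rightarrow> real \<Rightarrow> (real \<times> real) set" where
  "unit_square a b = {a .. a + 1} \<times> {b .. b + 1}"

datatype sign = Plus | Minus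

text \<open>Letters of words are numbered from 1.\<close>

definition letter :: "sign list \<Rightarrow> nat \<Rightarrow> sign" where
  "letter w i = w ! (i - 1)"

text \<open>
  The unit squares below have bottom right corner \<open>(x, x - 2 k)\<close> and top left
  corner \<open>(x, x - 2 k + 2)\<close>, respectively.
\<close>

definition asymptotic_data :: "nat \<Rightarrow> domino set \<Rightarrow> sign list \<Rightarrow> bool" where
  "asymptotic_data l T w \<longleftrightarrow>
     length w = 2 * l \<and>
     (\<forall>k\<in>{1..l}.
        (\<forall>\<^sub>F x::int in at_top. \<exists>d\<in>T.
           unit_square (of_int x - 1) (of_int x - 2 * real k) \<subseteq> rect d \<and>
           (case letter w (2 * k - 1) of Plus \<Rightarrow> north_going d | Minus \<Rightarrow> east_going d)) \<and>
        (\<forall>\<^sub>F x::int in at_bot. \<exists>d\<in>T.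
           unit_square (of_int x) (of_int x - 2 * real k + 1) \<subseteq> rect d \<and>
           (case letter w (2 * k) of Plus \<Rightarrow> west_going d | Minus \<Rightarrow> south_going d)))"

definition half_integers :: "real set" where
  "half_integers = range (\<lambda>n::int. of_int n + 1 / 2)"

definition pure_tiling :: "nat \<Rightarrow> domino set \<Rightarrow> bool" where
  "pure_tiling l T \<longleftrightarrow>
     (\<exists>a\<in>half_integers. \<exists>b\<in>half_integers. \<forall>x\<in>half_integers.
        (unit_square (x - 1 / 2) (x - 1 / 2) \<subseteq> tiled_region T \<longleftrightarrow> x \<ge> a) \<and>
        (unit_square (x - 1 / 2) (x - 2 * real l - 1 / 2) \<subseteq> tiled_region T \<longleftrightarrow> x \<le> b))"

definition pure_steep_tilings :: "nat \<Rightarrow> sign list \<Rightarrow> domino set set" where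
  "pure_steep_tilings l w =
     {T. strip_tiling l T \<and> steep T \<and> asymptotic_data l T w \<and> pure_tiling l T}"

fun translate :: "int \<Rightarrow> domino \<Rightarrow> domino" where
  "translate n (Horizontal x y) = Horizontal (x + n) (y + n)"
| "translate n (Vertical x y) = Vertical (x + n) (y + n)"

definition translation_rel :: "nat \<Rightarrow> sign list \<Rightarrow> (domino set \<times> domino set) set" where
  "translation_rel l w =
     {(T, T'). T \<in> pure_steep_tilings l w \<and> T' \<in> pure_steep_tilings l w \<and>
               (\<exists>n. T' = translate n ` T)}"

definition pure_steep_classes :: "nat \<Rightarrow> sign list \<Rightarrow> domino set set set" where
  "pure_steep_classes l w = pure_steep_tilings l w // translation_rel l w"

definition flip :: "domino set \<Rightarrow> domino set \<Rightarrow> bool" where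
  "flip T T' \<longleftrightarrow>
     (\<exists>x y. let hs = {Horizontal x y, Horizontal x (y - 1)};
                vs = {Vertical x y, Vertical (x + 1) y}
            in hs \<subseteq> T \<and> T' = (T - hs) \<union> vs \<or> vs \<subseteq> T \<and> T' = (T - vs) \<union> hs)"

text \<open>
  Occupation is only meaningful at the sites of the strip, i.e. points with half-integer
  coordinates and \<open>0 \<le> x - y \<le> 2 l\<close>. At a site of a tiling of the strip, being empty is
  the same as not being occupied.
\<close>

definition occupied :: "domino set \<Rightarrow> real \<times> real \<Rightarrow> bool" where
  "occupied T p \<longleftrightarrow>
     (\<exists>d\<in>T. p \<in> rect d \<and> (south_going d \<or> west_going d)) \<or>
     (p \<notin> tiled_region T \<and> snd p = fst p)"

text \<open>
  \<open>front w m\<close> is the position of the boundary between occupied and empty sites on the line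
  \<open>y = x - m\<close> of the minimal tiling.
\<close>

fun front :: "sign list \<Rightarrow> nat \<Rightarrow> int" where
  "front w 0 = 0"
| "front w (Suc n) =
     front w n + (if letter w (Suc n) = (if odd (Suc n) then Plus else Minus) then 1 else 0)"

definition is_minimal_tiling :: "nat \<Rightarrow> sign list \<Rightarrow> domino set \<Rightarrow> bool" where
  "is_minimal_tiling l w T \<longleftrightarrow>
     strip_tiling l T \<and> steep T \<and> asymptotic_data l T w \<and>
     (\<forall>m\<in>{0..2 * l}. \<forall>x\<in>half_integers.
        occupied T (x, x - real m) \<longleftrightarrow> x < of_int (front w m))"

definition minimal_tiling :: "nat \<Rightarrow> sign list \<Rightarrow> domino set" where
  "minimal_tiling l w = (THE T. is_minimal_tiling l w T)"

text \<open>
  The minimal number of flips leading from the minimal tiling to some representative of the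
  class \<open>C\<close>; it is \<open>\<infinity>\<close> if no representative can be reached.
\<close>

definition flip_number :: "nat \<Rightarrow> sign list \<Rightarrow> domino set set \<Rightarrow> enat" where
  "flip_number l w C = (INF n\<in>{n. \<exists>T\<in>C. (flip ^^ n) (minimal_tiling l w) T}. enat n)"

definition classes_with_flips :: "nat \<Rightarrow> sign list \<Rightarrow> nat \<Rightarrow> domino set set set" where
  "classes_with_flips l w n = {C \<in> pure_steep_classes l w. flip_number l w C = enat n}"

definition tiling_gf :: "nat \<Rightarrow> sign list \<Rightarrow> rat fps" where
  "tiling_gf l w = Abs_fps (\<lambda>n. of_nat (card (classes_with_flips l w n)))"

end

theory Submission
  imports Defs
begin

text \<open>
  The particle configurations on the diagonals of a pure steep tiling are Maya diagrams of partitions, and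
  the dominos between two consecutive diagonals match their particles (or their holes) with shifts 0 or 1.
  This identifies tilings with sequences of partitions from the empty partition to itself, in which the
  \<open>i\<close>-th step adds (\<open>w\<^sub>i = +\<close>) or removes (\<open>w\<^sub>i = -\<close>) a horizontal strip if \<open>i\<close> is odd and a vertical strip
  if \<open>i\<close> is even. A flip adds or removes one box, and every sequence with a box has a removable one, so
  that the number of flips from the minimal tiling is the total number of boxes.

  The sequences are counted by commuting each adding step to the right of each removing step. Moving past
  one another, two steps of the same kind release a natural number and two steps of different kinds
  release a bit, which gives the factors \<open>1 / (1 - q^(j - i))\<close> and \<open>1 + q^(j - i)\<close>; when all removing steps come
  first, only the constant sequence is left.
\<close>

text \<open>Counting functions keep local changes local: both kinds of strips become inequalities
  between values at neighbouring points, and a flip changes a single value. The parts of the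
  partition matter only when two steps of the same kind are exchanged; there the largest part has no
  upper bound, which is why a natural number and not a bit is released. The total number of boxes is
  a poor weight for commuting steps: an exchange rule controls the sum of the old and the new middle
  partition, whereas the total changes by their difference. Therefore each step carries a label, and
  the weight is the sum over the steps of the label times the loss of boxes across the step.
  Exchanging steps labelled \<open>i\<close> and \<open>j\<close> that release \<open>k\<close>
  changes this weight by exactly \<open>(j - i) * k\<close>, wherever the steps stand at that
  moment; this is the origin of the exponents. Flip numbers are defined on translation classes, but
  a flip never changes the covered region. Hence only one normalised representative of each class
  can be reached from the minimal tiling, and the classes disappear from the count.\<close>

text \<open>A partition is encoded by the function that counts the particles of its Maya diagram (of charge 0)
  at positions \<open>\<ge> n\<close>; its value exceeds the one of the empty partition by the number of boxes of
  content \<open>n\<close>. In this encoding \<open>hstep\<close> and \<open>vstep\<close> are the additions of a horizontal and of a vertical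
  strip.\<close>

definition vac :: "int \<Rightarrow> int" where "vac n = max 0 (- n)"

definition is_state :: "(int \<Rightarrow> int) \<Rightarrow> bool" where
  "is_state h \<longleftrightarrow> (\<forall>n. h (n + 1) \<le> h n \<and> h n \<le> h (n + 1) + 1) \<and>
     (\<exists>N. \<forall>n. N \<le> \<bar>n\<bar> \<longrightarrow> h n = vac n)"

definition boxes :: "(int \<Rightarrow> int) \<Rightarrow> int" where
  "boxes h = (\<Sum>n | h n \<noteq> vac n. h n - vac n)"

definition hstep :: "(int \<Rightarrow> int) \<Rightarrow> (int \<Rightarrow> int) \<Rightarrow> bool" where
  "hstep a b \<longleftrightarrow> (\<forall>n. a n \<le> b n \<and> b n \<le> a (n + 1) + 1)"

definition vstep :: "(int \<Rightarrow> int) \<Rightarrow> (int \<Rightarrow> int) \<Rightarrow> bool" where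
  "vstep a b \<longleftrightarrow> (\<forall>n. a n \<le> b n \<and> b n \<le> a (n - 1))"

section \<open>Elementary bounds on the counting functions\<close>

lemma boxes_eq:
  assumes "\<And>n. N \<le> \<bar>n\<bar> \<Longrightarrow> h n = vac n"
  shows "boxes h = (\<Sum>n\<in>{- N..N}. h n - vac n)"
  unfolding boxes_def
proof (rule sum.mono_neutral_left)
  show "{n. h n \<noteq> vac n} \<subseteq> {- N..N}"
  proof
    fix n assume "n \<in> {n. h n \<noteq> vac n}"
    then have "\<not> N \<le> \<bar>n\<bar>" using assms by blast
    then show "n \<in> {- N..N}" by auto
  qed
qed auto

lemma is_state_vac: "is_state vac"
  by (auto simp: is_state_def vac_def)

lemma boxes_vac [simp]: "boxes vac = 0"
  by (simp add: boxes_def)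

lemma state_decseq:
  assumes "is_state h" "m \<le> n"
  shows "h n \<le> h m"
  using assms(2)
proof (induction n rule: int_ge_induct)
  case (step i)
  have "h (i + 1) \<le> h i" using assms(1) by (simp add: is_state_def)
  then show ?case using step by simp
qed simp

lemma state_lipschitz:
  assumes "is_state h" "m \<le> n"
  shows "h m \<le> h n + (n - m)"
  using assms(2)
proof (induction n rule: int_ge_induct)
  case (step i)
  have "h i \<le> h (i + 1) + 1" using assms(1) by (simp add: is_state_def)
  then show ?case using step by simp
qed simp

lemma state_bound:
  assumes "is_state h"
  obtains N where "N \<ge> 0" "\<And>n. N \<le> \<bar>n\<bar> \<Longrightarrow> h n = vac n"
proof -
  obtain N where N: "\<And>n. N \<le> \<bar>n\<bar> \<Longrightarrow> h n = vac n"
    using assms by (auto simp: is_state_def)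
  show ?thesis by (rule that[of "max 0 N"]) (use N in auto)
qed

text \<open>A state decreases to 0 on the far right, which gives \<open>0 \<le> h n\<close>;
  compared with the far left, where it equals minus the position, it drops by at most 1 per unit,
  which gives \<open>- n \<le> h n\<close>.\<close>

lemma state_ge_vac:
  assumes "is_state h"
  shows "vac n \<le> h n"
proof -
  obtain N where N: "N \<ge> 0" "\<And>n. N \<le> \<bar>n\<bar> \<Longrightarrow> h n = vac n"
    using state_bound[OF assms] by blast
  have "h (max N \<bar>n\<bar>) \<le> h n" by (rule state_decseq[OF assms]) auto
  moreover have "h (max N \<bar>n\<bar>) = 0" using N(2)[of "max N \<bar>n\<bar>"] N(1) by (auto simp: vac_def)
  moreover have "h (- max N \<bar>n\<bar>) \<le> h n + (n - (- max N \<bar>n\<bar>))"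
    by (rule state_lipschitz[OF assms]) auto
  moreover have "h (- max N \<bar>n\<bar>) = max N \<bar>n\<bar>" using N(2)[of "- max N \<bar>n\<bar>"] N(1) by (auto simp: vac_def)
  ultimately have "0 \<le> h n" "- n \<le> h n" by linarith+
  then show ?thesis by (simp add: vac_def)
qed

lemma state_nonneg: "is_state h \<Longrightarrow> 0 \<le> h n"
  using state_ge_vac[of h n] by (auto simp: vac_def)

lemma boxes_nonneg:
  assumes "is_state h" shows "0 \<le> boxes h"
  unfolding boxes_def by (rule sum_nonneg) (use state_ge_vac[OF assms] in auto)

lemma finite_excess:
  assumes "is_state h" shows "finite {n. h n \<noteq> vac n}"
proof -
  obtain N where N: "N \<ge> 0" "\<And>n. N \<le> \<bar>n\<bar> \<Longrightarrow> h n = vac n"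
    using state_bound[OF assms] by blast
  have "{n. h n \<noteq> vac n} \<subseteq> {- N..N}"
  proof
    fix n assume "n \<in> {n. h n \<noteq> vac n}"
    then have "\<not> N \<le> \<bar>n\<bar>" using N(2) by blast
    then show "n \<in> {- N..N}" by auto
  qed
  then show ?thesis by (rule finite_subset) simp
qed

lemma state_le_vac:
  assumes "is_state h" "\<And>n. h n \<le> vac n" shows "h = vac"
  using assms(2) state_ge_vac[OF assms(1)] by (intro ext antisym)

section \<open>Particle positions\<close>

text \<open>The position of the particle number \<open>i\<close> from the right, counted from 0; for
  a partition with parts \<open>p_0 \<ge> p_1 \<ge> ...\<close> it is \<open>p_i - i - 1\<close>.
  The lower bound in the set makes the maximum exist: it is the position of this particle in the
  vacuum, and in no state does the particle lie further left.\<close>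

definition pos :: "(int \<Rightarrow> int) \<Rightarrow> nat \<Rightarrow> int" where
  "pos h i = Max {n. - int i - 1 \<le> n \<and> int i < h n}"

text \<open>Through this equivalence \<open>h\<close> and \<open>pos h\<close> are two readings of
  one Young diagram, by contents and by rows; all translations between them use it.\<close>

lemma pos_iff:
  assumes "is_state h"
  shows "n \<le> pos h i \<longleftrightarrow> int i < h n"
proof -
  let ?S = "{n. - int i - 1 \<le> n \<and> int i < h n}"
  obtain N where N: "N \<ge> 0" "\<And>n. N \<le> \<bar>n\<bar> \<Longrightarrow> h n = vac n"
    using state_bound[OF assms] by blast
  have "?S \<subseteq> {- int i - 1..N}"
  proof
    fix n assume n: "n \<in> ?S"
    have "n \<le> N"
    proof (rule ccontr)
      assume "\<not> n \<le> N"
      then have "h n = 0" using N(1) N(2)[of n] by (auto simp: vac_def)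
      then show False using n by auto
    qed
    then show "n \<in> {- int i - 1..N}" using n by auto
  qed
  then have fin: "finite ?S" by (rule finite_subset) simp
  have mem: "- int i - 1 \<in> ?S" using state_ge_vac[OF assms, of "- int i - 1"] by (auto simp: vac_def)
  have P: "pos h i \<in> ?S" unfolding pos_def by (rule Max_in) (use fin mem in auto)
  have ub: "\<And>n. n \<in> ?S \<Longrightarrow> n \<le> pos h i" unfolding pos_def by (rule Max_ge[OF fin])
  show ?thesis
  proof
    assume "n \<le> pos h i"
    then have "h (pos h i) \<le> h n" by (rule state_decseq[OF assms])
    then show "int i < h n" using P by auto
  next
    assume "int i < h n"
    show "n \<le> pos h i"
    proof (cases "n < - int i - 1")
      case True
      then show ?thesis using P by auto
    next
      case False
      then show ?thesis using ub[of n] \<open>int i < h n\<close> by auto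
    qed
  qed
qed

definition is_pos :: "(nat \<Rightarrow> int) \<Rightarrow> bool" where
  "is_pos a \<longleftrightarrow> (\<forall>i. a (Suc i) < a i) \<and> (\<exists>M. \<forall>i\<ge>M. a i = - int i - 1)"

definition of_pos :: "(nat \<Rightarrow> int) \<Rightarrow> int \<Rightarrow> int" where
  "of_pos a n = int (card {i. n \<le> a i})"

lemma pos_eq_vac:
  assumes "is_state h" "\<And>n. int M \<le> \<bar>n\<bar> \<Longrightarrow> h n = vac n" "M \<le> i"
  shows "pos h i = - int i - 1"
proof -
  have "h (- int i) = int i" "h (- int i - 1) = int i + 1"
    using assms(2)[of "- int i"] assms(2)[of "- int i - 1"] assms(3) by (auto simp: vac_def)
  then have "- int i - 1 \<le> pos h i" "\<not> - int i \<le> pos h i"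
    by (simp_all add: pos_iff[OF assms(1)])
  then show ?thesis by simp
qed

lemma is_pos_pos:
  assumes "is_state h" shows "is_pos (pos h)"
proof -
  obtain N where N: "N \<ge> 0" "\<And>n. N \<le> \<bar>n\<bar> \<Longrightarrow> h n = vac n"
    using state_bound[OF assms] by blast
  have "pos h (Suc i) < pos h i" for i
  proof -
    have "int (Suc i) < h (pos h (Suc i))" using pos_iff[OF assms, of "pos h (Suc i)" "Suc i"] by simp
    moreover have "h (pos h (Suc i)) \<le> h (pos h (Suc i) + 1) + 1" using assms by (simp add: is_state_def)
    ultimately have "int i < h (pos h (Suc i) + 1)" by simp
    then have "pos h (Suc i) + 1 \<le> pos h i" by (simp only: pos_iff[OF assms])
    then show ?thesis by simp
  qed
  moreover have "\<forall>i\<ge>nat N. pos h i = - int i - 1"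
    using pos_eq_vac[OF assms, of "nat N"] N by auto
  ultimately show ?thesis unfolding is_pos_def by blast
qed

lemma of_pos_iff:
  assumes "is_pos a"
  shows "int i < of_pos a n \<longleftrightarrow> n \<le> a i"
proof -
  obtain M where M: "\<And>i. i \<ge> M \<Longrightarrow> a i = - int i - 1" using assms by (auto simp: is_pos_def)
  have dec: "a (Suc i) < a i" for i using assms by (simp add: is_pos_def)
  have anti: "i \<le> j \<Longrightarrow> a j \<le> a i" for i j
    by (rule lift_Suc_antimono_le[of a]) (use dec less_imp_le in auto)
  \<comment> \<open>Since \<open>a\<close> decreases, the indices with \<open>n \<le> a i\<close>
    form an initial segment, and \<open>k\<close> is its length.\<close>
  define k where "k = (LEAST i. a i < n)"
  have ex: "a (M + nat \<bar>n\<bar>) < n" using M[of "M + nat \<bar>n\<bar>"] by auto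
  have k: "a k < n" unfolding k_def by (rule LeastI[of "\<lambda>i. a i < n", OF ex])
  have below: "i < k \<Longrightarrow> n \<le> a i" for i using not_less_Least[of i "\<lambda>i. a i < n"] k_def by auto
  have "{i. n \<le> a i} = {..<k}"
  proof (intro set_eqI iffI)
    fix i assume "i \<in> {i. n \<le> a i}"
    then have "\<not> k \<le> i" using anti[of k i] k by auto
    then show "i \<in> {..<k}" by auto
  qed (use below in auto)
  then have "of_pos a n = int k" "n \<le> a i \<longleftrightarrow> i < k" by (auto simp: of_pos_def)
  then show ?thesis by simp
qed

text \<open>Counts are compared level by level, the form in which \<open>pos_iff\<close> and
  \<open>of_pos_iff\<close> apply.\<close>

lemma int_le_via_nat:
  assumes "0 \<le> (y::int)" "\<And>i. int i < x \<Longrightarrow> int i < y"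
  shows "x \<le> y"
proof (rule ccontr)
  assume "\<not> x \<le> y"
  then have "int (nat y) < x" using assms(1) by simp
  then show False using assms(2)[of "nat y"] assms(1) by simp
qed

lemma of_pos_nonneg: "0 \<le> of_pos a n" by (simp add: of_pos_def)

lemma is_state_of_pos:
  assumes "is_pos a" shows "is_state (of_pos a)"
proof -
  obtain M where M: "\<And>i. i \<ge> M \<Longrightarrow> a i = - int i - 1" using assms by (auto simp: is_pos_def)
  have dec: "a (Suc i) < a i" for i using assms by (simp add: is_pos_def)
  have anti: "i \<le> j \<Longrightarrow> a j \<le> a i" for i j
    by (rule lift_Suc_antimono_le[of a]) (use dec less_imp_le in auto)
  have 1: "of_pos a (n + 1) \<le> of_pos a n" for n
    by (rule int_le_via_nat) (auto simp: of_pos_nonneg of_pos_iff[OF assms])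
  have 2: "of_pos a n \<le> of_pos a (n + 1) + 1" for n
  proof (rule int_le_via_nat)
    fix i assume i: "int i < of_pos a n"
    show "int i < of_pos a (n + 1) + 1"
    proof (cases i)
      case 0
      then show ?thesis using of_pos_nonneg[of a "n + 1"] by simp
    next
      case (Suc j)
      have "n \<le> a (Suc j)" using i Suc of_pos_iff[OF assms, of "Suc j" n] by simp
      then have "n + 1 \<le> a j" using dec[of j] by simp
      then have "int j < of_pos a (n + 1)" using of_pos_iff[OF assms] by simp
      then show ?thesis using Suc by simp
    qed
  qed (use of_pos_nonneg[of a "n + 1"] in simp)
  have 3: "of_pos a n = vac n" if n: "\<bar>a 0\<bar> + int M + 1 \<le> \<bar>n\<bar>" for n
  proof (cases "n \<ge> 0")
    case True
    have "\<not> int 0 < of_pos a n" using of_pos_iff[OF assms, of 0 n] True n by auto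
    then show ?thesis using True of_pos_nonneg[of a n] by (simp add: vac_def)
  next
    case False
    have "i < nat (- n) \<longleftrightarrow> n \<le> a i" for i
    proof
      assume "n \<le> a i"
      show "i < nat (- n)"
      proof (rule ccontr)
        assume "\<not> i < nat (- n)"
        then have "M \<le> i" "- int i - 1 < n" using n False by auto
        then show False using M[of i] \<open>n \<le> a i\<close> by auto
      qed
    next
      assume i: "i < nat (- n)"
      have "a (nat (- n - 1)) = n" using M[of "nat (- n - 1)"] n False by auto
      then show "n \<le> a i" using anti[of i "nat (- n - 1)"] i by auto
    qed
    then have "{i. n \<le> a i} = {..<nat (- n)}" by blast
    then show ?thesis using False by (simp add: of_pos_def vac_def)
  qed
  show ?thesis unfolding is_state_def using 1 2 3 by blast
qed

lemma pos_of_pos: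
  assumes "is_pos a" shows "pos (of_pos a) = a"
proof
  fix i
  have "n \<le> pos (of_pos a) i \<longleftrightarrow> n \<le> a i" for n
    by (simp add: pos_iff[OF is_state_of_pos[OF assms]] of_pos_iff[OF assms])
  then show "pos (of_pos a) i = a i" by (meson order_antisym order_refl)
qed

lemma of_pos_pos:
  assumes "is_state h" shows "of_pos (pos h) = h"
proof
  fix n
  have "int i < of_pos (pos h) n \<longleftrightarrow> int i < h n" for i
    by (simp add: pos_iff[OF assms] of_pos_iff[OF is_pos_pos[OF assms]])
  then show "of_pos (pos h) n = h n"
    using int_le_via_nat[OF of_pos_nonneg, of "h n" "pos h" n]
      int_le_via_nat[OF state_nonneg[OF assms], of "of_pos (pos h) n" n] by simp
qed

text \<open>Double counting: row \<open>i\<close> has a box of content \<open>n\<close> exactly if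
  \<open>- int i - 1 < n \<and> n \<le> pos h i\<close>, and the boxes are summed by contents on one
  side and by rows on the other.\<close>

lemma boxes_pos:
  assumes h: "is_state h" and M: "\<And>i. i \<ge> M \<Longrightarrow> pos h i = - int i - 1"
  shows "boxes h = (\<Sum>i<M. pos h i + int i + 1)"
proof -
  obtain N0 where N0: "N0 \<ge> 0" "\<And>n. N0 \<le> \<bar>n\<bar> \<Longrightarrow> h n = vac n"
    using state_bound[OF h] by blast
  define N where "N = max M (nat N0)"
  have N: "\<And>n. int N \<le> \<bar>n\<bar> \<Longrightarrow> h n = vac n" using N0 by (auto simp: N_def)
  have hN: "h (- int N) = int N" "h (int N) = 0" using N[of "- int N"] N[of "int N"] by (auto simp: vac_def)
  have row: "(\<Sum>n\<in>{- int N..int N}. of_bool (- int i - 1 < n \<and> n \<le> pos h i)) = pos h i + int i + 1"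
    if "i < N" for i
  proof -
    have "\<not> int N \<le> pos h i" using hN(2) by (simp add: pos_iff[OF h])
    then have "{- int N..int N} \<inter> {n. - int i - 1 < n \<and> n \<le> pos h i} = {- int i..pos h i}"
      using that by auto
    moreover have "- int i - 1 \<le> pos h i"
      unfolding pos_iff[OF h] using state_ge_vac[OF h, of "- int i - 1"] by (auto simp: vac_def)
    ultimately show ?thesis by simp
  qed
  have col: "(\<Sum>i<N. of_bool (- int i - 1 < n \<and> n \<le> pos h i)) = h n - vac n"
    if "n \<in> {- int N..int N}" for n
  proof -
    have "h n \<le> int N" using state_decseq[OF h, of "- int N" n] hN that by auto
    then have E: "{..<N} \<inter> {i. - int i - 1 < n \<and> n \<le> pos h i} = {nat (vac n)..<nat (h n)}"
      using state_nonneg[OF h, of n] by (auto simp: pos_iff[OF h] vac_def)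
    have "(\<Sum>i<N. of_bool (- int i - 1 < n \<and> n \<le> pos h i)) = int (card {nat (vac n)..<nat (h n)})"
      by (subst sum_of_bool_eq) (simp_all only: E finite_lessThan)
    moreover have "0 \<le> vac n" by (simp add: vac_def)
    ultimately show ?thesis using state_ge_vac[OF h, of n] by simp
  qed
  have "boxes h = (\<Sum>n\<in>{- int N..int N}. h n - vac n)" using N by (rule boxes_eq)
  also have "\<dots> = (\<Sum>n\<in>{- int N..int N}. \<Sum>i<N. of_bool (- int i - 1 < n \<and> n \<le> pos h i))"
    by (rule sum.cong) (use col in auto)
  also have "\<dots> = (\<Sum>i<N. \<Sum>n\<in>{- int N..int N}. of_bool (- int i - 1 < n \<and> n \<le> pos h i))"
    by (rule sum.swap)
  also have "\<dots> = (\<Sum>i<N. pos h i + int i + 1)"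
    by (rule sum.cong) (use row in auto)
  also have "\<dots> = (\<Sum>i<M. pos h i + int i + 1)"
    by (rule sum.mono_neutral_right) (use M in \<open>auto simp: N_def\<close>)
  finally show ?thesis .
qed

section \<open>Exchange of two steps of the same kind\<close>

text \<open>For parts this is the interlacing
  \<open>b_0 \<ge> a_0 \<ge> b_1 \<ge> a_1 \<ge> ...\<close>; the second inequality becomes strict
  because positions are parts shifted by the row index.\<close>

lemma hstep_iff_pos:
  assumes a: "is_state a" and b: "is_state b"
  shows "hstep a b \<longleftrightarrow> (\<forall>i. pos a i \<le> pos b i \<and> pos b (Suc i) < pos a i)"
proof
  assume H: "hstep a b"
  show "\<forall>i. pos a i \<le> pos b i \<and> pos b (Suc i) < pos a i"
  proof (intro allI conjI)
    fix i
    have "int i < a (pos a i)" by (simp flip: pos_iff[OF a])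
    also have "\<dots> \<le> b (pos a i)" using H by (simp add: hstep_def)
    finally show "pos a i \<le> pos b i" by (simp add: pos_iff[OF b])
    have "int (Suc i) < b (pos b (Suc i))" using pos_iff[OF b, of "pos b (Suc i)" "Suc i"] by simp
    also have "\<dots> \<le> a (pos b (Suc i) + 1) + 1" using H by (simp add: hstep_def)
    finally have "pos b (Suc i) + 1 \<le> pos a i" unfolding pos_iff[OF a] by simp
    then show "pos b (Suc i) < pos a i" by simp
  qed
next
  assume P: "\<forall>i. pos a i \<le> pos b i \<and> pos b (Suc i) < pos a i"
  show "hstep a b" unfolding hstep_def
  proof (intro allI conjI)
    fix n
    show "a n \<le> b n"
    proof (rule int_le_via_nat[OF state_nonneg[OF b]])
      fix i assume "int i < a n"
      then have "n \<le> pos a i" by (simp add: pos_iff[OF a])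
      then have "n \<le> pos b i" using P order_trans by blast
      then show "int i < b n" by (simp add: pos_iff[OF b])
    qed
    show "b n \<le> a (n + 1) + 1"
    proof (rule int_le_via_nat)
      show "0 \<le> a (n + 1) + 1" using state_nonneg[OF a, of "n + 1"] by simp
      fix i assume i: "int i < b n"
      show "int i < a (n + 1) + 1"
      proof (cases i)
        case 0
        then show ?thesis using state_nonneg[OF a, of "n + 1"] by simp
      next
        case (Suc j)
        then have "n \<le> pos b (Suc j)" using i by (simp add: pos_iff[OF b])
        then have "n + 1 \<le> pos a j" using P[rule_format, of j] by simp
        then have "int j < a (n + 1)" by (simp only: pos_iff[OF a])
        then show ?thesis using Suc by simp
      qed
    qed
  qed
qed

text \<open>\<open>A\<close> will be the set of possible middle elements of an increasing step followed by a decreasing one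
  between two fixed partitions, \<open>B\<close> the same with the two steps in the other order.\<close>

definition exchange :: "(int \<Rightarrow> int) set \<Rightarrow> (int \<Rightarrow> int) set \<Rightarrow> nat set \<Rightarrow> int \<Rightarrow> bool" where
  "exchange A B K s \<longleftrightarrow>
     (\<exists>f. bij_betw f A (B \<times> K) \<and> (\<forall>x\<in>A. boxes x + boxes (fst (f x)) = s + int (snd (f x))))"

text \<open>Interlacing confines \<open>pos nu (Suc i)\<close> to the integers from
  \<open>mx (Suc i)\<close> up to \<open>mn i - 1\<close>, and \<open>pos ka i\<close> to the same
  interval moved up by one. The reflection \<open>b\<close> is a bijection between the two. Only
  \<open>pos nu 0\<close> has no upper bound, and its excess over \<open>mx 0\<close> is the
  released number.\<close>

lemma exchange_hstep:
  assumes la: "is_state la" and mu: "is_state mu"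
  shows "exchange {nu. is_state nu \<and> hstep la nu \<and> hstep mu nu}
    {ka. is_state ka \<and> hstep ka la \<and> hstep ka mu} UNIV (boxes la + boxes mu)"
    (is "exchange ?A ?B _ _")
proof -
  define mx where "mx i = max (pos la i) (pos mu i)" for i
  define mn where "mn i = min (pos la i) (pos mu i)" for i
  define b where "b c i = mx (Suc i) + mn i - c i" for c :: "nat \<Rightarrow> int" and i
  define up where "up c k = case_nat (mx 0 + int k) (b c)" for c k
  define f where "f nu = (of_pos (b (\<lambda>i. pos nu (Suc i))), nat (pos nu 0 - mx 0))" for nu
  define g where "g = (\<lambda>(ka, k). of_pos (up (pos ka) k))"
  obtain M1 where M1: "\<And>i. i \<ge> M1 \<Longrightarrow> pos la i = - int i - 1"
    using is_pos_pos[OF la] by (auto simp: is_pos_def)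
  obtain M2 where M2: "\<And>i. i \<ge> M2 \<Longrightarrow> pos mu i = - int i - 1"
    using is_pos_pos[OF mu] by (auto simp: is_pos_def)
  have dec: "pos la (Suc i) < pos la i" "pos mu (Suc i) < pos mu i" for i
    using is_pos_pos[OF la] is_pos_pos[OF mu] by (auto simp: is_pos_def)
  have mm: "mn i \<le> mx i" "mx i + mn i = pos la i + pos mu i" for i by (auto simp: mx_def mn_def)
  have A_iff: "nu \<in> ?A \<longleftrightarrow> is_state nu \<and> (\<forall>i. mx i \<le> pos nu i \<and> pos nu (Suc i) < mn i)" for nu
    using hstep_iff_pos[OF la] hstep_iff_pos[OF mu] by (auto simp: mx_def mn_def)
  have B_iff: "ka \<in> ?B \<longleftrightarrow> is_state ka \<and> (\<forall>i. mx (Suc i) < pos ka i \<and> pos ka i \<le> mn i)" for ka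
    using hstep_iff_pos[OF _ la] hstep_iff_pos[OF _ mu] by (auto simp: mx_def mn_def)
  have pos_b: "is_pos (b c)" if c: "\<And>i. mx (Suc i) \<le> c i \<and> c i < mn i" "\<exists>M. \<forall>i\<ge>M. c i = - int i - 2" for c
  proof -
    obtain M where M: "\<And>i. i \<ge> M \<Longrightarrow> c i = - int i - 2" using c(2) by auto
    have "b c (Suc i) < b c i" for i using c(1)[of i] c(1)[of "Suc i"] mm(1)[of "Suc i"] by (simp add: b_def)
    moreover have "b c i = - int i - 1" if "i \<ge> max M (max M1 M2)" for i
      using M[of i] M1[of i] M1[of "Suc i"] M2[of i] M2[of "Suc i"] that by (simp add: b_def mx_def mn_def)
    ultimately show ?thesis unfolding is_pos_def by blast
  qed
  have pos_up: "is_pos (up c k)" if c: "\<And>i. mx (Suc i) < c i \<and> c i \<le> mn i" "\<exists>M. \<forall>i\<ge>M. c i = - int i - 1" for c k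
  proof -
    obtain M where M: "\<And>i. i \<ge> M \<Longrightarrow> c i = - int i - 1" using c(2) by auto
    have "up c k (Suc i) < up c k i" for i
    proof (cases i)
      case 0
      then show ?thesis using c(1)[of 0] mm(1)[of 0] by (simp add: up_def b_def)
    next
      case (Suc j)
      then show ?thesis using c(1)[of j] c(1)[of i] mm(1)[of i] by (simp add: up_def b_def)
    qed
    moreover have "up c k i = - int i - 1" if i: "i \<ge> Suc (max M (max M1 M2))" for i
    proof -
      obtain j where j: "i = Suc j" "j \<ge> max M (max M1 M2)" using i by (metis Suc_le_D Suc_le_mono)
      then show ?thesis
        using M[of j] M1[of j] M1[of "Suc j"] M2[of j] M2[of "Suc j"] by (simp add: up_def b_def mx_def mn_def)
    qed
    ultimately show ?thesis unfolding is_pos_def by blast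
  qed
  have fA: "is_pos (b (\<lambda>i. pos nu (Suc i)))" if "nu \<in> ?A" for nu
  proof (rule pos_b)
    have "is_pos (pos nu)" using is_pos_pos that by simp
    then obtain M where "\<And>i. i \<ge> M \<Longrightarrow> pos nu i = - int i - 1"
      unfolding is_pos_def by blast
    then show "\<exists>M. \<forall>i\<ge>M. pos nu (Suc i) = - int i - 2" by (intro exI[of _ M]) simp
  qed (use that A_iff in blast)
  have gB: "is_pos (up (pos ka) k)" if "ka \<in> ?B" for ka k
  proof (rule pos_up)
    show "\<exists>M. \<forall>i\<ge>M. pos ka i = - int i - 1"
      using is_pos_pos that by (auto simp: is_pos_def)
  qed (use that B_iff in blast)
  have bij: "bij_betw f ?A (?B \<times> UNIV)"
  proof (rule bij_betw_byWitness[where f' = g])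
    show "\<forall>nu\<in>?A. g (f nu) = nu"
    proof
      fix nu assume nu: "nu \<in> ?A"
      have "up (b (\<lambda>i. pos nu (Suc i))) (nat (pos nu 0 - mx 0)) i = pos nu i" for i
        using nu A_iff by (cases i) (auto simp: up_def b_def)
      then have "up (b (\<lambda>i. pos nu (Suc i))) (nat (pos nu 0 - mx 0)) = pos nu" by blast
      then show "g (f nu) = nu" using nu by (simp add: f_def g_def pos_of_pos[OF fA[OF nu]] of_pos_pos)
    qed
    show "\<forall>x\<in>?B \<times> UNIV. f (g x) = x"
    proof
      fix x assume "x \<in> ?B \<times> (UNIV :: nat set)"
      then obtain ka k where x: "x = (ka, k)" and ka: "ka \<in> ?B" by auto
      have "b (\<lambda>i. up (pos ka) k (Suc i)) = pos ka" by (rule ext) (simp add: b_def up_def)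
      then show "f (g x) = x"
        using ka by (simp add: x f_def g_def pos_of_pos[OF gB[OF ka]] of_pos_pos) (simp add: up_def)
    qed
    show "f ` ?A \<subseteq> ?B \<times> UNIV"
    proof (rule image_subsetI)
      fix nu assume nu: "nu \<in> ?A"
      have "mx (Suc i) < b (\<lambda>i. pos nu (Suc i)) i \<and> b (\<lambda>i. pos nu (Suc i)) i \<le> mn i" for i
        using nu A_iff[of nu] by (auto simp: b_def)
      then have "of_pos (b (\<lambda>i. pos nu (Suc i))) \<in> ?B"
        unfolding B_iff using is_state_of_pos[OF fA[OF nu]] by (simp add: pos_of_pos[OF fA[OF nu]])
      then show "f nu \<in> ?B \<times> UNIV" by (simp add: f_def)
    qed
    show "g ` (?B \<times> UNIV) \<subseteq> ?A"
    proof (rule image_subsetI)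
      fix x assume "x \<in> ?B \<times> (UNIV :: nat set)"
      then obtain ka k where x: "x = (ka, k)" and ka: "ka \<in> ?B" by auto
      have kb: "mx (Suc i) < pos ka i \<and> pos ka i \<le> mn i" for i using ka B_iff by blast
      have "mx i \<le> up (pos ka) k i \<and> up (pos ka) k (Suc i) < mn i" for i
        using kb[of i] kb[of "i - 1"] by (cases i) (auto simp: up_def b_def)
      then show "g x \<in> ?A"
        unfolding A_iff using is_state_of_pos[OF gB[OF ka, of k]]
        by (simp add: x g_def pos_of_pos[OF gB[OF ka, of k]])
    qed
  qed
  moreover have "boxes nu + boxes (fst (f nu)) = boxes la + boxes mu + int (snd (f nu))" if nu: "nu \<in> ?A" for nu
  proof -
    let ?ka = "fst (f nu)"
    have st: "is_state nu" "is_state ?ka" using nu is_state_of_pos[OF fA[OF nu]] by (auto simp: f_def)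
    have pk: "pos ?ka i = mx (Suc i) + mn i - pos nu (Suc i)" for i
      by (simp add: f_def pos_of_pos[OF fA[OF nu]] b_def)
    obtain M3 where M3: "\<And>i. i \<ge> M3 \<Longrightarrow> pos nu i = - int i - 1"
      using is_pos_pos[OF st(1)] by (auto simp: is_pos_def)
    define M where "M = max M3 (max M1 M2)"
    have M: "\<And>i. i \<ge> M \<Longrightarrow> pos la i = - int i - 1" "\<And>i. i \<ge> M \<Longrightarrow> pos mu i = - int i - 1"
      "\<And>i. i \<ge> M \<Longrightarrow> pos nu i = - int i - 1" using M1 M2 M3 by (auto simp: M_def)
    have Mk: "\<And>i. i \<ge> M \<Longrightarrow> pos ?ka i = - int i - 1"
      by (simp add: pk mx_def mn_def M)
    have "boxes nu = (\<Sum>i<Suc M. pos nu i + int i + 1)" by (rule boxes_pos[OF st(1)]) (use M in auto)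
    also have "\<dots> = pos nu 0 + 1 + (\<Sum>i<M. pos nu (Suc i) + int (Suc i) + 1)"
      by (subst sum.lessThan_Suc_shift) simp
    finally have 1: "boxes nu = pos nu 0 + 1 + (\<Sum>i<M. pos nu (Suc i) + int i + 2)" by (simp add: algebra_simps)
    have 2: "boxes ?ka = (\<Sum>i<M. pos ?ka i + int i + 1)" by (rule boxes_pos[OF st(2) Mk])
    have 3: "boxes la = (\<Sum>i<M. pos la i + int i + 1)" "boxes mu = (\<Sum>i<M. pos mu i + int i + 1)"
      using boxes_pos[OF la, of M] boxes_pos[OF mu, of M] M by auto
    have mxM: "mx M = - int M - 1" using M by (simp add: mx_def)
    \<comment> \<open>The reflections involve \<open>mx\<close> from index 1 on. Adding the missing
      term at index 0 consumes \<open>mx 0 + 1\<close>, so that of \<open>pos nu 0 + 1\<close> just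
      the released number remains.\<close>
    have shift: "(\<Sum>i<M. mx (Suc i) + int i + 2) + (mx 0 + 1) = (\<Sum>i<M. mx i + int i + 1)"
    proof -
      have "(\<Sum>i<Suc M. mx i + int i + 1) = mx 0 + 1 + (\<Sum>i<M. mx (Suc i) + int (Suc i) + 1)"
        by (subst sum.lessThan_Suc_shift) simp
      then show ?thesis using mxM by (simp add: algebra_simps)
    qed
    have "boxes nu + boxes ?ka = pos nu 0 + 1 + (\<Sum>i<M. (mx (Suc i) + int i + 2) + (mn i + int i + 1))"
      unfolding 1 2 pk by (simp flip: sum.distrib add: algebra_simps)
    also have "\<dots> = pos nu 0 - mx 0 + (\<Sum>i<M. (mx i + int i + 1) + (mn i + int i + 1))"
      unfolding sum.distrib[of "\<lambda>i. mx (Suc i) + int i + 2"] sum.distrib[of "\<lambda>i. mx i + int i + 1"] using shift by linarith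
    also have "(\<Sum>i<M. (mx i + int i + 1) + (mn i + int i + 1)) = (\<Sum>i<M. (pos la i + int i + 1) + (pos mu i + int i + 1))"
      by (rule sum.cong) (use mm(2) in \<open>auto simp: algebra_simps\<close>)
    also have "\<dots> = boxes la + boxes mu" unfolding 3 sum.distrib[of "\<lambda>i. pos la i + int i + 1"] ..
    finally show ?thesis using nu A_iff[of nu] by (simp add: f_def)
  qed
  ultimately show ?thesis unfolding exchange_def by blast
qed

section \<open>Transposition of partitions\<close>

text \<open>In charge 0, \<open>h (- n) - n\<close> is the number of holes below \<open>- n\<close>.
  This counts particles at positions \<open>\<ge> n\<close> after the reflection
  \<open>a \<mapsto> - 1 - a\<close> combined with the swap of particles and holes, which transposes
  the partition.\<close>

definition conj_state :: "(int \<Rightarrow> int) \<Rightarrow> int \<Rightarrow> int" where "conj_state h n = h (- n) - n"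

lemma conj_conj [simp]: "conj_state (conj_state h) = h"
  by (rule ext) (simp add: conj_state_def)

lemma vac_uminus: "vac (- n) = vac n + n" by (simp add: vac_def)

lemma is_state_conj:
  assumes "is_state h" shows "is_state (conj_state h)"
proof -
  obtain N where N: "N \<ge> 0" "\<And>n. N \<le> \<bar>n\<bar> \<Longrightarrow> h n = vac n"
    using state_bound[OF assms] by blast
  have "conj_state h (n + 1) \<le> conj_state h n \<and> conj_state h n \<le> conj_state h (n + 1) + 1" for n
  proof -
    have "h (- n - 1 + 1) \<le> h (- n - 1) \<and> h (- n - 1) \<le> h (- n - 1 + 1) + 1"
      using assms unfolding is_state_def by blast
    then show ?thesis by (simp add: conj_state_def)
  qed
  moreover have "conj_state h n = vac n" if "N \<le> \<bar>n\<bar>" for n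
    using N(2)[of "- n"] that by (simp add: conj_state_def vac_uminus)
  ultimately show ?thesis unfolding is_state_def by blast
qed

lemma boxes_conj:
  assumes "is_state h" shows "boxes (conj_state h) = boxes h"
proof -
  obtain N where N: "N \<ge> 0" "\<And>n. N \<le> \<bar>n\<bar> \<Longrightarrow> h n = vac n"
    using state_bound[OF assms] by blast
  have "conj_state h n = vac n" if "N \<le> \<bar>n\<bar>" for n
    using N(2)[of "- n"] that by (simp add: conj_state_def vac_uminus)
  then have "boxes (conj_state h) = (\<Sum>n\<in>{- N..N}. conj_state h n - vac n)" by (rule boxes_eq)
  also have "\<dots> = (\<Sum>n\<in>{- N..N}. h n - vac n)"
    by (rule sum.reindex_bij_witness[of _ uminus uminus]) (auto simp: conj_state_def vac_uminus)
  also have "\<dots> = boxes h" by (rule boxes_eq[symmetric]) (rule N(2))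
  finally show ?thesis .
qed

lemma hstep_conj: "hstep (conj_state a) (conj_state b) \<longleftrightarrow> vstep a b"
proof -
  have "hstep (conj_state a) (conj_state b) \<longleftrightarrow> (\<forall>n. a (- n) \<le> b (- n) \<and> b (- n) \<le> a (- n - 1))"
    by (simp add: hstep_def conj_state_def algebra_simps)
  also have "\<dots> \<longleftrightarrow> vstep a b" unfolding vstep_def by (metis minus_minus)
  finally show ?thesis .
qed

lemma exchange_vstep:
  assumes la: "is_state la" and mu: "is_state mu"
  shows "exchange {nu. is_state nu \<and> vstep la nu \<and> vstep mu nu}
    {ka. is_state ka \<and> vstep ka la \<and> vstep ka mu} UNIV (boxes la + boxes mu)"
    (is "exchange ?A ?B _ _")
proof -
  let ?c = conj_state
  let ?A' = "{nu. is_state nu \<and> hstep (?c la) nu \<and> hstep (?c mu) nu}"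
  let ?B' = "{ka. is_state ka \<and> hstep ka (?c la) \<and> hstep ka (?c mu)}"
  obtain f where f: "bij_betw f ?A' (?B' \<times> UNIV)"
    and fs: "\<And>x. x \<in> ?A' \<Longrightarrow> boxes x + boxes (fst (f x)) = boxes (?c la) + boxes (?c mu) + int (snd (f x))"
    using exchange_hstep[OF is_state_conj[OF la] is_state_conj[OF mu]] unfolding exchange_def by blast
  have A: "?c x \<in> ?A'" if "x \<in> ?A" for x
    using that by (simp add: is_state_conj hstep_conj)
  have A2: "?c x \<in> ?A" if "x \<in> ?A'" for x
    using that by (simp add: is_state_conj flip: hstep_conj)
  have B: "?c x \<in> ?B" if "x \<in> ?B'" for x
    using that by (simp add: is_state_conj flip: hstep_conj)
  have B2: "?c x \<in> ?B'" if "x \<in> ?B" for x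
    using that by (simp add: is_state_conj hstep_conj)
  have 1: "bij_betw ?c ?A ?A'" by (rule bij_betw_byWitness[where f' = ?c]) (use A A2 in auto)
  have 2: "bij_betw (map_prod ?c id) (?B' \<times> (UNIV :: nat set)) (?B \<times> UNIV)"
    by (rule bij_betw_byWitness[where f' = "map_prod ?c id"]) (use B B2 in auto)
  have "bij_betw (map_prod ?c id \<circ> f \<circ> ?c) ?A (?B \<times> UNIV)"
    using bij_betw_trans[OF 1 bij_betw_trans[OF f 2]] by (simp add: o_assoc)
  moreover have "boxes x + boxes (fst ((map_prod ?c id \<circ> f \<circ> ?c) x)) =
      boxes la + boxes mu + int (snd ((map_prod ?c id \<circ> f \<circ> ?c) x))" if x: "x \<in> ?A" for x
  proof -
    have "f (?c x) \<in> ?B' \<times> UNIV" using bij_betwE[OF f] A[OF x] by blast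
    then have "is_state (fst (f (?c x)))" by auto
    then show ?thesis using fs[OF A[OF x]] x la mu by (simp add: boxes_conj)
  qed
  ultimately show ?thesis unfolding exchange_def by blast
qed

section \<open>Exchange of a horizontal and a vertical step\<close>

lemma sum_telescope_int:
  fixes f :: "int \<Rightarrow> int"
  assumes "a \<le> b"
  shows "(\<Sum>n\<in>{a..b}. f (n + 1) - f n) = f (b + 1) - f a"
  using assms
proof (induction b rule: int_ge_induct)
  case base
  then show ?case by simp
next
  case (step i)
  have "{a..i + 1} = insert (i + 1) {a..i}" using step.hyps by auto
  then show ?case using step by simp
qed

lemma boxes_add_indicator:
  assumes "\<And>n. N \<le> \<bar>n\<bar> \<Longrightarrow> h n = vac n" and "X \<subseteq> {- N<..<N}"
  shows "boxes (\<lambda>n. h n + c * of_bool (n \<in> X)) = boxes h + c * int (card X)"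
proof -
  have "boxes (\<lambda>n. h n + c * of_bool (n \<in> X)) = (\<Sum>n\<in>{- N..N}. h n + c * of_bool (n \<in> X) - vac n)"
  proof (rule boxes_eq)
    fix n assume n: "N \<le> \<bar>n\<bar>"
    have "n \<in> {- N<..<N}" if "n \<in> X" using assms(2) that by blast
    then have "n \<notin> X" using n by fastforce
    then show "h n + c * of_bool (n \<in> X) = vac n" using assms(1)[OF n] by simp
  qed
  also have "\<dots> = (\<Sum>n\<in>{- N..N}. h n - vac n) + c * (\<Sum>n\<in>{- N..N}. of_bool (n \<in> X))"
    by (simp add: sum.distrib sum_subtractf sum_distrib_left)
  also have "(\<Sum>n\<in>{- N..N}. of_bool (n \<in> X)) = int (card X)"
  proof -
    have "{- N..N} \<inter> {n. n \<in> X} = X" using assms(2) by auto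
    then show ?thesis by (subst sum_of_bool_eq) simp_all
  qed
  also have "(\<Sum>n\<in>{- N..N}. h n - vac n) = boxes h" using boxes_eq[OF assms(1)] by simp
  finally show ?thesis .
qed

lemma bij_betw_indicator:
  fixes L :: "int \<Rightarrow> int"
  assumes "c \<noteq> 0"
  shows "bij_betw (\<lambda>h. {n. h n \<noteq> L n}) {h. \<forall>n. h n = L n \<or> n \<in> F \<and> h n = L n + c} (Pow F)"
    and "bij_betw (\<lambda>X n. L n + c * of_bool (n \<in> X)) (Pow F) {h. \<forall>n. h n = L n \<or> n \<in> F \<and> h n = L n + c}"
proof -
  let ?H = "{h. \<forall>n. h n = L n \<or> n \<in> F \<and> h n = L n + c}"
  let ?i = "\<lambda>X n. L n + c * of_bool (n \<in> X)" and ?d = "\<lambda>h. {n. h n \<noteq> L n}"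
  have 1: "?i (?d h) = h" if "h \<in> ?H" for h
  proof
    fix n show "?i (?d h) n = h n" using that by (cases "h n = L n") auto
  qed
  have 2: "?d (?i X) = X" for X using assms by auto
  have 3: "?i ` Pow F \<subseteq> ?H" "?d ` ?H \<subseteq> Pow F" by auto
  show "bij_betw ?d ?H (Pow F)" by (rule bij_betw_byWitness[where f' = ?i]) (use 1 2 3 in blast)+
  show "bij_betw ?i (Pow F) ?H" by (rule bij_betw_byWitness[where f' = ?d]) (use 1 2 3 in blast)+
qed

text \<open>One element of \<open>F\<close> is split off: its membership is the bit, and the other
  elements are renamed to those of \<open>F'\<close>.\<close>

lemma bij_betw_Pow_Suc:
  assumes "finite F" "finite F'" "card F = Suc (card F')"
  shows "\<exists>g. bij_betw g (Pow F) (Pow F' \<times> {0, 1 :: nat}) \<and> (\<forall>X\<in>Pow F. card X = card (fst (g X)) + snd (g X))"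
proof -
  obtain x where x: "x \<in> F" using assms by fastforce
  have "card (F - {x}) = card F'" using assms x by simp
  then obtain h where h: "bij_betw h (F - {x}) F'"
    using finite_same_card_bij[of "F - {x}" F'] assms by blast
  define r where "r X = (X - {x}, of_bool (x \<in> X) :: nat)" for X
  have r: "bij_betw r (Pow F) (Pow (F - {x}) \<times> {0, 1})"
    by (rule bij_betw_byWitness[where f' = "\<lambda>(Y, e). if e = 1 then insert x Y else Y"])
      (use x in \<open>auto simp: r_def\<close>)
  have "bij_betw (map_prod ((`) h) id) (Pow (F - {x}) \<times> {0, 1 :: nat}) (Pow F' \<times> {0, 1})"
    by (rule bij_betw_map_prod[OF bij_betw_Pow[OF h]]) simp
  from bij_betw_trans[OF r this] have "bij_betw (map_prod ((`) h) id \<circ> r) (Pow F) (Pow F' \<times> {0, 1})" .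
  moreover have "card X = card (fst ((map_prod ((`) h) id \<circ> r) X)) + snd ((map_prod ((`) h) id \<circ> r) X)"
    if "X \<in> Pow F" for X
  proof -
    have "inj_on h (X - {x})" using h that by (auto simp: bij_betw_def intro: inj_on_subset)
    moreover have "finite X" using that assms finite_subset by auto
    ultimately show ?thesis using card.remove[of X x] by (cases "x \<in> X") (simp_all add: r_def card_image)
  qed
  ultimately show ?thesis by blast
qed

text \<open>Both families are cubes. One adds boxes to \<open>L\<close> at positions of
  \<open>F\<close>, the other removes boxes from \<open>U\<close> at positions of \<open>F'\<close>;
  since sizes of subsets enter with opposite signs, they cancel up to the bit of the extra
  dimension.\<close>

lemma exchange_indicator:
  assumes vac: "\<And>n. N \<le> \<bar>n\<bar> \<Longrightarrow> L n = vac n" "\<And>n. N \<le> \<bar>n\<bar> \<Longrightarrow> U n = vac n"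
    and F: "F \<subseteq> {- N<..<N}" "F' \<subseteq> {- N<..<N}" "card F = Suc (card F')"
  shows "exchange {h. \<forall>n. h n = L n \<or> n \<in> F \<and> h n = L n + 1}
    {h. \<forall>n. h n = U n \<or> n \<in> F' \<and> h n = U n + (- 1)} {0, 1} (boxes L + boxes U)"
    (is "exchange ?A ?B _ _")
proof -
  have fin: "finite F" "finite F'" using F(1,2) finite_subset by blast+
  obtain g where g: "bij_betw g (Pow F) (Pow F' \<times> {0, 1 :: nat})"
    and card: "\<And>X. X \<in> Pow F \<Longrightarrow> card X = card (fst (g X)) + snd (g X)"
    using bij_betw_Pow_Suc[OF fin F(3)] by blast
  let ?d = "\<lambda>h. {n. h n \<noteq> L n}" and ?i = "\<lambda>X n. U n + (- 1) * of_bool (n \<in> X)"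
  have d: "bij_betw ?d ?A (Pow F)" by (rule bij_betw_indicator) simp
  have "bij_betw ?i (Pow F') ?B" by (rule bij_betw_indicator) simp
  then have "bij_betw (map_prod ?i id) (Pow F' \<times> {0, 1 :: nat}) (?B \<times> {0, 1})"
    by (rule bij_betw_map_prod) simp
  then have "bij_betw (map_prod ?i id \<circ> (g \<circ> ?d)) ?A (?B \<times> {0, 1})"
    by (rule bij_betw_trans[OF bij_betw_trans[OF d g]])
  moreover have "boxes h + boxes (fst ((map_prod ?i id \<circ> (g \<circ> ?d)) h)) =
      boxes L + boxes U + int (snd ((map_prod ?i id \<circ> (g \<circ> ?d)) h))" if h: "h \<in> ?A" for h
  proof -
    define X where "X = ?d h"
    have X: "X \<in> Pow F" using bij_betwE[OF d] h unfolding X_def by blast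
    have gX: "fst (g X) \<in> Pow F'" using bij_betwE[OF g] X by (force simp: mem_Times_iff)
    have "h n = L n + 1 * of_bool (n \<in> X)" for n using h by (cases "h n = L n") (auto simp: X_def)
    then have "h = (\<lambda>n. L n + 1 * of_bool (n \<in> X))" by blast
    then have "boxes h = boxes L + int (card X)"
      using boxes_add_indicator[of N L X 1] vac(1) X F(1) by simp
    moreover have "boxes (?i (fst (g X))) = boxes U - int (card (fst (g X)))"
      using boxes_add_indicator[of N U "fst (g X)" "- 1"] vac(2) gX F(2) by simp
    ultimately show ?thesis using card[OF X] by (simp add: X_def)
  qed
  ultimately show ?thesis unfolding exchange_def by blast
qed

text \<open>Both sides are products of intervals of length at most one, so that they are parametrized by
  the subsets of their sets of free positions.\<close>

lemma exchange_mixed: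
  assumes la: "is_state la" and mu: "is_state mu"
  shows "exchange {nu. is_state nu \<and> hstep la nu \<and> vstep mu nu}
    {ka. is_state ka \<and> vstep ka la \<and> hstep ka mu} {0, 1} (boxes la + boxes mu)"
    (is "exchange ?A ?B _ _")
proof -
  define L where "L n = max (la n) (mu n)" for n
  define U where "U n = min (la (n + 1) + 1) (mu (n - 1))" for n
  define L' where "L' n = max (la (n + 1)) (mu (n - 1) - 1)" for n
  define U' where "U' n = min (la n) (mu n)" for n
  obtain N1 where N1: "N1 \<ge> 0" "\<And>n. N1 \<le> \<bar>n\<bar> \<Longrightarrow> la n = vac n"
    using state_bound[OF la] by blast
  obtain N2 where N2: "N2 \<ge> 0" "\<And>n. N2 \<le> \<bar>n\<bar> \<Longrightarrow> mu n = vac n"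
    using state_bound[OF mu] by blast
  define N where "N = max N1 N2 + 1"
  have N: "N > 0" "\<And>n. N - 1 \<le> \<bar>n\<bar> \<Longrightarrow> la n = vac n" "\<And>n. N - 1 \<le> \<bar>n\<bar> \<Longrightarrow> mu n = vac n"
    using N1 N2 by (auto simp: N_def)
  have out: "L n = vac n" "U n = vac n" "L' n = vac n" "U' n = vac n" if "N \<le> \<bar>n\<bar>" for n
    using that N(1) by (auto simp: L_def U_def L'_def U'_def N(2,3) vac_def min_def max_def)
  have la1: "la (n + 1) \<le> la n" "la n \<le> la (n + 1) + 1" for n using la by (auto simp: is_state_def)
  have mu1: "mu n \<le> mu (n - 1)" "mu (n - 1) \<le> mu n + 1" for n
    using mu[unfolded is_state_def, THEN conjunct1, rule_format, of "n - 1"] by auto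
  have A_iff: "nu \<in> ?A \<longleftrightarrow> (\<forall>n. L n \<le> nu n \<and> nu n \<le> U n)" for nu
  proof
    assume nu: "\<forall>n. L n \<le> nu n \<and> nu n \<le> U n"
    \<comment> \<open>Being a state is a consequence of the bounds:
      \<open>U (n + 1) \<le> mu n \<le> L n\<close> and
      \<open>U n \<le> la (n + 1) + 1 \<le> L (n + 1) + 1\<close>.\<close>
    have "nu (n + 1) \<le> nu n \<and> nu n \<le> nu (n + 1) + 1" for n
      using nu[rule_format, of n] nu[rule_format, of "n + 1"] by (simp add: L_def U_def)
    moreover have "nu n = vac n" if "N \<le> \<bar>n\<bar>" for n
      using out[OF that] nu[rule_format, of n] by simp
    ultimately have "is_state nu" unfolding is_state_def by blast
    then show "nu \<in> ?A" using nu by (simp add: hstep_def vstep_def L_def U_def)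
  qed (auto simp: hstep_def vstep_def L_def U_def)
  have B_iff: "ka \<in> ?B \<longleftrightarrow> (\<forall>n. L' n \<le> ka n \<and> ka n \<le> U' n)" for ka
  proof
    assume ka: "\<forall>n. L' n \<le> ka n \<and> ka n \<le> U' n"
    have "ka (n + 1) \<le> ka n \<and> ka n \<le> ka (n + 1) + 1" for n
      using ka[rule_format, of n] ka[rule_format, of "n + 1"] by (simp add: L'_def U'_def)
    moreover have "ka n = vac n" if "N \<le> \<bar>n\<bar>" for n
      using out[OF that] ka[rule_format, of n] by simp
    ultimately have "is_state ka" unfolding is_state_def by blast
    moreover have "la n \<le> ka (n - 1)" "mu n \<le> ka (n + 1) + 1" for n
      using ka[rule_format, of "n - 1"] ka[rule_format, of "n + 1"] by (auto simp: L'_def)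
    ultimately show "ka \<in> ?B" using ka by (simp add: hstep_def vstep_def U'_def)
  next
    assume ka: "ka \<in> ?B"
    then have s: "ka n \<le> la n" "la n \<le> ka (n - 1)" "ka n \<le> mu n" "mu n \<le> ka (n + 1) + 1" for n
      by (auto simp: vstep_def hstep_def)
    have "L' n \<le> ka n \<and> ka n \<le> U' n" for n
      using s(1,3)[of n] s(2)[of "n + 1"] s(4)[of "n - 1"] by (simp add: L'_def U'_def)
    then show "\<forall>n. L' n \<le> ka n \<and> ka n \<le> U' n" by blast
  qed
  show ?thesis
  proof (cases "?A = {} \<and> ?B = {}")
    case True
    then have e: "?A = {}" "?B = {}" by blast+
    show ?thesis unfolding exchange_def e by (simp add: bij_betw_def)
  next
    case False
    \<comment> \<open>A single element on either side makes the bounds of both sides consistent, so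
      that the two sets are empty together.\<close>
    have "(\<forall>n. L n \<le> U n) \<and> (\<forall>n. L' n \<le> U' n)"
    proof (cases "?A = {}")
      case True
      then obtain ka where ka: "ka \<in> ?B" using False by blast
      then have s: "ka n \<le> la n" "la n \<le> ka (n - 1)" "ka n \<le> mu n" "mu n \<le> ka (n + 1) + 1" for n
        by (auto simp: vstep_def hstep_def)
      have "L' n \<le> U' n" for n using ka B_iff[of ka] order_trans by blast
      moreover have "L n \<le> U n" for n
        using s(2)[of n] s(3)[of "n - 1"] s(4)[of n] s(1)[of "n + 1"] la1[of n] mu1[of n]
        by (simp add: L_def U_def)
      ultimately show ?thesis by blast
    next
      case False
      then obtain nu where nu: "nu \<in> ?A" by blast
      then have s: "la n \<le> nu n" "nu n \<le> la (n + 1) + 1" "mu n \<le> nu n" "nu n \<le> mu (n - 1)" for n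
        by (auto simp: vstep_def hstep_def)
      have "L n \<le> U n" for n using nu A_iff[of nu] order_trans by blast
      moreover have "L' n \<le> U' n" for n
        using s(1)[of "n + 1"] s(4)[of "n + 1"] s(3)[of "n - 1"] s(2)[of "n - 1"] la1[of n] mu1[of n]
        by (simp add: L'_def U'_def)
      ultimately show ?thesis by blast
    qed
    then have le: "\<And>n. L n \<le> U n" "\<And>n. L' n \<le> U' n" by auto
    define F where "F = {n. U n = L n + 1}"
    define F' where "F' = {n. U' n = L' n + 1}"
    have U: "U n = L n + of_bool (n \<in> F)" for n
      using le(1)[of n] la1[of n] mu1[of n] by (auto simp: F_def L_def U_def)
    have L': "L' n = U' n - of_bool (n \<in> F')" for n
      using le(2)[of n] la1[of n] mu1[of n] by (auto simp: F'_def L'_def U'_def)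
    have Fsub: "F \<subseteq> {- N<..<N}" "F' \<subseteq> {- N<..<N}"
    proof -
      have "\<not> N \<le> \<bar>n\<bar>" if "n \<in> F \<or> n \<in> F'" for n using out[of n] that by (auto simp: F_def F'_def)
      then show "F \<subseteq> {- N<..<N}" "F' \<subseteq> {- N<..<N}" by fastforce+
    qed
    have "int (card F) = int (card F') + 1"
    proof -
      have c: "int (card G) = (\<Sum>n\<in>{- N..N}. of_bool (n \<in> G))" if "G \<subseteq> {- N<..<N}" for G
      proof -
        have "{- N..N} \<inter> {n. n \<in> G} = G" using that by auto
        then show ?thesis by (subst sum_of_bool_eq) simp_all
      qed
      \<comment> \<open>Since a maximum and a minimum of the same two numbers add up to their sum,
        each term is a difference of increments of \<open>la\<close> and \<open>mu\<close>. The
        telescoped sums leave \<open>- N\<close> and \<open>- (N + 1)\<close>, because the argument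
        of \<open>mu\<close> is shifted by one; this is where the one extra free position comes
        from.\<close>
      have "int (card F) - int (card F') = (\<Sum>n\<in>{- N..N}. (U n - L n) - (U' n - L' n))"
        unfolding c[OF Fsub(1)] c[OF Fsub(2)] sum_subtractf[symmetric]
        by (rule sum.cong) (simp_all add: U L')
      also have "\<dots> = (\<Sum>n\<in>{- N..N}. (la (n + 1) - la n) - (mu (n + 1 - 1) - mu (n - 1)))"
        by (rule sum.cong) (auto simp: U_def U'_def L_def L'_def)
      also have "\<dots> = (\<Sum>n\<in>{- N..N}. la (n + 1) - la n) - (\<Sum>n\<in>{- N..N}. mu (n + 1 - 1) - mu (n - 1))"
        by (rule sum_subtractf)
      also have "\<dots> = 1"
        using sum_telescope_int[of "- N" N la] sum_telescope_int[of "- N" N "\<lambda>n. mu (n - 1)"] N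
        by (simp add: N vac_def)
      finally show ?thesis by simp
    qed
    then have card: "card F = Suc (card F')" by simp
    have "nu \<in> ?A \<longleftrightarrow> (\<forall>n. nu n = L n \<or> n \<in> F \<and> nu n = L n + 1)" for nu
      unfolding A_iff U by (rule iff_allI) (auto simp: of_bool_def)
    then have A: "?A = {h. \<forall>n. h n = L n \<or> n \<in> F \<and> h n = L n + 1}" by blast
    have "ka \<in> ?B \<longleftrightarrow> (\<forall>n. ka n = U' n \<or> n \<in> F' \<and> ka n = U' n + (- 1))" for ka
      unfolding B_iff L' by (rule iff_allI) (auto simp: of_bool_def)
    then have B: "?B = {h. \<forall>n. h n = U' n \<or> n \<in> F' \<and> h n = U' n + (- 1)}" by blast
    have "boxes L + boxes U' = (\<Sum>n\<in>{- N..N}. (L n - vac n) + (U' n - vac n))"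
      unfolding sum.distrib using boxes_eq[of N L] boxes_eq[of N U'] out by simp
    also have "\<dots> = (\<Sum>n\<in>{- N..N}. (la n - vac n) + (mu n - vac n))"
      by (rule sum.cong) (auto simp: L_def U'_def)
    also have "\<dots> = boxes la + boxes mu"
      unfolding sum.distrib using boxes_eq[of N la] boxes_eq[of N mu] N by simp
    finally show ?thesis
      unfolding A B using exchange_indicator[of N L U', OF out(1) out(4) Fsub card] by simp
  qed
qed

section \<open>Weighted generating functions\<close>

text \<open>These conditions make the coefficients of \<open>wgf\<close> meaningful: no element has
  a negative weight and drops out, and no coefficient is the cardinality 0 of an infinite
  set.\<close>

definition graded :: "'a set \<Rightarrow> ('a \<Rightarrow> int) \<Rightarrow> bool" where
  "graded A f \<longleftrightarrow> (\<forall>a\<in>A. 0 \<le> f a) \<and> (\<forall>n. finite {a \<in> A. f a = n})"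

definition wgf :: "'a set \<Rightarrow> ('a \<Rightarrow> int) \<Rightarrow> rat fps" where
  "wgf A f = Abs_fps (\<lambda>n. of_nat (card {a \<in> A. f a = int n}))"

text \<open>The weights split additively along the product, which gives a Cauchy product. As
  \<open>c > 0\<close>, an exponent \<open>c * k\<close> determines \<open>k\<close>, so the
  coefficients of the second factor are 0 or 1.\<close>

lemma graded_times:
  fixes K :: "nat set"
  assumes B: "graded B g" and c: "c > 0" and bij: "bij_betw \<phi> A (B \<times> K)"
    and f: "\<And>a. a \<in> A \<Longrightarrow> f a = g (fst (\<phi> a)) + int c * int (snd (\<phi> a))"
  shows "graded A f"
    and "wgf A f = wgf B g * Abs_fps (\<lambda>n. of_bool (\<exists>k\<in>K. n = c * k))"
proof -
  define S where "S n = (SIGMA i:{0..n}. {b \<in> B. g b = int i} \<times> {k \<in> K. n - i = c * k})" for n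
  have nonneg: "0 \<le> g b" if "b \<in> B" for b using B that by (simp add: graded_def)
  have \<phi>: "\<phi> a \<in> B \<times> K" if "a \<in> A" for a using bij_betwE[OF bij] that by blast
  have img: "(\<lambda>a. (nat (g (fst (\<phi> a))), \<phi> a)) ` {a \<in> A. f a = int n} = S n" for n
  proof (intro equalityI subsetI)
    fix x assume "x \<in> (\<lambda>a. (nat (g (fst (\<phi> a))), \<phi> a)) ` {a \<in> A. f a = int n}"
    then obtain a where a: "a \<in> A" "f a = int n" "x = (nat (g (fst (\<phi> a))), \<phi> a)" by auto
    obtain b k where bk: "\<phi> a = (b, k)" "b \<in> B" "k \<in> K" using \<phi>[OF a(1)] by (cases "\<phi> a") auto
    have e: "g b + int c * int k = int n" using f[OF a(1)] a(2) bk by simp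
    have "int (nat (g b)) + int (c * k) = int n" using e nonneg[OF bk(2)] by simp
    then have "nat (g b) + c * k = n" by linarith
    then show "x \<in> S n" using nonneg[OF bk(2)] bk a(3) by (auto simp: S_def)
  next
    fix x assume "x \<in> S n"
    then obtain i b k where x: "x = (i, b, k)" "i \<le> n" "b \<in> B" "g b = int i" "k \<in> K" "n - i = c * k"
      by (auto simp: S_def)
    obtain a where a: "a \<in> A" "\<phi> a = (b, k)" using bij x(3,5) unfolding bij_betw_def by (metis SigmaI imageE)
    have "int i + int (c * k) = int n" using x(2,6) by linarith
    then have "f a = int n" using f[OF a(1)] a(2) x(4) by simp
    then show "x \<in> (\<lambda>a. (nat (g (fst (\<phi> a))), \<phi> a)) ` {a \<in> A. f a = int n}"
      using a x by (intro image_eqI[of _ _ a]) auto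
  qed
  have inj: "inj_on (\<lambda>a. (nat (g (fst (\<phi> a))), \<phi> a)) X" if "X \<subseteq> A" for X
    using inj_on_subset[OF bij_betw_imp_inj_on[OF bij] that] by (auto simp: inj_on_def)
  have Kc: "finite {k \<in> K. m = c * k}" "card {k \<in> K. m = c * k} = of_bool (\<exists>k\<in>K. m = c * k)" for m
  proof -
    have "{k \<in> K. m = c * k} = (if \<exists>k\<in>K. m = c * k then {m div c} else {})" using c by auto
    then show "finite {k \<in> K. m = c * k}" "card {k \<in> K. m = c * k} = of_bool (\<exists>k\<in>K. m = c * k)"
      by simp_all
  qed
  have finB: "finite {b \<in> B. g b = i}" for i using B by (simp add: graded_def)
  have finS: "finite (S n)" for n unfolding S_def using finB Kc(1) by blast
  have finA: "finite {a \<in> A. f a = int n}" for n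
    by (rule finite_imageD[OF _ inj]) (simp_all add: img finS)
  have fA: "0 \<le> f a" if "a \<in> A" for a
    using f[OF that] \<phi>[OF that] nonneg[of "fst (\<phi> a)"] by (auto simp: mem_Times_iff)
  show "graded A f" unfolding graded_def
  proof (intro conjI ballI allI)
    fix n
    show "finite {a \<in> A. f a = n}"
    proof (cases "n \<ge> 0")
      case True
      then show ?thesis using finA[of "nat n"] by simp
    next
      case False
      then have "{a \<in> A. f a = n} = {}" using fA by force
      then show ?thesis by (simp only: finite.emptyI)
    qed
  qed (use fA in auto)
  show "wgf A f = wgf B g * Abs_fps (\<lambda>n. of_bool (\<exists>k\<in>K. n = c * k))"
  proof (rule fps_ext)
    fix n
    have "card {a \<in> A. f a = int n} = card (S n)"
      using card_image[OF inj[of "{a \<in> A. f a = int n}"]] img[of n] by simp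
    also have "\<dots> = (\<Sum>i=0..n. card {b \<in> B. g b = int i} * of_bool (\<exists>k\<in>K. n - i = c * k))"
      unfolding S_def by (subst card_SigmaI) (auto simp: finB Kc card_cartesian_product)
    finally show "fps_nth (wgf A f) n = fps_nth (wgf B g * Abs_fps (\<lambda>n. of_bool (\<exists>k\<in>K. n = c * k))) n"
      by (simp add: wgf_def fps_mult_nth)
  qed
qed

definition pair_factor :: "bool \<Rightarrow> nat \<Rightarrow> rat fps" where
  "pair_factor same c = (if same then 1 / (1 - fps_X ^ c) else 1 + fps_X ^ c)"

lemma pair_factor_eq:
  assumes "c > 0"
  shows "pair_factor same c = Abs_fps (\<lambda>n. of_bool (\<exists>k\<in>(if same then UNIV else {0, 1}). n = c * k))"
proof (cases same)
  case True
  let ?f = "Abs_fps (\<lambda>n. of_bool (c dvd n)) :: rat fps"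
  have "(1 - fps_X ^ c) * ?f = 1"
  proof (rule fps_ext)
    fix n
    show "fps_nth ((1 - fps_X ^ c) * ?f) n = fps_nth 1 n"
      using assms by (auto simp: left_diff_distrib fps_X_power_mult_nth dvd_imp_le dvd_minus_self
          split: if_splits)
  qed
  moreover from this have "(1 - fps_X ^ c :: rat fps) \<noteq> 0" by force
  ultimately have "1 / (1 - fps_X ^ c) = ?f" by (metis nonzero_mult_div_cancel_left)
  then show ?thesis using True by (simp add: pair_factor_def dvd_def)
next
  case False
  have "1 + fps_X ^ c = (Abs_fps (\<lambda>n. of_bool (n = 0 \<or> n = c)) :: rat fps)"
    using assms by (intro fps_ext) (auto simp: fps_X_power_nth)
  then show ?thesis using False by (simp add: pair_factor_def)
qed

section \<open>Paths of states\<close>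

definition up :: "bool \<Rightarrow> (int \<Rightarrow> int) \<Rightarrow> (int \<Rightarrow> int) \<Rightarrow> bool" where
  "up t = (if t then hstep else vstep)"

fun trans_step :: "sign \<times> bool \<times> int \<Rightarrow> (int \<Rightarrow> int) \<Rightarrow> (int \<Rightarrow> int) \<Rightarrow> bool" where
  "trans_step (Plus, t, i) a b \<longleftrightarrow> up t a b"
| "trans_step (Minus, t, i) a b \<longleftrightarrow> up t b a"

lemma up_le: "up t a b \<Longrightarrow> a n \<le> b n"
  by (auto simp: up_def hstep_def vstep_def split: if_splits)

text \<open>The two mixed cases are instances of one rule, with \<open>la\<close> and
  \<open>mu\<close> interchanged.\<close>

lemma exchange_up:
  assumes la: "is_state la" and mu: "is_state mu"
  shows "exchange {nu. is_state nu \<and> up t la nu \<and> up s mu nu}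
    {ka. is_state ka \<and> up s ka la \<and> up t ka mu} (if t = s then UNIV else {0, 1}) (boxes la + boxes mu)"
  using exchange_hstep[OF la mu] exchange_vstep[OF la mu]
    exchange_mixed[OF la mu] exchange_mixed[OF mu la]
  by (cases t; cases s) (simp_all add: up_def conj_commute add.commute)

text \<open>The padding by \<open>vac\<close> beyond the last step makes equality of paths an
  equality of functions, and an exchange of steps the update of one value.\<close>

definition paths :: "(sign \<times> bool \<times> int) list \<Rightarrow> (nat \<Rightarrow> int \<Rightarrow> int) set" where
  "paths ws = {p. (\<forall>i. is_state (p i)) \<and> p 0 = vac \<and> (\<forall>i\<ge>length ws. p i = vac) \<and>
     (\<forall>i<length ws. trans_step (ws ! i) (p i) (p (Suc i)))}"

text \<open>When two steps are exchanged they keep their labels. For the labels \<open>1, \<dots>, L\<close> in this order,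
  summation by parts turns \<open>wt\<close> into the total number of boxes of a path.\<close>

definition label :: "sign \<times> bool \<times> int \<Rightarrow> int" where "label x = snd (snd x)"

definition wt :: "(sign \<times> bool \<times> int) list \<Rightarrow> (nat \<Rightarrow> int \<Rightarrow> int) \<Rightarrow> int" where
  "wt ws p = (\<Sum>i<length ws. label (ws ! i) * (boxes (p i) - boxes (p (Suc i))))"

section \<open>Commuting two neighbouring steps\<close>

text \<open>Only the state between the two steps is replaced, by the exchange rule for its two
  neighbours. The weights of the old and the new path differ by \<open>j - i\<close> times the sum
  of both middle box numbers minus the sum of the outer ones, and the rule says that this is the
  released number.\<close>

lemma paths_swap:
  fixes u v t s i j
  defines "ws \<equiv> u @ [(Plus, t, i), (Minus, s, j)] @ v"
    and "ws' \<equiv> u @ [(Minus, s, j), (Plus, t, i)] @ v"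
  shows "\<exists>\<phi>. bij_betw \<phi> (paths ws) (paths ws' \<times> (if t = s then UNIV else {0, 1 :: nat})) \<and>
     (\<forall>p\<in>paths ws. wt ws p = wt ws' (fst (\<phi> p)) + (j - i) * int (snd (\<phi> p)))"
proof -
  define r where "r = length u"
  define K where "K = (if t = s then UNIV else {0, 1 :: nat})"
  define A where "A la mu = {nu. is_state nu \<and> up t la nu \<and> up s mu nu}" for la mu
  define B where "B la mu = {ka. is_state ka \<and> up s ka la \<and> up t ka mu}" for la mu
  define P where "P la mu f \<longleftrightarrow> bij_betw f (A la mu) (B la mu \<times> K) \<and>
      (\<forall>x\<in>A la mu. boxes x + boxes (fst (f x)) = boxes la + boxes mu + int (snd (f x)))" for la mu f
  \<comment> \<open>One bijection is fixed for each pair of outer states, so that the map on paths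
    and its inverse refer to the same choice.\<close>
  define f where "f la mu = (SOME f. P la mu f)" for la mu
  have f: "P la mu (f la mu)" if "is_state la" "is_state mu" for la mu
    unfolding f_def using exchange_up[OF that, of t s]
    unfolding exchange_def A_def[symmetric] B_def[symmetric] K_def[symmetric] P_def by (rule someI_ex)
  define g where "g la mu = the_inv_into (A la mu) (f la mu)" for la mu
  have len: "length ws = length u + length v + 2" "length ws' = length ws" by (simp_all add: ws_def ws'_def)
  have nth: "ws ! r = (Plus, t, i)" "ws ! Suc r = (Minus, s, j)"
    "ws' ! r = (Minus, s, j)" "ws' ! Suc r = (Plus, t, i)"
    by (simp_all add: ws_def ws'_def r_def nth_append)
  have same: "ws ! k = ws' ! k" if "k \<noteq> r" "k \<noteq> Suc r" for k
    using that by (auto simp: ws_def ws'_def r_def nth_append nth_Cons split: nat.splits)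
  have rL: "Suc r < length ws" by (simp add: r_def len)
  \<comment> \<open>\<open>C\<close> collects the conditions on a path that do not involve the
    middle state; hence it survives its replacement and is common to both words.\<close>
  define C where "C p \<longleftrightarrow> (\<forall>k. k \<noteq> Suc r \<longrightarrow> is_state (p k)) \<and> p 0 = vac \<and> (\<forall>k\<ge>length ws. p k = vac) \<and>
     (\<forall>k<length ws. k \<noteq> r \<longrightarrow> k \<noteq> Suc r \<longrightarrow> trans_step (ws ! k) (p k) (p (Suc k)))" for p
  have C_upd: "C (p(Suc r := x)) \<longleftrightarrow> C p" for p x using rL by (auto simp: C_def)
  have all_split: "(\<forall>k<length ws. Q k) \<longleftrightarrow> Q r \<and> Q (Suc r) \<and> (\<forall>k<length ws. k \<noteq> r \<longrightarrow> k \<noteq> Suc r \<longrightarrow> Q k)" for Q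
    using rL Suc_lessD by blast
  have st_split: "(\<forall>k. is_state (p k)) \<longleftrightarrow> is_state (p (Suc r)) \<and> (\<forall>k. k \<noteq> Suc r \<longrightarrow> is_state (p k))" for p
    by metis
  let ?A = "\<lambda>p. A (p r) (p (Suc (Suc r)))" and ?B = "\<lambda>p. B (p r) (p (Suc (Suc r)))"
  let ?f = "\<lambda>p. f (p r) (p (Suc (Suc r)))" and ?g = "\<lambda>p. g (p r) (p (Suc (Suc r)))"
  have paths: "p \<in> paths ws \<longleftrightarrow> C p \<and> p (Suc r) \<in> ?A p" for p
    unfolding paths_def mem_Collect_eq all_split[of "\<lambda>k. trans_step (ws ! k) (p k) (p (Suc k))"] st_split C_def
    by (auto simp: nth A_def)
  have paths': "p \<in> paths ws' \<longleftrightarrow> C p \<and> p (Suc r) \<in> ?B p" for p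
    unfolding paths_def mem_Collect_eq len(2) all_split[of "\<lambda>k. trans_step (ws' ! k) (p k) (p (Suc k))"] st_split C_def
    by (auto simp: nth B_def same)
  define \<phi> where "\<phi> p = (p(Suc r := fst (?f p (p (Suc r)))),
      snd (?f p (p (Suc r))))" for p :: "nat \<Rightarrow> int \<Rightarrow> int"
  define \<psi> where "\<psi> = (\<lambda>(p :: nat \<Rightarrow> int \<Rightarrow> int, k). p(Suc r := ?g p (p (Suc r), k)))"
  have st: "is_state (p r)" "is_state (p (Suc (Suc r)))" if "C p" for p using that by (auto simp: C_def)
  have fB: "?f p (p (Suc r)) \<in> ?B p \<times> K" if "p \<in> paths ws" for p
    using that f[OF st, of p] bij_betwE unfolding paths P_def by blast
  have bij: "bij_betw \<phi> (paths ws) (paths ws' \<times> K)"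
  proof (rule bij_betw_byWitness[where f' = \<psi>])
    show "\<forall>p\<in>paths ws. \<psi> (\<phi> p) = p"
    proof
      fix p assume p: "p \<in> paths ws"
      have "inj_on (?f p) (?A p)"
        using p f[OF st, of p] unfolding paths P_def bij_betw_def by blast
      then show "\<psi> (\<phi> p) = p"
        using p by (simp add: \<phi>_def \<psi>_def g_def paths the_inv_into_f_f)
    qed
    show "\<forall>x\<in>paths ws' \<times> K. \<phi> (\<psi> x) = x"
    proof
      fix x assume "x \<in> paths ws' \<times> K"
      then obtain p k where x: "x = (p, k)" "p \<in> paths ws'" "k \<in> K" by auto
      then have "bij_betw (?f p) (?A p) (?B p \<times> K)"
        "(p (Suc r), k) \<in> ?B p \<times> K"
        using f[OF st, of p] unfolding paths' P_def by auto
      from f_the_inv_into_f_bij_betw[OF this] show "\<phi> (\<psi> x) = x"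
        by (simp add: x \<phi>_def \<psi>_def g_def)
    qed
    show "\<phi> ` paths ws \<subseteq> paths ws' \<times> K"
    proof (rule image_subsetI)
      fix p assume p: "p \<in> paths ws"
      then show "\<phi> p \<in> paths ws' \<times> K"
        using fB[OF p] by (auto simp: \<phi>_def paths' paths C_upd mem_Times_iff)
    qed
    show "\<psi> ` (paths ws' \<times> K) \<subseteq> paths ws"
    proof (rule image_subsetI)
      fix x assume "x \<in> paths ws' \<times> K"
      then obtain p k where x: "x = (p, k)" "p \<in> paths ws'" "k \<in> K" by auto
      then have "bij_betw (?f p) (?A p) (?B p \<times> K)"
        "(p (Suc r), k) \<in> ?B p \<times> K" "C p"
        using f[OF st, of p] unfolding paths' P_def by auto
      then have "?g p (p (Suc r), k) \<in> ?A p"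
        unfolding g_def using bij_betwE[OF bij_betw_the_inv_into] by blast
      then show "\<psi> x \<in> paths ws" using \<open>C p\<close> by (simp add: x \<psi>_def paths C_upd)
    qed
  qed
  have "wt ws p = wt ws' (fst (\<phi> p)) + (j - i) * int (snd (\<phi> p))" if p: "p \<in> paths ws" for p
  proof -
    define q where "q = fst (\<phi> p)"
    define k where "k = snd (\<phi> p)"
    have qk: "q m = p m" if "m \<noteq> Suc r" for m using that by (simp add: q_def \<phi>_def)
    have b: "boxes (p (Suc r)) + boxes (q (Suc r)) = boxes (p r) + boxes (p (Suc (Suc r))) + int k"
      using p f[OF st, of p] unfolding paths P_def by (simp add: q_def k_def \<phi>_def)
    have split: "(\<Sum>m<length ws. F m) = F r + F (Suc r) + (\<Sum>m\<in>{..<length ws} - {r, Suc r}. F m)" for F :: "nat \<Rightarrow> int"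
      using sum.subset_diff[of "{r, Suc r}" "{..<length ws}" F] rL by simp
    have rest: "(\<Sum>m\<in>{..<length ws} - {r, Suc r}. label (ws ! m) * (boxes (p m) - boxes (p (Suc m)))) =
      (\<Sum>m\<in>{..<length ws} - {r, Suc r}. label (ws' ! m) * (boxes (q m) - boxes (q (Suc m))))"
      by (rule sum.cong) (auto simp: same qk)
    have "wt ws p - wt ws' q = i * (boxes (p r) - boxes (p (Suc r))) + j * (boxes (p (Suc r)) - boxes (p (Suc (Suc r))))
      - (j * (boxes (p r) - boxes (q (Suc r))) + i * (boxes (q (Suc r)) - boxes (p (Suc (Suc r)))))"
      unfolding wt_def len(2) split rest by (simp add: nth label_def qk)
    also have "\<dots> = (j - i) * (boxes (p (Suc r)) + boxes (q (Suc r)) - boxes (p r) - boxes (p (Suc (Suc r))))"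
      by (simp add: algebra_simps)
    also have "\<dots> = (j - i) * int k" using b by simp
    finally show ?thesis by (simp add: q_def k_def)
  qed
  then show ?thesis using bij unfolding K_def by blast
qed

section \<open>Sorting the steps of a word\<close>

fun step_factor :: "sign \<times> bool \<times> int \<Rightarrow> sign \<times> bool \<times> int \<Rightarrow> rat fps" where
  "step_factor (Plus, t, i) (Minus, s, j) = pair_factor (t = s) (nat (j - i))"
| "step_factor _ _ = 1"

fun pair_product :: "(sign \<times> bool \<times> int) list \<Rightarrow> rat fps" where
  "pair_product [] = 1"
| "pair_product (x # xs) = prod_list (map (step_factor x) xs) * pair_product xs"

fun inversions :: "(sign \<times> bool \<times> int) list \<Rightarrow> nat" where
  "inversions [] = 0"
| "inversions (x # xs) = (if fst x = Plus then length (filter (\<lambda>y. fst y = Minus) xs) else 0) + inversions xs"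

text \<open>All other pairs keep their order, and the exchanged pair contributes 1 once the removing
  step stands first.\<close>

lemma pair_product_swap:
  "pair_product (u @ [(Plus, t, i), (Minus, s, j)] @ v) =
     pair_product (u @ [(Minus, s, j), (Plus, t, i)] @ v) * pair_factor (t = s) (nat (j - i))"
  by (induction u) (simp_all add: ac_simps)

lemma inversions_swap:
  "inversions (u @ [(Plus, t, i), (Minus, s, j)] @ v) =
     Suc (inversions (u @ [(Minus, s, j), (Plus, t, i)] @ v))"
  by (induction u) simp_all

lemma step_factor_trivial: "\<not> (fst x = Plus \<and> fst y = Minus) \<Longrightarrow> step_factor x y = 1"
  by (cases "(x, y)" rule: step_factor.cases) auto

lemma sign_cases: "(x :: sign) = Plus \<or> x = Minus" by (cases x) auto

lemma vac_in_paths: "(\<lambda>_. vac) \<in> paths ws"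
proof -
  have "trans_step x vac vac" for x
    by (cases x; cases "fst x") (auto simp: up_def hstep_def vstep_def vac_def)
  then show ?thesis by (simp add: paths_def is_state_vac)
qed

text \<open>As the vacuum is the least state, a removing step cannot leave it and an adding step
  into it must start in it. So the left end forces the vacuum along the initial removing steps, the
  right end along the adding steps that follow.\<close>

lemma paths_no_inversion:
  assumes sorted: "sorted_wrt (\<lambda>x y. \<not> (fst x = Plus \<and> fst y = Minus)) ws"
  shows "paths ws = {\<lambda>_. vac}"
proof (intro equalityI subsetI)
  fix p assume p: "p \<in> paths ws"
  then have st: "is_state (p i)" and ends: "p 0 = vac" "i \<ge> length ws \<Longrightarrow> p i = vac"
    and tr: "i < length ws \<Longrightarrow> trans_step (ws ! i) (p i) (p (Suc i))" for i
    by (auto simp: paths_def)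
  have fwd: "i \<le> length ws \<Longrightarrow> \<forall>k<i. fst (ws ! k) = Minus \<Longrightarrow> p i = vac" for i
  proof (induction i)
    case (Suc i)
    obtain t j where "ws ! i = (Minus, t, j)" using Suc.prems(2) by (cases "ws ! i") auto
    then have "up t (p (Suc i)) (p i)" using tr[of i] Suc.prems(1) by simp
    then have "p (Suc i) n \<le> vac n" for n using Suc up_le by fastforce
    then show ?case by (rule state_le_vac[OF st])
  qed (use ends in simp)
  have bwd: "i \<le> length ws \<Longrightarrow> \<forall>k. i \<le> k \<and> k < length ws \<longrightarrow> fst (ws ! k) = Plus \<Longrightarrow> p i = vac" for i
  proof (induction i rule: inc_induct)
    case (step i)
    obtain t j where "ws ! i = (Plus, t, j)" using step by (cases "ws ! i") auto
    then have "up t (p i) (p (Suc i))" using tr[of i] step.hyps by simp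
    then have "p i n \<le> vac n" for n using step up_le by fastforce
    then show ?case by (rule state_le_vac[OF st])
  qed (use ends in simp)
  have "p i = vac" for i
  proof (cases "i < length ws")
    case True
    show ?thesis
    proof (cases "\<forall>k<i. fst (ws ! k) = Minus")
      case False
      then obtain k where k: "k < i" "fst (ws ! k) = Plus" using sign_cases by blast
      have "fst (ws ! m) = Plus" if "i \<le> m" "m < length ws" for m
        using sorted[unfolded sorted_wrt_iff_nth_less, rule_format, of k m] k that
          sign_cases[of "fst (ws ! m)"] by simp
      then show ?thesis using bwd[of i] True by simp
    qed (use fwd True in simp)
  qed (use ends in simp)
  then show "p \<in> {\<lambda>_. vac}" by auto
qed (simp add: vac_in_paths)

lemma pair_product_no_inversion:
  assumes "sorted_wrt (\<lambda>x y. \<not> (fst x = Plus \<and> fst y = Minus)) ws"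
  shows "pair_product ws = 1"
  using assms
proof (induction ws)
  case (Cons x xs)
  then have "map (step_factor x) xs = map (\<lambda>_. 1) xs"
    by (intro map_cong) (auto intro!: step_factor_trivial)
  moreover have "prod_list (map (\<lambda>_. 1) xs) = (1 :: rat fps)" by (induction xs) auto
  ultimately have "prod_list (map (step_factor x) xs) = 1" by (simp only:)
  then show ?case using Cons by simp
qed simp

text \<open>Induction on the number of pairs still to be exchanged. The labels need not stay sorted;
  what survives the exchanges is that an adding step has a smaller label than every removing step to
  its right, and this keeps the exponents \<open>j - i\<close> positive.\<close>

lemma wgf_paths:
  assumes "sorted_wrt (\<lambda>x y. fst x = Plus \<and> fst y = Minus \<longrightarrow> label x < label y) ws"
  shows "graded (paths ws) (wt ws) \<and> wgf (paths ws) (wt ws) = pair_product ws"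
  using assms
proof (induction "inversions ws" arbitrary: ws rule: less_induct)
  case less
  let ?Q = "\<lambda>x y :: sign \<times> bool \<times> int. \<not> (fst x = Plus \<and> fst y = Minus)"
  show ?case
  proof (cases "sorted_wrt ?Q ws")
    case True
    have "wt ws (\<lambda>_. vac) = 0" by (simp add: wt_def)
    then have "{a \<in> {\<lambda>_. vac}. wt ws a = n} = (if n = 0 then {\<lambda>_. vac} else {})" for n by auto
    then show ?thesis
      by (auto simp: paths_no_inversion[OF True] pair_product_no_inversion[OF True] graded_def wgf_def
          \<open>wt ws (\<lambda>_. vac) = 0\<close> intro!: fps_ext)
  next
    case False
    \<comment> \<open>For a transitive relation, a violation anywhere in the list implies one
      between neighbours.\<close>
    have "transp ?Q" using sign_cases by (auto intro!: transpI)
    then obtain k where k: "Suc k < length ws" "fst (ws ! k) = Plus" "fst (ws ! Suc k) = Minus"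
      using False by (auto simp: sorted_wrt_iff_nth_Suc_transp)
    obtain t i where x: "ws ! k = (Plus, t, i)" using k by (cases "ws ! k") auto
    obtain s j where y: "ws ! Suc k = (Minus, s, j)" using k by (cases "ws ! Suc k") auto
    define u where "u = take k ws"
    define v where "v = drop (Suc (Suc k)) ws"
    have ws: "ws = u @ [(Plus, t, i), (Minus, s, j)] @ v"
      using k(1) x y by (simp add: u_def v_def Cons_nth_drop_Suc flip: x y)
    let ?ws' = "u @ [(Minus, s, j), (Plus, t, i)] @ v"
    have ij: "i < j" using less.prems by (simp add: ws sorted_wrt_append label_def)
    have "sorted_wrt (\<lambda>x y. fst x = Plus \<and> fst y = Minus \<longrightarrow> label x < label y) ?ws'"
      using less.prems by (auto simp: ws sorted_wrt_append)
    then have IH: "graded (paths ?ws') (wt ?ws')" "wgf (paths ?ws') (wt ?ws') = pair_product ?ws'"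
      using less.hyps[of ?ws'] inversions_swap[of u t i s j v] ws by auto
    obtain \<phi> where \<phi>: "bij_betw \<phi> (paths ws) (paths ?ws' \<times> (if t = s then UNIV else {0, 1}))"
      "\<And>p. p \<in> paths ws \<Longrightarrow> wt ws p = wt ?ws' (fst (\<phi> p)) + (j - i) * int (snd (\<phi> p))"
      using paths_swap[of u t i s j v] ws by blast
    have c: "nat (j - i) > 0" "int (nat (j - i)) = j - i" using ij by auto
    have e: "wt ws p = wt ?ws' (fst (\<phi> p)) + int (nat (j - i)) * int (snd (\<phi> p))" if "p \<in> paths ws" for p
      using \<phi>(2)[OF that] c(2) by simp
    show ?thesis
      using graded_times[OF IH(1) c(1) \<phi>(1) e] IH(2) pair_product_swap[of u t i s j v] ws
      by (simp add: pair_factor_eq[OF c(1)])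
  qed
qed

section \<open>Tilings as sets of pairs of cells\<close>

text \<open>The cell \<open>(m, n)\<close> is the unit square on the diagonal \<open>y = x - m\<close> with left side \<open>x = n\<close>.
  Every domino joins a cell of some diagonal \<open>m\<close> to one of two cells of the diagonal \<open>m + 1\<close>.\<close>

definition dm :: "int \<Rightarrow> int \<Rightarrow> bool \<Rightarrow> domino" where
  "dm m n s = (if s then Horizontal n (n - m + 1) else Vertical n (n - m + 1))"

fun cells :: "domino \<Rightarrow> (int \<times> int) set" where
  "cells (Horizontal x y) = {(x - y + 1, x), (x - y + 2, x + 1)}"
| "cells (Vertical x y) = {(x - y + 1, x), (x - y + 2, x)}"

definition covered :: "domino set \<Rightarrow> int \<Rightarrow> int \<Rightarrow> bool" where
  "covered T m n \<longleftrightarrow> (\<exists>d\<in>T. (m, n) \<in> cells d)"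

lemma cells_dm: "cells (dm m n s) = {(m, n), (m + 1, n + of_bool s)}"
  by (auto simp: dm_def)

lemma dm_cases: obtains m n s where "d = dm m n s"
proof (cases d)
  case (Horizontal x y)
  then have "d = dm (x - y + 1) x True" by (simp add: dm_def)
  then show ?thesis by (rule that)
next
  case (Vertical x y)
  then have "d = dm (x - y + 1) x False" by (simp add: dm_def)
  then show ?thesis by (rule that)
qed

lemma dm_inject [simp]: "dm m n s = dm m' n' s' \<longleftrightarrow> m = m' \<and> n = n' \<and> s = s'"
  by (auto simp: dm_def)

lemma going_dm:
  "north_going (dm m n s) \<longleftrightarrow> s \<and> even m" "east_going (dm m n s) \<longleftrightarrow> \<not> s \<and> even m"
  "south_going (dm m n s) \<longleftrightarrow> s \<and> odd m" "west_going (dm m n s) \<longleftrightarrow> \<not> s \<and> odd m"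
  by (auto simp: dm_def)

lemma Bex_domino: "(\<exists>d\<in>T. P d) \<longleftrightarrow> (\<exists>m n s. dm m n s \<in> T \<and> P (dm m n s))"
  by (metis dm_cases)

text \<open>Centers of cells avoid the edges of dominos, so that testing closed rectangles on them
  involves no boundary cases.\<close>

lemma center_in_rect:
  "(of_int n + 1 / 2, of_int n - of_int m + 1 / 2) \<in> rect d \<longleftrightarrow> (m, n) \<in> cells d"
proof -
  have half: "real_of_int a \<le> of_int b + 1 / 2 \<longleftrightarrow> a \<le> b" "of_int b + 1 / 2 \<le> real_of_int a \<longleftrightarrow> b < a"
    for a b :: int by linarith+
  have e: "of_int n - of_int m + 1 / 2 = of_int (n - m) + (1 / 2 :: real)"
    "\<And>x. of_int x + 1 = real_of_int (x + 1)" "\<And>x. of_int x + 2 = real_of_int (x + 2)"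
    "\<And>x. of_int x - 1 = real_of_int (x - 1)" "\<And>x. of_int x - 2 = real_of_int (x - 2)" by simp_all
  show ?thesis by (cases d) (auto simp only: rect.simps cells.simps mem_Times_iff fst_conv snd_conv
        atLeastAtMost_iff e half insert_iff prod.inject empty_iff)
qed

lemma square_subset_rect_if:
  assumes "(m, n) \<in> cells d"
  shows "unit_square (of_int n) (of_int n - of_int m) \<subseteq> rect d"
  using assms by (cases d) (auto simp: unit_square_def)

lemma center_in_square: "(of_int n + 1 / 2, of_int n - of_int m + 1 / 2) \<in> unit_square (of_int n) (of_int n - of_int m)"
  by (simp add: unit_square_def)

lemma square_subset_rect:
  "unit_square (of_int n) (of_int n - of_int m) \<subseteq> rect d \<longleftrightarrow> (m, n) \<in> cells d"
  using square_subset_rect_if center_in_square center_in_rect by blast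

lemma center_in_region:
  "(of_int n + 1 / 2, of_int n - of_int m + 1 / 2) \<in> tiled_region T \<longleftrightarrow> covered T m n"
  by (auto simp: tiled_region_def covered_def center_in_rect)

lemma square_subset_region:
  "unit_square (of_int n) (of_int n - of_int m) \<subseteq> tiled_region T \<longleftrightarrow> covered T m n"
proof
  assume "unit_square (of_int n) (of_int n - of_int m) \<subseteq> tiled_region T"
  then show "covered T m n" using center_in_square center_in_region by blast
next
  assume "covered T m n"
  then show "unit_square (of_int n) (of_int n - of_int m) \<subseteq> tiled_region T"
    unfolding covered_def tiled_region_def using square_subset_rect_if by blast
qed

lemma rect_subset_squares:
  assumes "p \<in> rect d"
  obtains m n where "(m, n) \<in> cells d" "p \<in> unit_square (of_int n) (of_int n - of_int m)"
proof (cases d)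
  case (Horizontal x y)
  show ?thesis
  proof (cases "fst p \<le> of_int x + 1")
    case True
    then show ?thesis using that[of "x - y + 1" x] assms Horizontal by (auto simp: unit_square_def)
  next
    case False
    then show ?thesis using that[of "x - y + 2" "x + 1"] assms Horizontal by (auto simp: unit_square_def)
  qed
next
  case (Vertical x y)
  show ?thesis
  proof (cases "snd p \<le> of_int y - 1")
    case True
    then show ?thesis using that[of "x - y + 2" x] assms Vertical by (auto simp: unit_square_def)
  next
    case False
    then show ?thesis using that[of "x - y + 1" x] assms Vertical by (auto simp: unit_square_def)
  qed
qed

lemma interior_rect_dm:
  "interior (rect (dm m n s)) = {of_int n<..<of_int n + 1 + of_bool s} \<times>
     {of_int n - of_int m - 1 + of_bool s<..<of_int n - of_int m + 1}"
  by (cases s) (simp_all add: dm_def interior_Times interior_atLeastAtMost_real algebra_simps)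

text \<open>The corners are integers, so two open rectangles that meet share a whole cell;
  conversely the center of a shared cell is interior to both.\<close>

lemma interiors_disjoint_iff:
  "interior (rect d) \<inter> interior (rect d') = {} \<longleftrightarrow> cells d \<inter> cells d' = {}"
proof -
  obtain m n s where d: "d = dm m n s" by (rule dm_cases)
  obtain m' n' s' where d': "d' = dm m' n' s'" by (rule dm_cases)
  have "cells d \<inter> cells d' \<noteq> {}" if "interior (rect d) \<inter> interior (rect d') \<noteq> {}"
  proof -
    from that obtain p q where "(p, q) \<in> interior (rect d)" "(p, q) \<in> interior (rect d')" by auto
    then have "of_int n < of_int n' + 1 + (of_bool s' :: real)" "of_int n' < of_int n + 1 + (of_bool s :: real)"
      "of_int n - of_int m - 1 + of_bool s < of_int n' - of_int m' + (1 :: real)"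
      "of_int n' - of_int m' - 1 + of_bool s' < of_int n - of_int m + (1 :: real)"
      unfolding d d' interior_rect_dm mem_Times_iff fst_conv snd_conv greaterThanLessThan_iff by linarith+
    then have i: "n < n' + 1 + of_bool s'" "n' < n + 1 + of_bool s"
      "n - m - 1 + of_bool s < n' - m' + 1" "n' - m' - 1 + of_bool s' < n - m + 1"
      by (cases s; cases s'; simp; linarith)+
    have "m' = m \<and> n' = n \<or> m' = m + 1 \<and> n' = n + of_bool s \<or> m = m' + 1 \<and> n = n' + of_bool s' \<or>
        m' = m \<and> n' + of_bool s' = n + of_bool s"
      using i by (cases s; cases s'; simp; linarith)
    then show ?thesis unfolding d d' cells_dm by auto
  qed
  moreover have "(of_int n + 1 / 2, of_int n - of_int m + 1 / 2) \<in> interior (rect d)"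
    if c: "(m, n) \<in> cells d" for m n d
  proof -
    obtain m' n' s' where e: "d = dm m' n' s'" by (rule dm_cases)
    show ?thesis using c unfolding e interior_rect_dm by (cases s') (auto simp: cells_dm)
  qed
  ultimately show ?thesis by fastforce
qed

section \<open>The geometric conditions in terms of cells\<close>

definition comb_tiling :: "nat \<Rightarrow> domino set \<Rightarrow> bool" where
  "comb_tiling l T \<longleftrightarrow>
     (\<forall>d\<in>T. \<forall>d'\<in>T. d \<noteq> d' \<longrightarrow> cells d \<inter> cells d' = {}) \<and>
     (\<forall>m n. 1 \<le> m \<and> m < 2 * int l \<longrightarrow> covered T m n) \<and>
     (\<forall>m n s. dm m n s \<in> T \<longrightarrow> 0 \<le> m \<and> m < 2 * int l)"

text \<open>The inner band is \<open>1 \<le> x - y \<le> 2 * l - 1\<close>. A point lies in the cell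
  given by the floors of its coordinates, whose diagonal differs from \<open>x - y\<close> by less
  than 1, so the band is covered by the cells on diagonals 1 to \<open>2 * l - 1\<close>.
  Containment in the outer band is tested at the top left corner of the first and at the bottom
  right corner of the second cell of a domino.\<close>

lemma strip_tiling_iff: "strip_tiling l T \<longleftrightarrow> comb_tiling l T"
proof -
  have 1: "{(x, y). \<bar>x - y - real l\<bar> \<le> real l - 1} \<subseteq> tiled_region T \<longleftrightarrow>
    (\<forall>m n. 1 \<le> m \<and> m < 2 * int l \<longrightarrow> covered T m n)" (is "?L \<longleftrightarrow> ?R")
  proof
    assume L: ?L
    show ?R
    proof (intro allI impI)
      fix m n assume m: "1 \<le> m \<and> m < 2 * int l"
      then have "1 \<le> real_of_int m" "real_of_int m \<le> 2 * real l - 1" by linarith+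
      then have "(of_int n + 1 / 2, of_int n - of_int m + 1 / 2) \<in> {(x, y). \<bar>x - y - real l\<bar> \<le> real l - 1}"
        by auto
      then show "covered T m n" using L center_in_region by blast
    qed
  next
    assume R: ?R
    show ?L
    proof clarify
      fix x y :: real assume xy: "\<bar>x - y - real l\<bar> \<le> real l - 1"
      define n where "n = \<lfloor>x\<rfloor>"
      define m where "m = \<lfloor>x\<rfloor> - \<lfloor>y\<rfloor>"
      have "of_int m - 1 < x - y" "x - y < of_int m + 1" unfolding m_def by linarith+
      moreover have "1 \<le> x - y" "x - y \<le> 2 * real l - 1" using xy by linarith+
      ultimately have "0 < real_of_int m" "real_of_int m < real_of_int (2 * int l)" by simp_all
      then have "1 \<le> m" "m < 2 * int l" by linarith+
      then have "unit_square (of_int n) (of_int n - of_int m) \<subseteq> tiled_region T"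
        using R square_subset_region by blast
      moreover have "(x, y) \<in> unit_square (of_int n) (of_int n - of_int m)"
        by (simp add: unit_square_def n_def m_def)
      ultimately show "(x, y) \<in> tiled_region T" by blast
    qed
  qed
  have 2: "tiled_region T \<subseteq> {(x, y). \<bar>x - y - real l\<bar> \<le> real l + 1} \<longleftrightarrow>
    (\<forall>m n s. dm m n s \<in> T \<longrightarrow> 0 \<le> m \<and> m < 2 * int l)" (is "?L \<longleftrightarrow> ?R")
  proof
    assume L: ?L
    show ?R
    proof (intro allI impI)
      fix m n s assume d: "dm m n s \<in> T"
      then have sub: "unit_square (of_int n') (of_int n' - of_int m') \<subseteq> {(x, y). \<bar>x - y - real l\<bar> \<le> real l + 1}"
        if "(m', n') \<in> cells (dm m n s)" for m' n'
        using L square_subset_rect_if[OF that] unfolding tiled_region_def by blast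
      have "(of_int n, of_int n - of_int m + 1) \<in> {(x, y). \<bar>x - y - real l\<bar> \<le> real l + 1}"
        by (rule subsetD[OF sub[of m n]]) (auto simp: cells_dm unit_square_def)
      then have "0 \<le> m" by simp
      moreover have "(of_int (n + of_bool s) + 1, of_int (n + of_bool s) - of_int (m + 1)) \<in>
          {(x, y). \<bar>x - y - real l\<bar> \<le> real l + 1}"
        by (rule subsetD[OF sub[of "m + 1" "n + of_bool s"]]) (auto simp: cells_dm unit_square_def)
      then have "m < 2 * int l" by simp
      ultimately show "0 \<le> m \<and> m < 2 * int l" ..
    qed
  next
    assume R: ?R
    show ?L
    proof
      fix p assume "p \<in> tiled_region T"
      then obtain d where d: "d \<in> T" "p \<in> rect d" by (auto simp: tiled_region_def)
      obtain m' n' where mn: "(m', n') \<in> cells d" "p \<in> unit_square (of_int n') (of_int n' - of_int m')"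
        using rect_subset_squares[OF d(2)] .
      obtain m n s where e: "d = dm m n s" by (rule dm_cases)
      then have "0 \<le> m \<and> m < 2 * int l" using R d(1) by blast
      then have "0 \<le> m'" "m' \<le> 2 * int l" using e mn(1) by (auto simp: cells_dm)
      then have "0 \<le> real_of_int m'" "real_of_int m' \<le> 2 * real l" by linarith+
      then show "p \<in> {(x, y). \<bar>x - y - real l\<bar> \<le> real l + 1}"
        using mn(2) by (auto simp: unit_square_def)
    qed
  qed
  show ?thesis unfolding strip_tiling_def comb_tiling_def interiors_disjoint_iff 1 2 ..
qed

definition comb_steep :: "domino set \<Rightarrow> bool" where
  "comb_steep T \<longleftrightarrow> (\<exists>B. \<forall>m n s. dm m n s \<in> T \<longrightarrow> (B < n \<longrightarrow> even m) \<and> (n < - B \<longrightarrow> odd m))"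

text \<open>On a domino of the strip \<open>x + y\<close> differs from \<open>2 * n\<close> by a
  bounded amount, so the position can be measured by \<open>n\<close> alone; the parity of
  \<open>m\<close> separates the two groups of directions.\<close>

lemma steep_iff:
  assumes "comb_tiling l T"
  shows "steep T \<longleftrightarrow> comb_steep T"
proof -
  have m: "0 \<le> m" "m < 2 * int l" if "dm m n s \<in> T" for m n s
    using assms that unfolding comb_tiling_def by blast+
  have bounds: "of_int n \<le> fst p" "fst p \<le> of_int n + 2" "of_int n - of_int m - 1 \<le> snd p" "snd p \<le> of_int n - of_int m + 1"
    if "p \<in> rect (dm m n s)" for p m n s
    using that by (auto simp: dm_def split: if_splits)
  have corner: "(of_int n, of_int n - of_int m + 1) \<in> rect (dm m n s)" for m n s
    by (auto simp: dm_def)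
  show ?thesis
  proof
    assume "steep T"
    then obtain B :: real where B: "\<And>d. d \<in> T \<Longrightarrow> rect d \<subseteq> {(x, y). x + y > B} \<Longrightarrow> north_going d \<or> east_going d"
      "\<And>d. d \<in> T \<Longrightarrow> rect d \<subseteq> {(x, y). x + y < - B} \<Longrightarrow> south_going d \<or> west_going d"
      unfolding steep_def by blast
    define C where "C = \<lceil>\<bar>B\<bar>\<rceil> + 2 * int l + 3"
    have C: "\<bar>B\<bar> + 2 * real l + 3 \<le> of_int C" unfolding C_def by linarith
    have "(C < n \<longrightarrow> even m) \<and> (n < - C \<longrightarrow> odd m)" if d: "dm m n s \<in> T" for m n s
    proof (intro conjI impI)
      have m': "0 \<le> real_of_int m" "real_of_int m \<le> 2 * real l" using m[OF d] by linarith+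
      {
        assume "C < n"
        then have n: "of_int C < real_of_int n" by simp
        have "rect (dm m n s) \<subseteq> {(x, y). x + y > B}"
        proof
          fix p assume "p \<in> rect (dm m n s)"
          then show "p \<in> {(x, y). x + y > B}" using bounds[of p m n s] m' n C by (cases p) auto
        qed
        from B(1)[OF d this] show "even m" by (auto simp: going_dm)
      }
      assume "n < - C"
      then have n: "real_of_int n < - of_int C" by linarith
      have "rect (dm m n s) \<subseteq> {(x, y). x + y < - B}"
      proof
        fix p assume "p \<in> rect (dm m n s)"
        then show "p \<in> {(x, y). x + y < - B}" using bounds[of p m n s] m' n C by (cases p) auto
      qed
      from B(2)[OF d this] show "odd m" by (auto simp: going_dm)
    qed
    then show "comb_steep T" unfolding comb_steep_def by blast
  next
    assume "comb_steep T"
    then obtain B where B: "\<And>m n s. dm m n s \<in> T \<Longrightarrow> (B < n \<longrightarrow> even m) \<and> (n < - B \<longrightarrow> odd m)"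
      unfolding comb_steep_def by blast
    define C :: real where "C = 2 * of_int \<bar>B\<bar> + 2 * real l + 2"
    have "(rect d \<subseteq> {(x, y). x + y > C} \<longrightarrow> north_going d \<or> east_going d) \<and>
        (rect d \<subseteq> {(x, y). x + y < - C} \<longrightarrow> south_going d \<or> west_going d)" if d: "d \<in> T" for d
    proof -
      obtain m n s where e: "d = dm m n s" by (rule dm_cases)
      have m': "0 \<le> real_of_int m" "real_of_int m \<le> 2 * real l" using m d e by fastforce+
      show ?thesis
      proof (intro conjI impI)
        assume "rect d \<subseteq> {(x, y). x + y > C}"
        then have "(of_int n, of_int n - of_int m + 1) \<in> {(x, y). x + y > C}" using corner e by blast
        then have "B < n" using m' by (simp add: C_def)
        then show "north_going d \<or> east_going d" using B d e by (auto simp: going_dm)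
      next
        assume "rect d \<subseteq> {(x, y). x + y < - C}"
        then have "(of_int n, of_int n - of_int m + 1) \<in> {(x, y). x + y < - C}" using corner e by blast
        then have "n < - B" using m' by (simp add: C_def)
        then show "south_going d \<or> west_going d" using B d e by (auto simp: going_dm)
      qed
    qed
    then show "steep T" unfolding steep_def by blast
  qed
qed

text \<open>Tells whether the asymptotic dominos between the diagonals \<open>m\<close> and
  \<open>m + 1\<close> are horizontal: north-going for even \<open>m\<close>, south-going for odd
  \<open>m\<close>. The same bit is the increment of \<open>front\<close>.\<close>

definition shift_at :: "sign list \<Rightarrow> nat \<Rightarrow> bool" where
  "shift_at w m \<longleftrightarrow> letter w (Suc m) = (if even m then Plus else Minus)"

definition comb_asym :: "nat \<Rightarrow> domino set \<Rightarrow> sign list \<Rightarrow> bool" where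
  "comb_asym l T w \<longleftrightarrow> (\<exists>N. \<forall>m<2 * l. \<forall>n.
     (if even m then N \<le> n else n \<le> - N) \<longrightarrow> dm (int m) n (shift_at w m) \<in> T)"

lemma front_Suc: "front w (Suc m) = front w m + of_bool (shift_at w m)"
  by (simp add: shift_at_def)

lemma going_cover:
  "even m \<Longrightarrow> (\<exists>d\<in>T. (m + 1, n) \<in> cells d \<and> north_going d) \<longleftrightarrow> dm m (n - 1) True \<in> T"
  "even m \<Longrightarrow> (\<exists>d\<in>T. (m + 1, n) \<in> cells d \<and> east_going d) \<longleftrightarrow> dm m n False \<in> T"
  "odd m \<Longrightarrow> (\<exists>d\<in>T. (m, n) \<in> cells d \<and> south_going d) \<longleftrightarrow> dm m n True \<in> T"
  "odd m \<Longrightarrow> (\<exists>d\<in>T. (m, n) \<in> cells d \<and> west_going d) \<longleftrightarrow> dm m n False \<in> T"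
  unfolding Bex_domino going_dm cells_dm
  by (rule iffI; (elim exE conjE)?; force)+

lemma asymptotic_data_iff:
  assumes "length w = 2 * l"
  shows "asymptotic_data l T w \<longleftrightarrow> comb_asym l T w"
proof -
  \<comment> \<open>The square lies on the diagonal \<open>2 * k - 1\<close> and is the second cell
    of its domino, so the position of the domino is shifted back by the bit. In \<open>south\<close>
    the square is the first cell, and no shift occurs.\<close>
  have north: "(\<exists>d\<in>T. unit_square (of_int x - 1) (of_int x - 2 * real k) \<subseteq> rect d \<and>
      (case letter w (2 * k - 1) of Plus \<Rightarrow> north_going d | Minus \<Rightarrow> east_going d)) \<longleftrightarrow>
      dm (int (2 * (k - 1))) (x - 1 - of_bool (shift_at w (2 * (k - 1)))) (shift_at w (2 * (k - 1))) \<in> T"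
    if "1 \<le> k" for k and x :: int
  proof -
    have u: "unit_square (of_int x - 1) (of_int x - 2 * real k) =
        unit_square (of_int (x - 1)) (of_int (x - 1) - of_int (2 * int k - 1))" by simp
    have k: "2 * k - 1 = Suc (2 * (k - 1))" "int (2 * (k - 1)) = 2 * int k - 2" using that by auto
    show ?thesis unfolding u square_subset_rect
      using going_cover(1,2)[of "int (2 * (k - 1))" T "x - 1"] k
      by (cases "letter w (Suc (2 * (k - 1)))") (simp_all add: shift_at_def)
  qed
  have south: "(\<exists>d\<in>T. unit_square (of_int x) (of_int x - 2 * real k + 1) \<subseteq> rect d \<and>
      (case letter w (2 * k) of Plus \<Rightarrow> west_going d | Minus \<Rightarrow> south_going d)) \<longleftrightarrow>
      dm (int (2 * (k - 1) + 1)) x (shift_at w (2 * (k - 1) + 1)) \<in> T"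
    if "1 \<le> k" for k and x :: int
  proof -
    have u: "unit_square (of_int x) (of_int x - 2 * real k + 1) =
        unit_square (of_int x) (of_int x - of_int (2 * int k - 1))" by (simp add: algebra_simps)
    have k: "2 * k = Suc (2 * (k - 1) + 1)" "int (2 * (k - 1) + 1) = 2 * int k - 1" using that by auto
    show ?thesis unfolding u square_subset_rect
      using going_cover(3,4)[of "int (2 * (k - 1) + 1)" T x] k
      by (cases "letter w (Suc (2 * (k - 1) + 1))") (simp_all add: shift_at_def)
  qed
  let ?N = "\<lambda>k x. dm (int (2 * (k - 1))) (x - 1 - of_bool (shift_at w (2 * (k - 1)))) (shift_at w (2 * (k - 1))) \<in> T"
  let ?S = "\<lambda>k x. dm (int (2 * (k - 1) + 1)) x (shift_at w (2 * (k - 1) + 1)) \<in> T"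
  have "asymptotic_data l T w \<longleftrightarrow> (\<forall>k\<in>{1..l}. (\<forall>\<^sub>F x in at_top. ?N k x) \<and> (\<forall>\<^sub>F x in at_bot. ?S k x))"
    unfolding asymptotic_data_def using assms north south by (auto intro!: ball_cong)
  also have "\<dots> \<longleftrightarrow> (\<forall>\<^sub>F x in at_top. \<forall>k\<in>{1..l}. ?N k x) \<and> (\<forall>\<^sub>F x in at_bot. \<forall>k\<in>{1..l}. ?S k x)"
    by (simp add: eventually_ball_finite_distrib ball_conj_distrib)
  also have "\<dots> \<longleftrightarrow> comb_asym l T w"
  proof
    assume "(\<forall>\<^sub>F x in at_top. \<forall>k\<in>{1..l}. ?N k x) \<and> (\<forall>\<^sub>F x in at_bot. \<forall>k\<in>{1..l}. ?S k x)"
    then obtain N1 N2 where N1: "\<And>x k. N1 \<le> x \<Longrightarrow> k \<in> {1..l} \<Longrightarrow> ?N k x"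
      and N2: "\<And>x k. x \<le> N2 \<Longrightarrow> k \<in> {1..l} \<Longrightarrow> ?S k x"
      unfolding eventually_at_top_linorder eventually_at_bot_linorder by blast
    show "comb_asym l T w" unfolding comb_asym_def
    proof (intro exI[of _ "max N1 (- N2)"] allI impI)
      fix m n assume m: "m < 2 * l" and n: "if even m then max N1 (- N2) \<le> n else n \<le> - max N1 (- N2)"
      show "dm (int m) n (shift_at w m) \<in> T"
      proof (cases "even m")
        case True
        then have "2 * (Suc (m div 2) - 1) = m" "Suc (m div 2) \<in> {1..l}" using m by auto
        then show ?thesis using N1[of "n + 1 + of_bool (shift_at w m)" "Suc (m div 2)"] n True by simp
      next
        case False
        then have "2 * (Suc (m div 2) - 1) + 1 = m" "Suc (m div 2) \<in> {1..l}" using m by (auto simp: odd_two_times_div_two_succ)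
        then show ?thesis using N2[of n "Suc (m div 2)"] n False by simp
      qed
    qed
  next
    assume "comb_asym l T w"
    then obtain N where N: "\<And>m n. m < 2 * l \<Longrightarrow> if even m then N \<le> n else n \<le> - N \<Longrightarrow> dm (int m) n (shift_at w m) \<in> T"
      unfolding comb_asym_def by blast
    have "?N k x" if "N + 2 \<le> x" "k \<in> {1..l}" for k x
      using N[of "2 * (k - 1)" "x - 1 - of_bool (shift_at w (2 * (k - 1)))"] that
      by (cases "shift_at w (2 * (k - 1))") auto
    moreover have "?S k x" if "x \<le> - N" "k \<in> {1..l}" for k x
      using N[of "2 * (k - 1) + 1" x] that by auto
    ultimately show "(\<forall>\<^sub>F x in at_top. \<forall>k\<in>{1..l}. ?N k x) \<and> (\<forall>\<^sub>F x in at_bot. \<forall>k\<in>{1..l}. ?S k x)"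
      unfolding eventually_at_top_linorder eventually_at_bot_linorder by blast
  qed
  finally show ?thesis .
qed

lemma half_integer_ball: "(\<forall>x\<in>half_integers. P x) \<longleftrightarrow> (\<forall>n::int. P (of_int n + 1 / 2))"
  by (auto simp: half_integers_def)

lemma half_integer_bex: "(\<exists>x\<in>half_integers. P x) \<longleftrightarrow> (\<exists>n::int. P (of_int n + 1 / 2))"
  by (auto simp: half_integers_def)

lemma pure_tiling_iff:
  "pure_tiling l T \<longleftrightarrow> (\<exists>a b. \<forall>n. (covered T 0 n \<longleftrightarrow> a \<le> n) \<and> (covered T (2 * int l) n \<longleftrightarrow> n \<le> b))"
proof -
  have 1: "unit_square (of_int n + 1 / 2 - 1 / 2) (of_int n + 1 / 2 - 1 / 2) \<subseteq> tiled_region T \<longleftrightarrow> covered T 0 n" for n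
    using square_subset_region[of n 0 T] by simp
  have 2: "unit_square (of_int n + 1 / 2 - 1 / 2) (of_int n + 1 / 2 - 2 * real l - 1 / 2) \<subseteq> tiled_region T \<longleftrightarrow>
      covered T (2 * int l) n" for n
    using square_subset_region[of n "2 * int l" T] by (simp add: algebra_simps)
  show ?thesis unfolding pure_tiling_def half_integer_ball half_integer_bex 1 2 by simp
qed

definition occ :: "domino set \<Rightarrow> int \<Rightarrow> int \<Rightarrow> bool" where
  "occ T m n \<longleftrightarrow> (\<exists>m' n' s. dm m' n' s \<in> T \<and> odd m' \<and> (m, n) \<in> cells (dm m' n' s)) \<or> (\<not> covered T m n \<and> m = 0)"

lemma occupied_iff:
  "occupied T (of_int n + 1 / 2, of_int n + 1 / 2 - of_int m) \<longleftrightarrow> occ T m n"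
proof -
  have e: "(of_int n + 1 / 2, of_int n + 1 / 2 - of_int m) = (of_int n + 1 / 2, of_int n - of_int m + 1 / (2::real))"
    by simp
  have "(\<exists>d\<in>T. (m, n) \<in> cells d \<and> (south_going d \<or> west_going d)) \<longleftrightarrow>
     (\<exists>m' n' s. dm m' n' s \<in> T \<and> odd m' \<and> (m, n) \<in> cells (dm m' n' s))"
    unfolding Bex_domino going_dm by blast
  then show ?thesis
    unfolding occupied_def e center_in_rect center_in_region occ_def by auto
qed

section \<open>Occupation numbers\<close>

text \<open>\<open>R n s\<close> is read as a hop from \<open>n\<close> to
  \<open>n + of_bool s\<close>; the four clauses say that \<open>R\<close> is the graph of a
  bijection from \<open>A\<close> onto \<open>B\<close>. The relational form matches membership of
  dominos in a tiling.\<close>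

definition hops :: "int set \<Rightarrow> (int \<Rightarrow> bool \<Rightarrow> bool) \<Rightarrow> int set \<Rightarrow> bool" where
  "hops A R B \<longleftrightarrow> (\<forall>n. n \<in> A \<longleftrightarrow> (\<exists>s. R n s)) \<and> (\<forall>n. n \<in> B \<longleftrightarrow> (\<exists>s. R (n - of_bool s) s)) \<and>
     (\<forall>n s s'. R n s \<longrightarrow> R n s' \<longrightarrow> s = s') \<and>
     (\<forall>n s s'. R (n - of_bool s) s \<longrightarrow> R (n - of_bool s') s' \<longrightarrow> s = s')"

lemma hopsD:
  assumes "hops A R B"
  shows "n \<in> A \<longleftrightarrow> (\<exists>s. R n s)" "n \<in> B \<longleftrightarrow> (\<exists>s. R (n - of_bool s) s)"
    "R n s \<Longrightarrow> R n s' \<Longrightarrow> s = s'"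
    "R (n - of_bool s) s \<Longrightarrow> R (n - of_bool s') s' \<Longrightarrow> s = s'"
proof -
  note h = assms[unfolded hops_def]
  show "n \<in> A \<longleftrightarrow> (\<exists>s. R n s)" by (rule h[THEN conjunct1, rule_format])
  show "n \<in> B \<longleftrightarrow> (\<exists>s. R (n - of_bool s) s)" by (rule h[THEN conjunct2, THEN conjunct1, rule_format])
  show "R n s \<Longrightarrow> R n s' \<Longrightarrow> s = s'"
    by (rule h[THEN conjunct2, THEN conjunct2, THEN conjunct1, rule_format])
  show "R (n - of_bool s) s \<Longrightarrow> R (n - of_bool s') s' \<Longrightarrow> s = s'"
    by (rule h[THEN conjunct2, THEN conjunct2, THEN conjunct2, rule_format])
qed

text \<open>An injection that moves every point by 0 or 1 is monotone: of two points in order, the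
  left one can at most catch up with the right one, which injectivity forbids.\<close>

lemma hop_function:
  fixes A B :: "int set"
  assumes hop: "hops A R B"
  obtains f where "bij_betw f A B" "\<And>a. a \<in> A \<Longrightarrow> f a = a \<or> f a = a + 1"
    "\<And>a a'. a \<in> A \<Longrightarrow> a' \<in> A \<Longrightarrow> f a \<le> f a' \<longleftrightarrow> a \<le> a'" "\<And>n s. R n s \<Longrightarrow> f n = n + of_bool s"
proof
  have A: "\<And>n. n \<in> A \<longleftrightarrow> (\<exists>s. R n s)" and B: "\<And>n. n \<in> B \<longleftrightarrow> (\<exists>s. R (n - of_bool s) s)"
    and uA: "\<And>n s s'. R n s \<Longrightarrow> R n s' \<Longrightarrow> s = s'"
    and uB: "\<And>n s s'. R (n - of_bool s) s \<Longrightarrow> R (n - of_bool s') s' \<Longrightarrow> s = s'"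
    using hopsD[OF hop] by (assumption | blast)+
  define f where "f n = n + of_bool (R n True)" for n
  show f: "f n = n + of_bool s" if "R n s" for n s
    using that uA[of n s True] by (cases s) (auto simp: f_def)
  show f01: "\<And>a. a \<in> A \<Longrightarrow> f a = a \<or> f a = a + 1" by (auto simp: f_def)
  have inj: "inj_on f A"
  proof (rule inj_onI)
    fix a a' assume a: "a \<in> A" "a' \<in> A" "f a = f a'"
    obtain s s' where s: "R a s" "R a' s'" using A a by auto
    then have "a = f a - of_bool s" "a' = f a - of_bool s'" using f[OF s(1)] f[OF s(2)] a(3) by auto
    then show "a = a'" using uB[of "f a" s s'] s by simp
  qed
  have "f ` A = B"
  proof
    show "f ` A \<subseteq> B"
    proof (rule image_subsetI)
      fix a assume "a \<in> A"
      then obtain s where s: "R a s" using A by auto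
      then have "R (f a - of_bool s) s" using f[OF s] by simp
      then show "f a \<in> B" using B by blast
    qed
    show "B \<subseteq> f ` A"
    proof
      fix b assume "b \<in> B"
      then obtain s where s: "R (b - of_bool s) s" using B by auto
      then show "b \<in> f ` A" using f[OF s] A by (intro image_eqI[of _ _ "b - of_bool s"]) auto
    qed
  qed
  then show "bij_betw f A B" using inj by (simp add: bij_betw_def)
  show "f a \<le> f a' \<longleftrightarrow> a \<le> a'" if a: "a \<in> A" "a' \<in> A" for a a'
  proof -
    have "a < a' \<Longrightarrow> f a \<noteq> f a'" "a' < a \<Longrightarrow> f a \<noteq> f a'" using inj_onD[OF inj _ a] by auto
    then show ?thesis using f01[OF a(1)] f01[OF a(2)] by (cases a a' rule: linorder_cases) auto
  qed
qed

text \<open>The matching preserves the order and moves points to the right by at most 1, which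
  bounds the counts beyond a cut by each other; a cut at a matched pair gives equality. Counts from
  the right serve the occupied sites and counts from the left the empty ones, as these are the
  finite sides.\<close>

lemma hop_counts:
  fixes A B :: "int set"
  assumes hop: "hops A R B"
  shows "finite {b \<in> B. n \<le> b} \<Longrightarrow> card {a \<in> A. n \<le> a} \<le> card {b \<in> B. n \<le> b}"
    and "finite {a \<in> A. n - 1 \<le> a} \<Longrightarrow> card {b \<in> B. n \<le> b} \<le> card {a \<in> A. n - 1 \<le> a}"
    and "R n s \<Longrightarrow> card {a \<in> A. n \<le> a} = card {b \<in> B. n + of_bool s \<le> b}"
    and "finite {a \<in> A. a < n} \<Longrightarrow> card {b \<in> B. b < n} \<le> card {a \<in> A. a < n}"
    and "finite {b \<in> B. b < n} \<Longrightarrow> card {a \<in> A. a < n - 1} \<le> card {b \<in> B. b < n}"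
    and "R n s \<Longrightarrow> card {a \<in> A. a < n} = card {b \<in> B. b < n + of_bool s}"
proof -
  obtain f where f: "bij_betw f A B" "\<And>a. a \<in> A \<Longrightarrow> f a = a \<or> f a = a + 1"
    "\<And>a a'. a \<in> A \<Longrightarrow> a' \<in> A \<Longrightarrow> f a \<le> f a' \<longleftrightarrow> a \<le> a'" "\<And>n s. R n s \<Longrightarrow> f n = n + of_bool s"
    using hop_function[OF hop] by blast
  have inj: "inj_on f {a \<in> A. P a}" for P
    using f(1) by (auto simp: bij_betw_def intro: inj_on_subset)
  have im: "f a \<in> B" if "a \<in> A" for a using bij_betwE[OF f(1)] that by blast
  have pre: "\<exists>a\<in>A. f a = b" if "b \<in> B" for b using f(1) that by (auto simp: bij_betw_def)
  have h: "f ` {a \<in> A. n \<le> a} \<subseteq> {b \<in> B. n \<le> b}" "{b \<in> B. n \<le> b} \<subseteq> f ` {a \<in> A. n - 1 \<le> a}"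
    "f ` {a \<in> A. a < n - 1} \<subseteq> {b \<in> B. b < n}" "{b \<in> B. b < n} \<subseteq> f ` {a \<in> A. a < n}"
    using f(2) im pre by fastforce+
  show "finite {b \<in> B. n \<le> b} \<Longrightarrow> card {a \<in> A. n \<le> a} \<le> card {b \<in> B. n \<le> b}"
    by (rule card_inj_on_le[OF inj h(1)])
  show "finite {a \<in> A. n - 1 \<le> a} \<Longrightarrow> card {b \<in> B. n \<le> b} \<le> card {a \<in> A. n - 1 \<le> a}"
    by (rule surj_card_le[OF _ h(2)])
  show "finite {b \<in> B. b < n} \<Longrightarrow> card {a \<in> A. a < n - 1} \<le> card {b \<in> B. b < n}"
    by (rule card_inj_on_le[OF inj h(3)])
  show "finite {a \<in> A. a < n} \<Longrightarrow> card {b \<in> B. b < n} \<le> card {a \<in> A. a < n}"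
    by (rule surj_card_le[OF _ h(4)])
  assume R: "R n s"
  then have "\<exists>s. R n s" by (rule exI)
  then have n: "n \<in> A" by (simp only: hopsD(1)[OF hop])
  have n': "f n = n + of_bool s" by (rule f(4)[OF R])
  have "f a \<in> {b \<in> B. n + of_bool s \<le> b} \<longleftrightarrow> n \<le> a" if "a \<in> A" for a
    using im[OF that] f(3)[OF n that] n' by simp
  then have "f ` {a \<in> A. n \<le> a} = {b \<in> B. n + of_bool s \<le> b}" using pre by blast
  then show "card {a \<in> A. n \<le> a} = card {b \<in> B. n + of_bool s \<le> b}"
    using card_image[OF inj, of "\<lambda>a. n \<le> a"] by simp
  have "f a \<in> {b \<in> B. b < n + of_bool s} \<longleftrightarrow> a < n" if "a \<in> A" for a
    using im[OF that] f(3)[OF n that] n' by (simp flip: not_le)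
  then have "f ` {a \<in> A. a < n} = {b \<in> B. b < n + of_bool s}" using pre by blast
  then show "card {a \<in> A. a < n} = card {b \<in> B. b < n + of_bool s}"
    using card_image[OF inj, of "\<lambda>a. a < n"] by simp
qed

section \<open>Maya diagrams and their charge\<close>

definition maya :: "int set \<Rightarrow> bool" where
  "maya S \<longleftrightarrow> (\<exists>N. \<forall>n. (n < - N \<longrightarrow> n \<in> S) \<and> (N < n \<longrightarrow> n \<notin> S))"

definition occ_above :: "int set \<Rightarrow> int \<Rightarrow> int" where "occ_above S n = int (card {a \<in> S. n \<le> a})"

definition emp_below :: "int set \<Rightarrow> int \<Rightarrow> int" where "emp_below S n = int (card {a \<in> - S. a < n})"

text \<open>Empty sites are counted from the left and occupied ones from the right; the sign makes the count
  increase with \<open>n\<close> in both cases, so that both kinds of hops obey the same inequalities.\<close>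

definition movable_before :: "bool \<Rightarrow> int set \<Rightarrow> int \<Rightarrow> int" where
  "movable_before b S n = (if b then - occ_above S n else emp_below S n)"

lemma maya_finite:
  assumes "maya S"
  shows "finite {a \<in> S. n \<le> a}" "finite {a \<in> - S. a < n}"
proof -
  obtain N where N: "\<And>n. n < - N \<Longrightarrow> n \<in> S" "\<And>n. N < n \<Longrightarrow> n \<notin> S"
    using assms unfolding maya_def by blast
  have "{a \<in> S. n \<le> a} \<subseteq> {n..N}" "{a \<in> - S. a < n} \<subseteq> {- N..n}" using N by force+
  then show "finite {a \<in> S. n \<le> a}" "finite {a \<in> - S. a < n}" by (auto intro: finite_subset)
qed

lemma above_step:
  assumes "maya S"
  shows "occ_above S n = occ_above S (n + 1) + of_bool (n \<in> S)"
proof (cases "n \<in> S")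
  case True
  then have "{a \<in> S. n \<le> a} = insert n {a \<in> S. n + 1 \<le> a}" by auto
  then show ?thesis using maya_finite[OF assms] True by (simp add: occ_above_def)
next
  case False
  have "{a \<in> S. n \<le> a} = {a \<in> S. n + 1 \<le> a}"
  proof (rule Collect_cong)
    fix a show "(a \<in> S \<and> n \<le> a) = (a \<in> S \<and> n + 1 \<le> a)" using False by (cases "a = n") auto
  qed
  then show ?thesis using False by (simp add: occ_above_def)
qed

lemma below_step:
  assumes "maya S"
  shows "emp_below S (n + 1) = emp_below S n + of_bool (n \<notin> S)"
proof (cases "n \<in> S")
  case False
  then have "{a \<in> - S. a < n + 1} = insert n {a \<in> - S. a < n}" by auto
  then show ?thesis using maya_finite[OF assms] False by (simp add: emp_below_def)
next
  case True
  have "{a \<in> - S. a < n + 1} = {a \<in> - S. a < n}"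
  proof (rule Collect_cong)
    fix a show "(a \<in> - S \<and> a < n + 1) = (a \<in> - S \<and> a < n)" using True by (cases "a = n") auto
  qed
  then show ?thesis using True by (simp add: emp_below_def)
qed

lemma maya_far:
  assumes "maya S"
  obtains N where "\<And>n. N \<le> n \<Longrightarrow> occ_above S n = 0" "\<And>n. n \<le> - N \<Longrightarrow> emp_below S n = 0"
proof -
  obtain N where N: "\<And>n. n < - N \<Longrightarrow> n \<in> S" "\<And>n. N < n \<Longrightarrow> n \<notin> S"
    using assms unfolding maya_def by blast
  have "occ_above S n = 0" if "N + 1 \<le> n" for n
  proof -
    have "{a \<in> S. n \<le> a} = {}" using N(2) that by force
    then show ?thesis by (simp only: occ_above_def card.empty)
  qed
  moreover have "emp_below S n = 0" if "n \<le> - (N + 1)" for n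
  proof -
    have "{a \<in> - S. a < n} = {}" using N(1) that by force
    then show ?thesis by (simp only: emp_below_def card.empty)
  qed
  ultimately show ?thesis using that[of "N + 1"] by blast
qed

definition charge :: "int set \<Rightarrow> int" where "charge S = occ_above S 0 - emp_below S 0"

text \<open>Moving the cut by one either loses an occupied site or gains an empty one, and the
  summand \<open>n\<close> compensates for both. The charge can thus be read off at a cut where one
  of the counts vanishes.\<close>

lemma charge_eq:
  assumes "maya S"
  shows "occ_above S n - emp_below S n + n = charge S"
proof -
  have step: "occ_above S (n + 1) - emp_below S (n + 1) + (n + 1) = occ_above S n - emp_below S n + n" for n
    using above_step[OF assms, of n] below_step[OF assms, of n] by (cases "n \<in> S") auto
  show ?thesis
  proof (induction n rule: int_induct[where k = 0])
    case (step1 i)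
    then show ?case using step[of i] by simp
  next
    case (step2 i)
    then show ?case using step[of "i - 1"] by simp
  qed (simp add: charge_def)
qed

text \<open>Far to the left no site is empty and \<open>charge_eq\<close> makes the count linear;
  measuring positions from the charge turns it into \<open>vac\<close>.\<close>

lemma is_state_above:
  assumes "maya S" "charge S = c"
  shows "is_state (\<lambda>x. occ_above S (x + c))"
proof -
  obtain N where N: "\<And>n. N \<le> n \<Longrightarrow> occ_above S n = 0" "\<And>n. n \<le> - N \<Longrightarrow> emp_below S n = 0"
    using maya_far[OF assms(1)] by blast
  have 1: "occ_above S (n + 1 + c) \<le> occ_above S (n + c) \<and> occ_above S (n + c) \<le> occ_above S (n + 1 + c) + 1" for n
    using above_step[OF assms(1), of "n + c"] by (simp add: ac_simps)
  have 2: "occ_above S (n + c) = vac n" if "\<bar>N\<bar> + \<bar>c\<bar> \<le> \<bar>n\<bar>" for n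
    using N(1)[of "n + c"] N(2)[of "n + c"] that charge_eq[OF assms(1), of "n + c"] assms(2)
    by (cases "0 \<le> n") (auto simp: vac_def)
  show ?thesis unfolding is_state_def using 1 2 by blast
qed

text \<open>The particles of a state sit at its descents; counting them recovers the state, which
  inverts the passage from configurations to counting functions.\<close>

lemma card_descents:
  assumes "is_state h"
  shows "int (card {a. h (a + 1) < h a \<and> x \<le> a}) = h x"
proof -
  let ?S = "{a. h (a + 1) < h a}"
  obtain N where N: "N \<ge> 0" "\<And>n. N \<le> \<bar>n\<bar> \<Longrightarrow> h n = vac n"
    using state_bound[OF assms] by blast
  have h1: "h (n + 1) \<le> h n" "h n \<le> h (n + 1) + 1" for n using assms by (auto simp: is_state_def)
  have m: "maya ?S" unfolding maya_def
  proof (intro exI[of _ "N + 1"] allI conjI impI)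
    fix n
    show "n \<in> ?S" if "n < - (N + 1)" using that N(1) N(2)[of n] N(2)[of "n + 1"] by (auto simp: vac_def)
    show "n \<notin> ?S" if "N + 1 < n" using that N(1) N(2)[of n] N(2)[of "n + 1"] by (auto simp: vac_def)
  qed
  obtain M where M: "\<And>n. M \<le> n \<Longrightarrow> occ_above ?S n = 0" "\<And>n. n \<le> - M \<Longrightarrow> emp_below ?S n = 0"
    using maya_far[OF m] by blast
  have "occ_above ?S x = h x"
  proof (induction x rule: int_induct[where k = "max M N"])
    case base
    then show ?case using M(1)[of "max M N"] N(1) N(2)[of "max M N"] by (auto simp: vac_def)
  next
    case (step1 i)
    then show ?case using M(1)[of "i + 1"] N(1) N(2)[of "i + 1"] by (auto simp: vac_def)
  next
    case (step2 i)
    then show ?case using above_step[OF m, of "i - 1"] h1[of "i - 1"] by auto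
  qed
  then show ?thesis by (simp add: occ_above_def)
qed

section \<open>Normalised tilings and their particle configurations\<close>

text \<open>Each translation class contains exactly one tiling with \<open>0\<close> as the front on the first diagonal.\<close>

definition norm_tilings :: "nat \<Rightarrow> sign list \<Rightarrow> domino set set" where
  "norm_tilings l w = {T. comb_tiling l T \<and> comb_steep T \<and> comb_asym l T w \<and>
     (\<forall>n. covered T 0 n \<longleftrightarrow> 0 \<le> n) \<and> (\<exists>b. \<forall>n. covered T (2 * int l) n \<longleftrightarrow> n \<le> b)}"

definition sites :: "domino set \<Rightarrow> nat \<Rightarrow> int set" where
  "sites T m = {n. occ T (int m) n}"

text \<open>Measured from \<open>front w m\<close>, the configuration on the diagonal \<open>m\<close> has charge 0. Beyond the last
  diagonal, \<open>profile\<close> is padded by the empty partition.\<close>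

definition profile :: "nat \<Rightarrow> sign list \<Rightarrow> domino set \<Rightarrow> nat \<Rightarrow> int \<Rightarrow> int" where
  "profile l w T m = (if m \<le> 2 * l then \<lambda>x. occ_above (sites T m) (x + front w m) else vac)"

definition steps :: "nat \<Rightarrow> sign list \<Rightarrow> (sign \<times> bool \<times> int) list" where
  "steps l w = map (\<lambda>m. (letter w (Suc m), even m, int m + 1)) [0..<2 * l]"

lemma covered_iff:
  "covered T m n \<longleftrightarrow> (\<exists>s. dm m n s \<in> T) \<or> (\<exists>s. dm (m - 1) (n - of_bool s) s \<in> T)"
proof
  assume "covered T m n"
  then obtain m' n' s where "dm m' n' s \<in> T" "(m, n) \<in> cells (dm m' n' s)"
    unfolding covered_def Bex_domino by blast
  moreover from this(2) consider "m' = m" "n' = n" | "m' = m - 1" "n' = n - of_bool s"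
    by (force simp: cells_dm)
  ultimately show "(\<exists>s. dm m n s \<in> T) \<or> (\<exists>s. dm (m - 1) (n - of_bool s) s \<in> T)" by metis
next
  assume "(\<exists>s. dm m n s \<in> T) \<or> (\<exists>s. dm (m - 1) (n - of_bool s) s \<in> T)"
  then show "covered T m n"
  proof (elim disjE exE)
    fix s assume "dm m n s \<in> T"
    then show ?thesis unfolding covered_def by (rule bexI[rotated]) (simp add: cells_dm)
  next
    fix s assume "dm (m - 1) (n - of_bool s) s \<in> T"
    then show ?thesis unfolding covered_def by (rule bexI[rotated]) (simp add: cells_dm)
  qed
qed

lemma tiling_unique:
  assumes "comb_tiling l T" "dm m n s \<in> T" "dm m' n' s' \<in> T"
    "c \<in> cells (dm m n s)" "c \<in> cells (dm m' n' s')"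
  shows "m = m' \<and> n = n' \<and> s = s'"
proof -
  have "dm m n s = dm m' n' s'" using assms unfolding comb_tiling_def by blast
  then show ?thesis by simp
qed

lemma tiling_range:
  assumes "comb_tiling l T" "dm m n s \<in> T"
  shows "0 \<le> m" "m < 2 * int l"
  using assms unfolding comb_tiling_def by blast+

lemma occ_iff:
  "occ T m n \<longleftrightarrow> (if odd m then \<exists>s. dm m n s \<in> T else (\<exists>s. dm (m - 1) (n - of_bool s) s \<in> T)) \<or>
     (\<not> covered T m n \<and> m = 0)"
proof -
  have "(\<exists>m' n' s. dm m' n' s \<in> T \<and> odd m' \<and> (m, n) \<in> cells (dm m' n' s)) \<longleftrightarrow>
    (if odd m then \<exists>s. dm m n s \<in> T else (\<exists>s. dm (m - 1) (n - of_bool s) s \<in> T))" (is "?L \<longleftrightarrow> ?R")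
  proof
    assume ?L
    then obtain m' n' s where d: "dm m' n' s \<in> T" "odd m'" "(m, n) \<in> cells (dm m' n' s)" by blast
    from d(3) consider "m' = m" "n' = n" | "m' = m - 1" "n' = n - of_bool s" by (force simp: cells_dm)
    then show ?R
    proof cases
      case 1
      then have "odd m" "dm m n s \<in> T" using d by simp_all
      then show ?thesis by metis
    next
      case 2
      then have "even m" "dm (m - 1) (n - of_bool s) s \<in> T" using d by simp_all
      then show ?thesis by metis
    qed
  next
    assume ?R
    then show ?L
    proof (cases "odd m")
      case True
      then obtain s where "dm m n s \<in> T" using \<open>?R\<close> by auto
      then show ?thesis using True by (intro exI[of _ m] exI[of _ n] exI[of _ s]) (auto simp: cells_dm)
    next
      case False
      then obtain s where "dm (m - 1) (n - of_bool s) s \<in> T" using \<open>?R\<close> by auto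
      then show ?thesis using False
        by (intro exI[of _ "m - 1"] exI[of _ "n - of_bool s"] exI[of _ s]) (auto simp: cells_dm)
    qed
  qed
  then show ?thesis unfolding occ_def by blast
qed

text \<open>A cell of an inner diagonal lies in exactly one domino, shared with the next or with the
  previous diagonal, and it is occupied exactly if the first diagonal of that domino is odd.
  Diagonal 0 fits in because its uncovered cells count as occupied.\<close>

lemma site_source:
  assumes T: "comb_tiling l T" and m: "m < 2 * l"
  shows "(n \<in> sites T m \<longleftrightarrow> odd m) \<longleftrightarrow> (\<exists>s. dm (int m) n s \<in> T)"
proof -
  have cov: "m \<noteq> 0 \<Longrightarrow> covered T (int m) n" using T m unfolding comb_tiling_def by auto
  have neg: "dm (- 1) n s \<notin> T" for n s using tiling_range[OF T] by force
  have excl: "dm (int m) n s \<in> T \<Longrightarrow> dm (int m - 1) (n - of_bool s') s' \<notin> T" for s s'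
    using tiling_unique[OF T, of "int m" n s "int m - 1" "n - of_bool s'" s' "(int m, n)"]
    by (auto simp: cells_dm)
  show ?thesis
  proof (cases "odd m")
    case True
    then show ?thesis by (auto simp: sites_def occ_iff)
  next
    case False
    show ?thesis
    proof (cases "m = 0")
      case True
      then show ?thesis using neg by (auto simp: sites_def occ_iff covered_iff)
    next
      case nz: False
      have "n \<in> sites T m \<longleftrightarrow> (\<exists>s. dm (int m - 1) (n - of_bool s) s \<in> T)"
        using False nz by (simp add: sites_def occ_iff)
      then show ?thesis using False cov[OF nz] excl unfolding covered_iff by metis
    qed
  qed
qed

text \<open>The same dichotomy seen from the other end; the last diagonal fits in because its
  uncovered cells count as empty.\<close>

lemma site_target:
  assumes T: "comb_tiling l T" and m: "m < 2 * l"
  shows "(n \<in> sites T (Suc m) \<longleftrightarrow> odd m) \<longleftrightarrow> (\<exists>s. dm (int m) (n - of_bool s) s \<in> T)"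
proof -
  have excl: "dm (1 + int m) n s \<in> T \<Longrightarrow> dm (int m) (n - of_bool s') s' \<notin> T" for s s'
    using tiling_unique[OF T, of "1 + int m" n s "int m" "n - of_bool s'" s' "(1 + int m, n)"]
    by (auto simp: cells_dm)
  show ?thesis
  proof (cases "odd m")
    case True
    then show ?thesis by (auto simp: sites_def occ_iff)
  next
    case False
    then have "Suc m \<noteq> 2 * l" by presburger
    then have "covered T (1 + int m) n" using T m unfolding comb_tiling_def by auto
    moreover have "n \<in> sites T (Suc m) \<longleftrightarrow> (\<exists>s. dm (1 + int m) n s \<in> T)"
      using False by (simp add: sites_def occ_iff)
    ultimately show ?thesis using False excl unfolding covered_iff by (metis add_diff_cancel_left')
  qed
qed

lemma sites_left:
  assumes "T \<in> norm_tilings l w"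
  shows "sites T 0 = {..<0}"
proof (rule set_eqI)
  fix n
  have c: "comb_tiling l T" "covered T 0 n \<longleftrightarrow> 0 \<le> n" using assms by (auto simp: norm_tilings_def)
  have "dm (- 1) n s \<notin> T" for n s using tiling_range[OF c(1)] by force
  then show "n \<in> sites T 0 \<longleftrightarrow> n \<in> {..<0}" using c(2) by (auto simp: sites_def occ_iff)
qed

lemma sites_right_iff_covered:
  assumes "comb_tiling l T" "l > 0"
  shows "n \<in> sites T (2 * l) \<longleftrightarrow> covered T (2 * int l) n"
proof -
  have "dm (2 * int l) n s \<notin> T" for s using tiling_range[OF assms(1)] by force
  moreover have "n \<in> sites T (2 * l) \<longleftrightarrow> (\<exists>s. dm (2 * int l - 1) (n - of_bool s) s \<in> T)"
    using assms(2) by (simp add: sites_def occ_iff)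
  ultimately show ?thesis unfolding covered_iff by blast
qed

lemma sites_right:
  assumes T: "T \<in> norm_tilings l w"
  obtains b where "sites T (2 * l) = {..b}"
proof (cases "l = 0")
  case True
  have "{..<0} = {..- 1 :: int}" by (rule set_eqI) (simp only: lessThan_iff atMost_iff, linarith)
  then have "sites T (2 * l) = {..- 1}" using sites_left[OF T] True by simp
  then show ?thesis by (rule that)
next
  case False
  have c: "comb_tiling l T" using T by (simp add: norm_tilings_def)
  obtain b where "\<And>n. covered T (2 * int l) n \<longleftrightarrow> n \<le> b" using T by (auto simp: norm_tilings_def)
  then have "sites T (2 * l) = {..b}" using sites_right_iff_covered[OF c] False by (intro set_eqI) simp
  then show ?thesis by (rule that)
qed

text \<open>On the inner diagonals an occupied site far to the right, or an empty one far to the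
  left, would lie in a domino that steepness excludes. The two outer diagonals are half lines by
  purity.\<close>

lemma maya_sites:
  assumes T: "T \<in> norm_tilings l w" and m: "m \<le> 2 * l"
  shows "maya (sites T m)"
proof -
  have c: "comb_tiling l T" using T by (simp add: norm_tilings_def)
  obtain B where B: "\<And>m n s. dm m n s \<in> T \<Longrightarrow> (B < n \<longrightarrow> even m) \<and> (n < - B \<longrightarrow> odd m)"
    using T unfolding norm_tilings_def comb_steep_def by blast
  obtain b where b: "sites T (2 * l) = {..b}" using sites_right[OF T] .
  consider "m = 0" | "m = 2 * l" | k where "m = Suc k" "m < 2 * l" using m by (cases m) force+
  then show ?thesis
  proof cases
    case 1
    then show ?thesis unfolding maya_def by (intro exI[of _ 0]) (simp add: sites_left[OF T])
  next
    case 2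
    then show ?thesis unfolding maya_def by (intro exI[of _ "\<bar>b\<bar> + 1"]) (auto simp: b)
  next
    case 3
    have src: "\<exists>s. dm (int m) n s \<in> T" if "n \<in> sites T m \<longleftrightarrow> odd m" for n
      using site_source[OF c 3(2)] that by blast
    have tgt: "\<exists>s. dm (int k) (n - of_bool s) s \<in> T" if "n \<in> sites T m \<longleftrightarrow> even m" for n
      using site_target[OF c, of k n] that 3 by simp
    show ?thesis unfolding maya_def
    proof (intro exI[of _ "\<bar>B\<bar> + 1"] allI conjI impI)
      fix n
      show "n \<in> sites T m" if n: "n < - (\<bar>B\<bar> + 1)"
      proof (rule ccontr)
        assume no: "n \<notin> sites T m"
        show False
        proof (cases "odd m")
          case True
          then obtain s where "dm (int k) (n - of_bool s) s \<in> T" using tgt no by blast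
          then show False using B[of "int k" "n - of_bool s" s] n True 3 by (cases s) auto
        next
          case False
          then obtain s where "dm (int m) n s \<in> T" using src no by blast
          then show False using B[of "int m" n s] n False by auto
        qed
      qed
      show "n \<notin> sites T m" if n: "\<bar>B\<bar> + 1 < n"
      proof
        assume yes: "n \<in> sites T m"
        show False
        proof (cases "odd m")
          case True
          then obtain s where "dm (int m) n s \<in> T" using src yes by blast
          then show False using B[of "int m" n s] n True by auto
        next
          case False
          then obtain s where "dm (int k) (n - of_bool s) s \<in> T" using tgt yes by blast
          then show False using B[of "int k" "n - of_bool s" s] n False 3 by (cases s) auto
        qed
      qed
    qed
  qed
qed

lemma sites_hop:
  assumes T: "T \<in> norm_tilings l w" and m: "m < 2 * l"
  shows "movable_before (odd m) (sites T m) (n - 1) \<le> movable_before (odd m) (sites T (Suc m)) n"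
    and "movable_before (odd m) (sites T (Suc m)) n \<le> movable_before (odd m) (sites T m) n"
    and "dm (int m) n s \<in> T \<Longrightarrow>
      movable_before (odd m) (sites T m) n = movable_before (odd m) (sites T (Suc m)) (n + of_bool s)"
proof -
  let ?S = "sites T m" and ?S' = "sites T (Suc m)"
  let ?R = "\<lambda>n s. dm (int m) n s \<in> T"
  have c: "comb_tiling l T" using T by (auto simp: norm_tilings_def)
  have mS: "maya ?S" "maya ?S'" using maya_sites[OF T] m by auto
  have u: "?R n s \<Longrightarrow> ?R n s' \<Longrightarrow> s = s'"
    "?R (n - of_bool s) s \<Longrightarrow> ?R (n - of_bool s') s' \<Longrightarrow> s = s'" for n s s'
    using tiling_unique[OF c, of "int m" n s "int m" n s' "(int m, n)"]
      tiling_unique[OF c, of "int m" "n - of_bool s" s "int m" "n - of_bool s'" s' "(int m + 1, n)"]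
    by (auto simp: cells_dm)
  have A: "n \<in> {n. n \<in> ?S \<longleftrightarrow> odd m} \<longleftrightarrow> (\<exists>s. ?R n s)"
    "n \<in> {n. n \<in> ?S' \<longleftrightarrow> odd m} \<longleftrightarrow> (\<exists>s. ?R (n - of_bool s) s)" for n
    using site_source[OF c m, of n] site_target[OF c m, of n] by simp_all
  have "hops {n. n \<in> ?S \<longleftrightarrow> odd m} ?R {n. n \<in> ?S' \<longleftrightarrow> odd m}"
    unfolding hops_def by (intro conjI allI impI) (erule (1) u | rule A)+
  note H = hop_counts[OF this]
  show "movable_before (odd m) ?S (n - 1) \<le> movable_before (odd m) ?S' n"
    "movable_before (odd m) ?S' n \<le> movable_before (odd m) ?S n"
    "?R n s \<Longrightarrow> movable_before (odd m) ?S n = movable_before (odd m) ?S' (n + of_bool s)"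
    using H(1,2,4,5)[of n] H(3,6)[of n s] maya_finite[OF mS(1)] maya_finite[OF mS(2)]
    by (auto simp: movable_before_def occ_above_def emp_below_def)
qed

text \<open>Far out on the side described by the asymptotic data, a cut at an asymptotic domino
  gives equal counts of the moving kind on both diagonals, while the counts of the other kind
  vanish. The charge therefore changes by the length of the hop, which is the increment of
  \<open>front\<close>.\<close>

lemma charge_sites:
  assumes T: "T \<in> norm_tilings l w" and m: "m \<le> 2 * l"
  shows "charge (sites T m) = front w m"
  using m
proof (induction m)
  case 0
  have "{a \<in> {..<0}. 0 \<le> a} = ({} :: int set)" "{a \<in> - {..<0}. a < 0} = ({} :: int set)" by auto
  then show ?case
    unfolding charge_def occ_above_def emp_below_def sites_left[OF T] by (simp only: card.empty front.simps)
next
  case (Suc m)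
  obtain N where N: "\<And>m n. m < 2 * l \<Longrightarrow> if even m then N \<le> n else n \<le> - N \<Longrightarrow> dm (int m) n (shift_at w m) \<in> T"
    using T unfolding norm_tilings_def comb_asym_def by blast
  let ?S = "sites T m" and ?S' = "sites T (Suc m)" and ?b = "of_bool (shift_at w m) :: int"
  have mS: "maya ?S" "maya ?S'" using maya_sites[OF T] Suc.prems by auto
  obtain N1 where N1: "\<And>n. N1 \<le> n \<Longrightarrow> occ_above ?S n = 0" "\<And>n. n \<le> - N1 \<Longrightarrow> emp_below ?S n = 0"
    using maya_far[OF mS(1)] by blast
  obtain N2 where N2: "\<And>n. N2 \<le> n \<Longrightarrow> occ_above ?S' n = 0" "\<And>n. n \<le> - N2 \<Longrightarrow> emp_below ?S' n = 0"
    using maya_far[OF mS(2)] by blast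
  define M where "M = \<bar>N\<bar> + \<bar>N1\<bar> + \<bar>N2\<bar> + 1"
  have m2: "m < 2 * l" using Suc.prems by simp
  have "charge ?S' = charge ?S + ?b"
  proof (cases "odd m")
    case True
    have "occ_above ?S (- M) = occ_above ?S' (- M + ?b)"
      using sites_hop(3)[OF T m2, of "- M" "shift_at w m"] N[OF m2, of "- M"] True
      by (simp add: M_def movable_before_def)
    moreover have "emp_below ?S (- M) = 0" "emp_below ?S' (- M + ?b) = 0"
      using N1(2)[of "- M"] N2(2)[of "- M + ?b"] by (auto simp: M_def of_bool_def)
    ultimately show ?thesis
      using charge_eq[OF mS(1), of "- M"] charge_eq[OF mS(2), of "- M + ?b"] by simp
  next
    case False
    have "emp_below ?S M = emp_below ?S' (M + ?b)"
      using sites_hop(3)[OF T m2, of M "shift_at w m"] N[OF m2, of M] False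
      by (simp add: M_def movable_before_def)
    moreover have "occ_above ?S M = 0" "occ_above ?S' (M + ?b) = 0"
      using N1(1)[of M] N2(1)[of "M + ?b"] by (auto simp: M_def of_bool_def)
    ultimately show ?thesis
      using charge_eq[OF mS(1), of M] charge_eq[OF mS(2), of "M + ?b"] by simp
  qed
  then show ?case using Suc by (simp add: front_Suc del: front.simps)
qed

section \<open>The correspondence between tilings and paths\<close>

text \<open>In absolute positions the four kinds of steps reduce to two: the inequalities for hops
  of occupied sites if \<open>m\<close> is odd and of empty sites if \<open>m\<close> is even.
  Whether the step adds or removes is absorbed by the motion of the front.\<close>

lemma trans_step_iff:
  fixes a b :: "int \<Rightarrow> int" and w :: "sign list" and m :: nat and i :: int
  defines "A \<equiv> \<lambda>n. a (n - front w m)" and "B \<equiv> \<lambda>n. b (n - front w (Suc m))"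
  shows "trans_step (letter w (Suc m), even m, i) a b \<longleftrightarrow>
    (if odd m then \<forall>n. A n \<le> B n \<and> B n \<le> A (n - 1)
     else \<forall>n. A (n - 1) + (n - 1) - front w m \<le> B n + n - front w (Suc m) \<and>
              B n + n - front w (Suc m) \<le> A n + n - front w m)"
proof -
  let ?c = "front w m"
  have sh: "(\<forall>n. P n) \<longleftrightarrow> (\<forall>n. P (n - d))" for P and d :: int
  proof (intro iffI allI)
    fix n assume "\<forall>n. P (n - d)"
    from spec[OF this, of "n + d"] show "P n" by simp
  qed simp
  show ?thesis
  proof (cases "odd m")
    case odd: True
    show ?thesis
    proof (cases "letter w (Suc m)")
      case Plus
      then have "front w (Suc m) = ?c" using odd by simp
      then show ?thesis using odd Plus sh[of "\<lambda>n. a n \<le> b n \<and> b n \<le> a (n - 1)" ?c]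
        by (simp add: A_def B_def up_def vstep_def algebra_simps)
    next
      case Minus
      then have "front w (Suc m) = ?c + 1" using odd by simp
      moreover have "(\<forall>n. b n \<le> a n \<and> a n \<le> b (n - 1)) \<longleftrightarrow> (\<forall>n. a n \<le> b (n - 1) \<and> b (n - 1) \<le> a (n - 1))"
        using sh[of "\<lambda>n. b n \<le> a n" 1] by auto
      ultimately show ?thesis using odd Minus sh[of "\<lambda>n. a n \<le> b (n - 1) \<and> b (n - 1) \<le> a (n - 1)" ?c]
        by (simp add: A_def B_def up_def vstep_def algebra_simps)
    qed
  next
    case even: False
    show ?thesis
    proof (cases "letter w (Suc m)")
      case Plus
      then have "front w (Suc m) = ?c + 1" using even by simp
      then show ?thesis using even Plus sh[of "\<lambda>n. a n \<le> b n \<and> b n \<le> a (n + 1) + 1" "?c + 1"]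
        by (simp add: A_def B_def up_def hstep_def algebra_simps)
    next
      case Minus
      then have "front w (Suc m) = ?c" using even by simp
      moreover have "(\<forall>n. b n \<le> a n \<and> a n \<le> b (n + 1) + 1) \<longleftrightarrow> (\<forall>n. b n \<le> a n \<and> a (n - 1) \<le> b n + 1)"
        using sh[of "\<lambda>n. a n \<le> b (n + 1) + 1" 1] by auto
      ultimately show ?thesis using even Minus sh[of "\<lambda>n. b n \<le> a n \<and> a (n - 1) \<le> b n + 1" ?c]
        by (simp add: A_def B_def up_def hstep_def algebra_simps conj_commute)
    qed
  qed
qed

lemma length_steps [simp]: "length (steps l w) = 2 * l"
  by (simp add: steps_def)

lemma nth_steps [simp]: "m < 2 * l \<Longrightarrow> steps l w ! m = (letter w (Suc m), even m, int m + 1)"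
  by (simp add: steps_def)

lemma profile_in_paths:
  assumes T: "T \<in> norm_tilings l w"
  shows "profile l w T \<in> paths (steps l w)"
proof -
  have st: "is_state (profile l w T m)" for m
    using is_state_above[OF maya_sites[OF T] charge_sites[OF T]] by (auto simp: profile_def is_state_vac)
  \<comment> \<open>A half line of particles is the vacuum up to translation, and the charge forces
    its end to be at the front.\<close>
  have vac_if: "profile l w T m = vac" if m: "m \<le> 2 * l" and sb: "sites T m = {..b}" for m b
  proof -
    have "{a \<in> sites T m. n \<le> a} = {n..b}" for n unfolding sb by auto
    then have a: "occ_above (sites T m) n = max 0 (b + 1 - n)" for n by (simp add: occ_above_def)
    have "{a \<in> - sites T m. a < b + 1} = {}" unfolding sb by auto
    then have "emp_below (sites T m) (b + 1) = 0" by (simp only: emp_below_def card.empty)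
    then have "front w m = b + 1"
      using charge_eq[OF maya_sites[OF T m], of "b + 1"] charge_sites[OF T m] a by simp
    then show ?thesis using m a by (auto simp: profile_def vac_def)
  qed
  have "{..<0} = {..- 1 :: int}" by (rule set_eqI) (simp only: lessThan_iff atMost_iff, linarith)
  then have start: "profile l w T 0 = vac" using sites_left[OF T] by (intro vac_if) simp_all
  obtain b where "sites T (2 * l) = {..b}" using sites_right[OF T] .
  then have "profile l w T (2 * l) = vac" by (intro vac_if) simp_all
  then have finish: "profile l w T m = vac" if "m \<ge> 2 * l" for m
    using that by (cases "m = 2 * l") (simp_all add: profile_def)
  have "trans_step (steps l w ! m) (profile l w T m) (profile l w T (Suc m))" if m: "m < 2 * l" for m
  proof -
    let ?S = "sites T m" and ?S' = "sites T (Suc m)"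
    have p: "profile l w T m (n - front w m) = occ_above ?S n"
      "profile l w T (Suc m) (n - front w (Suc m)) = occ_above ?S' n" for n
      using m by (simp_all add: profile_def)
    have e: "occ_above ?S n + n - front w m = emp_below ?S n"
      "occ_above ?S' n + n - front w (Suc m) = emp_below ?S' n" for n
      using charge_eq[OF maya_sites[OF T], of m n] charge_eq[OF maya_sites[OF T], of "Suc m" n]
        charge_sites[OF T, of m] charge_sites[OF T, of "Suc m"] m by (simp_all del: front.simps)
    show ?thesis
      unfolding nth_steps[OF m] trans_step_iff p e using sites_hop(1,2)[OF T m]
      by (auto simp: movable_before_def split: if_splits)
  qed
  then show ?thesis unfolding paths_def using st start finish by simp
qed

section \<open>From paths back to tilings\<close>

definition path_sites :: "sign list \<Rightarrow> (nat \<Rightarrow> int \<Rightarrow> int) \<Rightarrow> nat \<Rightarrow> int set" where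
  "path_sites w p m = {n. p m (n + 1 - front w m) < p m (n - front w m)}"

text \<open>The value of \<open>movable_before\<close> for the configuration of the path; the second
  branch uses that the configuration has charge \<open>front w m\<close>.\<close>

definition site_rank :: "sign list \<Rightarrow> (nat \<Rightarrow> int \<Rightarrow> int) \<Rightarrow> bool \<Rightarrow> nat \<Rightarrow> int \<Rightarrow> int" where
  "site_rank w p b m n = (if b then - p m (n - front w m) else p m (n - front w m) + n - front w m)"

text \<open>The dominos between the diagonals \<open>m\<close> and \<open>m + 1\<close> match the occupied (\<open>m\<close> odd) or empty (\<open>m\<close> even)
  sites of both diagonals in increasing order, hence join sites of equal rank.\<close>

definition joins :: "sign list \<Rightarrow> (nat \<Rightarrow> int \<Rightarrow> int) \<Rightarrow> nat \<Rightarrow> int \<Rightarrow> bool \<Rightarrow> bool" where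
  "joins w p m n s \<longleftrightarrow> (n \<in> path_sites w p m \<longleftrightarrow> odd m) \<and>
     (n + of_bool s \<in> path_sites w p (Suc m) \<longleftrightarrow> odd m) \<and>
     site_rank w p (odd m) m n = site_rank w p (odd m) (Suc m) (n + of_bool s)"

definition tiling_of :: "nat \<Rightarrow> sign list \<Rightarrow> (nat \<Rightarrow> int \<Rightarrow> int) \<Rightarrow> domino set" where
  "tiling_of l w p = {dm (int m) n s |m n s. m < 2 * l \<and> joins w p m n s}"

lemma tiling_of_iff:
  "dm k n s \<in> tiling_of l w p \<longleftrightarrow> (\<exists>m. k = int m \<and> m < 2 * l \<and> joins w p m n s)"
  by (auto simp: tiling_of_def)

lemma rank_step:
  assumes "is_state (p m)"
  shows "site_rank w p b m (n + 1) = site_rank w p b m n + of_bool (n \<in> path_sites w p m \<longleftrightarrow> b)"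
proof -
  have "p m (n - front w m + 1) \<le> p m (n - front w m)" "p m (n - front w m) \<le> p m (n - front w m + 1) + 1"
    using assms by (auto simp: is_state_def)
  then show ?thesis by (auto simp: site_rank_def path_sites_def algebra_simps)
qed

lemma rank_hop:
  assumes "p \<in> paths (steps l w)" "m < 2 * l"
  shows "site_rank w p (odd m) m (n - 1) \<le> site_rank w p (odd m) (Suc m) n"
    and "site_rank w p (odd m) (Suc m) n \<le> site_rank w p (odd m) m n"
proof -
  have "trans_step (letter w (Suc m), even m, int m + 1) (p m) (p (Suc m))"
    using assms by (auto simp: paths_def)
  note H = this[unfolded trans_step_iff]
  show "site_rank w p (odd m) m (n - 1) \<le> site_rank w p (odd m) (Suc m) n"
    "site_rank w p (odd m) (Suc m) n \<le> site_rank w p (odd m) m n"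
    using H by (auto simp: site_rank_def simp del: front.simps split: if_splits dest: spec[of _ n])
qed

text \<open>On both diagonals the rank grows by 1 exactly at movable sites, and by
  \<open>rank_hop\<close> the two ranks interlace. So the partner of a movable site \<open>n\<close>
  is found at \<open>n\<close> or \<open>n + 1\<close>, and not at both, since passing a movable
  site raises the rank.\<close>

lemma joins_source:
  assumes p: "p \<in> paths (steps l w)" and m: "m < 2 * l"
  shows "(\<exists>s. joins w p m n s) \<longleftrightarrow> (n \<in> path_sites w p m \<longleftrightarrow> odd m)"
    and "joins w p m n s \<Longrightarrow> joins w p m n s' \<Longrightarrow> s = s'"
proof -
  have st: "is_state (p i)" for i using p by (simp add: paths_def)
  define K K' where "K = site_rank w p (odd m) m" and "K' = site_rank w p (odd m) (Suc m)"
  define M M' where "M = {n. n \<in> path_sites w p m \<longleftrightarrow> odd m}" and "M' = {n. n \<in> path_sites w p (Suc m) \<longleftrightarrow> odd m}"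
  have J: "joins w p m n s \<longleftrightarrow> n \<in> M \<and> n + of_bool s \<in> M' \<and> K n = K' (n + of_bool s)" for s
    by (simp add: joins_def K_def K'_def M_def M'_def)
  have step: "K (x + 1) = K x + of_bool (x \<in> M)" "K' (x + 1) = K' x + of_bool (x \<in> M')" for x
    by (simp_all add: K_def K'_def M_def M'_def rank_step[OF st])
  have hop: "K' x \<le> K x" "K x \<le> K' (x + 1)" for x
    using rank_hop[OF p m, of x] rank_hop[OF p m, of "x + 1"] by (simp_all add: K_def K'_def)
  have "joins w p m n False \<or> joins w p m n True" if "n \<in> M"
    using that step[of n] step(2)[of "n + 1"] hop[of n] hop[of "n + 1"] unfolding J
    by (auto simp: of_bool_def split: if_splits)
  then show "(\<exists>s. joins w p m n s) \<longleftrightarrow> (n \<in> path_sites w p m \<longleftrightarrow> odd m)" unfolding J M_def by blast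
  have "\<not> (joins w p m n False \<and> joins w p m n True)" using step(2)[of n] by (auto simp: J)
  then show "joins w p m n s \<Longrightarrow> joins w p m n s' \<Longrightarrow> s = s'" by (cases s; cases s') auto
qed

lemma joins_target:
  assumes p: "p \<in> paths (steps l w)" and m: "m < 2 * l"
  shows "(\<exists>s. joins w p m (n - of_bool s) s) \<longleftrightarrow> (n \<in> path_sites w p (Suc m) \<longleftrightarrow> odd m)"
    and "joins w p m (n - of_bool s) s \<Longrightarrow> joins w p m (n - of_bool s') s' \<Longrightarrow> s = s'"
proof -
  have st: "is_state (p i)" for i using p by (simp add: paths_def)
  define K K' where "K = site_rank w p (odd m) m" and "K' = site_rank w p (odd m) (Suc m)"
  define M M' where "M = {n. n \<in> path_sites w p m \<longleftrightarrow> odd m}" and "M' = {n. n \<in> path_sites w p (Suc m) \<longleftrightarrow> odd m}"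
  have J: "joins w p m (n - of_bool s) s \<longleftrightarrow> n - of_bool s \<in> M \<and> n \<in> M' \<and> K (n - of_bool s) = K' n" for s
    by (simp add: joins_def K_def K'_def M_def M'_def)
  have step: "K (x + 1) = K x + of_bool (x \<in> M)" "K' (x + 1) = K' x + of_bool (x \<in> M')" for x
    by (simp_all add: K_def K'_def M_def M'_def rank_step[OF st])
  have hop: "K' x \<le> K x" "K (x - 1) \<le> K' x" for x
    using rank_hop[OF p m, of x] by (simp_all add: K_def K'_def)
  have "joins w p m (n - of_bool False) False \<or> joins w p m (n - of_bool True) True" if "n \<in> M'"
    using that step[of n] step(1)[of "n - 1"] hop[of n] hop[of "n + 1"] unfolding J
    by (auto simp: of_bool_def split: if_splits)
  then have "n \<in> M' \<longleftrightarrow> (\<exists>s. joins w p m (n - of_bool s) s)" unfolding J by metis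
  then show "(\<exists>s. joins w p m (n - of_bool s) s) \<longleftrightarrow> (n \<in> path_sites w p (Suc m) \<longleftrightarrow> odd m)"
    by (simp add: M'_def)
  have "\<not> (joins w p m (n - of_bool False) False \<and> joins w p m (n - of_bool True) True)"
    unfolding J using step(1)[of "n - 1"] by auto
  then show "joins w p m (n - of_bool s) s \<Longrightarrow> joins w p m (n - of_bool s') s' \<Longrightarrow> s = s'"
    by (cases s; cases s') auto
qed

lemma comb_tiling_of:
  assumes p: "p \<in> paths (steps l w)"
  shows "comb_tiling l (tiling_of l w p)"
proof -
  let ?T = "tiling_of l w p"
  have disj: "d = d'" if dT: "d \<in> ?T" "d' \<in> ?T" and c: "c \<in> cells d" "c \<in> cells d'" for d d' c
  proof -
    obtain m n s where d: "d = dm (int m) n s" "m < 2 * l" "joins w p m n s"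
      using \<open>d \<in> ?T\<close> by (auto simp: tiling_of_def)
    obtain m' n' s' where d': "d' = dm (int m') n' s'" "m' < 2 * l" "joins w p m' n' s'"
      using \<open>d' \<in> ?T\<close> by (auto simp: tiling_of_def)
    consider "m = m'" "n = n'" | "m = Suc m'" "n = n' + of_bool s'" | "m' = Suc m" "n' = n + of_bool s"
      | "m = m'" "n + of_bool s = n' + of_bool s'"
      using c unfolding d(1) d'(1) cells_dm by auto
    then show "d = d'"
    proof cases
      case 1
      then show ?thesis using joins_source(2)[OF p d(2), of n s s'] d d' by simp
    next
      \<comment> \<open>The cell would have to be of the kind moving at step \<open>m'\<close> and
        also of the kind moving at step \<open>Suc m'\<close>, but these kinds alternate.\<close>
      case 2
      then show ?thesis using d(3) d'(3) by (auto simp: joins_def)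
    next
      case 3
      then show ?thesis using d(3) d'(3) by (auto simp: joins_def)
    next
      case 4
      then have "joins w p m (n + of_bool s - of_bool s) s" "joins w p m (n + of_bool s - of_bool s') s'"
        using d(3) d'(3) by auto
      then have "s = s'" by (rule joins_target(2)[OF p d(2)])
      then show ?thesis using 4 d d' by simp
    qed
  qed
  have cov: "covered ?T m n" if m: "1 \<le> m" "m < 2 * int l" for m n
  proof -
    obtain k where k: "m = int (Suc k)" using m(1) by (metis One_nat_def int_ops(2) nonneg_int_cases not0_implies_Suc not_one_le_zero of_nat_0 order_trans zero_le_one)
    then have k2: "Suc k < 2 * l" "k < 2 * l" using m(2) by auto
    show ?thesis
    proof (cases "n \<in> path_sites w p (Suc k) \<longleftrightarrow> odd (Suc k)")
      case True
      then obtain s where "joins w p (Suc k) n s" using joins_source(1)[OF p k2(1)] by blast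
      then show ?thesis unfolding covered_iff tiling_of_iff using k k2 by blast
    next
      case False
      then have "n \<in> path_sites w p (Suc k) \<longleftrightarrow> odd k" by simp
      then obtain s where "joins w p k (n - of_bool s) s" using joins_target(1)[OF p k2(2)] by blast
      then show ?thesis unfolding covered_iff tiling_of_iff using k k2 by force
    qed
  qed
  show ?thesis unfolding comb_tiling_def using disj cov by (auto simp: tiling_of_iff)
qed

lemma sites_tiling_of:
  assumes p: "p \<in> paths (steps l w)" and m: "m \<le> 2 * l" and l: "l > 0"
  shows "sites (tiling_of l w p) m = path_sites w p m"
proof (cases "m < 2 * l")
  case True
  have "(\<exists>s. dm (int m) n s \<in> tiling_of l w p) \<longleftrightarrow> (\<exists>s. joins w p m n s)" for n
    using True by (auto simp: tiling_of_iff)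
  then show ?thesis
    using site_source[OF comb_tiling_of[OF p] True] joins_source(1)[OF p True] by blast
next
  case False
  then obtain k where k: "m = Suc k" "k < 2 * l" using m l by (cases m) auto
  have "(\<exists>s. dm (int k) (n - of_bool s) s \<in> tiling_of l w p) \<longleftrightarrow> (\<exists>s. joins w p k (n - of_bool s) s)" for n
    using k by (auto simp: tiling_of_iff)
  then show ?thesis unfolding k(1)
    using site_target[OF comb_tiling_of[OF p] k(2)] joins_target(1)[OF p k(2)] by blast
qed

lemma path_far:
  assumes p: "p \<in> paths (steps l w)"
  obtains N where "N \<ge> 0" "\<And>m x. m \<le> 2 * l \<Longrightarrow> N \<le> \<bar>x\<bar> \<Longrightarrow> p m (x - front w m) = vac (x - front w m)"
    "\<And>m. m \<le> 2 * l \<Longrightarrow> \<bar>front w m\<bar> \<le> N"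
proof -
  have "\<exists>N. \<forall>x. N \<le> \<bar>x\<bar> \<longrightarrow> p m x = vac x" for m
    using p unfolding paths_def is_state_def by blast
  then obtain f where f: "\<And>m x. f m \<le> \<bar>x\<bar> \<Longrightarrow> p m x = vac x" by metis
  define N where "N = (\<Sum>m\<le>2 * l. \<bar>f m\<bar> + \<bar>front w m\<bar>)"
  have N: "\<bar>f m\<bar> + \<bar>front w m\<bar> \<le> N" if "m \<le> 2 * l" for m
    unfolding N_def by (rule member_le_sum[of m _ "\<lambda>m. \<bar>f m\<bar> + \<bar>front w m\<bar>"]) (use that in auto)
  show ?thesis
  proof (rule that[of N])
    show "N \<ge> 0" unfolding N_def by (rule sum_nonneg) simp
    show "\<bar>front w m\<bar> \<le> N" if "m \<le> 2 * l" for m using N[OF that] by simp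
    show "p m (x - front w m) = vac (x - front w m)" if "m \<le> 2 * l" "N \<le> \<bar>x\<bar>" for m x
      using N[OF that(1)] that(2) by (intro f) linarith
  qed
qed

lemma tiling_of_norm:
  assumes p: "p \<in> paths (steps l w)" and l: "l > 0"
  shows "tiling_of l w p \<in> norm_tilings l w"
proof -
  let ?T = "tiling_of l w p"
  obtain N where N: "N \<ge> 0" "\<And>m x. m \<le> 2 * l \<Longrightarrow> N \<le> \<bar>x\<bar> \<Longrightarrow> p m (x - front w m) = vac (x - front w m)"
    "\<And>m. m \<le> 2 * l \<Longrightarrow> \<bar>front w m\<bar> \<le> N"
    using path_far[OF p] by blast
  have far: "n \<notin> path_sites w p m" "site_rank w p True m n = 0" if "m \<le> 2 * l" "N < n" for m n
    using N(2)[OF that(1), of n] N(2)[OF that(1), of "n + 1"] N(3)[OF that(1)] that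
    by (auto simp: path_sites_def site_rank_def vac_def)
  have near: "n \<in> path_sites w p m" "site_rank w p False m n = 0" if "m \<le> 2 * l" "n < - N - 1" for m n
    using N(2)[OF that(1), of n] N(2)[OF that(1), of "n + 1"] N(3)[OF that(1)] that
    by (auto simp: path_sites_def site_rank_def vac_def)
  have rank_rel: "site_rank w p False m n = n - front w m - site_rank w p True m n" for m n
    by (simp add: site_rank_def)
  have steep: "comb_steep ?T" unfolding comb_steep_def
  proof (intro exI[of _ "N + 1"] allI impI)
    fix m n s assume "dm m n s \<in> ?T"
    then obtain k where k: "m = int k" "k < 2 * l" "joins w p k n s" by (auto simp: tiling_of_iff)
    then show "(N + 1 < n \<longrightarrow> even m) \<and> (n < - (N + 1) \<longrightarrow> odd m)"
      using far(1)[of k n] near(1)[of k n] by (auto simp: joins_def)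
  qed
  have asym: "comb_asym l ?T w" unfolding comb_asym_def
  \<comment> \<open>The margin 3 keeps the site after the hop below \<open>- N - 1\<close> as
    well.\<close>
  proof (intro exI[of _ "N + 3"] allI impI)
    fix m n assume m: "m < 2 * l" and n: "if even m then N + 3 \<le> n else n \<le> - (N + 3)"
    let ?b = "of_bool (shift_at w m) :: int"
    have b: "0 \<le> ?b" "?b \<le> 1" "front w (Suc m) = front w m + ?b" by (auto simp: front_Suc simp del: front.simps)
    have "joins w p m n (shift_at w m)"
    proof (cases "even m")
      case True
      then show ?thesis
        using n m b far[of m n] far[of "Suc m" "n + ?b"] N(1) unfolding joins_def
        by (simp add: rank_rel del: front.simps)
    next
      case False
      have n': "n < - N - 1" "n + ?b < - N - 1" using n b False by (simp_all del: front.simps)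
      have "site_rank w p False m n = 0" "site_rank w p False (Suc m) (n + ?b) = 0"
        using near(2)[of m n] near(2)[of "Suc m" "n + ?b"] m n' by auto
      then have "site_rank w p True m n = site_rank w p True (Suc m) (n + ?b)"
        using rank_rel[of m n] rank_rel[of "Suc m" "n + ?b"] b(3) by linarith
      then show ?thesis
        using False m n' near(1)[of m n] near(1)[of "Suc m" "n + ?b"] unfolding joins_def by simp
    qed
    then show "dm (int m) n (shift_at w m) \<in> ?T" using m by (auto simp: tiling_of_iff)
  qed
  have vac_sites: "n \<in> path_sites w p m \<longleftrightarrow> n < front w m" if "p m = vac" for m n
    using that by (auto simp: path_sites_def vac_def)
  have ends: "p 0 = vac" "p (2 * l) = vac" using p by (auto simp: paths_def)
  have left: "covered ?T 0 n \<longleftrightarrow> 0 \<le> n" for n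
  proof -
    have "covered ?T 0 n \<longleftrightarrow> (\<exists>s. joins w p 0 n s)" unfolding covered_iff tiling_of_iff using l by auto
    then show ?thesis using joins_source(1)[OF p, of 0 n] l vac_sites[OF ends(1), of n] by auto
  qed
  have right: "covered ?T (2 * int l) n \<longleftrightarrow> n \<le> front w (2 * l) - 1" for n
  proof -
    have e: "2 * int l - 1 = int (2 * l - 1)" "Suc (2 * l - 1) = 2 * l" "2 * l - 1 < 2 * l" "odd (2 * l - 1)"
      using l by auto
    have "dm (2 * int l) n s \<notin> ?T" for s using tiling_range(2)[OF comb_tiling_of[OF p], of "2 * int l"] by blast
    then have "covered ?T (2 * int l) n \<longleftrightarrow> (\<exists>s. dm (int (2 * l - 1)) (n - of_bool s) s \<in> ?T)"
      unfolding covered_iff e(1) by blast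
    also have "\<dots> \<longleftrightarrow> (\<exists>s. joins w p (2 * l - 1) (n - of_bool s) s)"
      unfolding tiling_of_iff using e(3) by (simp only: of_nat_eq_iff) blast
    also have "\<dots> \<longleftrightarrow> n < front w (2 * l)"
      using joins_target(1)[OF p e(3), of n] vac_sites[OF ends(2), of n] e by simp
    finally show ?thesis by auto
  qed
  show ?thesis unfolding norm_tilings_def using comb_tiling_of[OF p] steep asym left right by blast
qed

lemma profile_tiling_of:
  assumes p: "p \<in> paths (steps l w)" and l: "l > 0"
  shows "profile l w (tiling_of l w p) = p"
proof
  fix m
  have st: "is_state (p m)" using p by (simp add: paths_def)
  show "profile l w (tiling_of l w p) m = p m"
  proof (cases "m \<le> 2 * l")
    case True
    have "occ_above (path_sites w p m) (x + front w m) = p m x" for x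
    proof -
      have "{a \<in> path_sites w p m. x + front w m \<le> a} =
          (\<lambda>a. a + front w m) ` {a. p m (a + 1) < p m a \<and> x \<le> a}"
      proof (intro equalityI subsetI)
        fix a assume "a \<in> {a \<in> path_sites w p m. x + front w m \<le> a}"
        then show "a \<in> (\<lambda>a. a + front w m) ` {a. p m (a + 1) < p m a \<and> x \<le> a}"
          by (intro image_eqI[of _ _ "a - front w m"]) (auto simp: path_sites_def algebra_simps)
      qed (auto simp: path_sites_def algebra_simps)
      moreover have "inj_on (\<lambda>a. a + front w m) A" for A by (auto simp: inj_on_def)
      ultimately show ?thesis using card_descents[OF st, of x] by (simp add: occ_above_def card_image)
    qed
    then show ?thesis using True sites_tiling_of[OF p True l] by (simp add: profile_def)
  next
    case False
    then show ?thesis using p by (simp add: profile_def paths_def)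
  qed
qed

text \<open>Every domino of \<open>T\<close> joins sites of equal rank. Conversely, a join starts at
  a movable site, where \<open>T\<close> has a domino; that domino is a join too, and joins are
  determined by their source.\<close>

lemma tiling_of_profile:
  assumes T: "T \<in> norm_tilings l w" and l: "l > 0"
  shows "tiling_of l w (profile l w T) = T"
proof -
  let ?p = "profile l w T"
  have c: "comb_tiling l T" using T by (simp add: norm_tilings_def)
  have p: "?p \<in> paths (steps l w)" by (rule profile_in_paths[OF T])
  have S: "path_sites w ?p m = sites T m" if "m \<le> 2 * l" for m
  proof (rule set_eqI)
    fix n
    show "n \<in> path_sites w ?p m \<longleftrightarrow> n \<in> sites T m"
      using above_step[OF maya_sites[OF T that], of n] that
      by (cases "n \<in> sites T m") (simp_all add: path_sites_def profile_def)
  qed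
  have r: "site_rank w ?p b m n = movable_before b (sites T m) n" if "m \<le> 2 * l" for b m n
    using that charge_eq[OF maya_sites[OF T that], of n] charge_sites[OF T that]
    by (auto simp: site_rank_def movable_before_def profile_def)
  have J: "joins w ?p m n s" if "dm (int m) n s \<in> T" "m < 2 * l" for m n s
  proof -
    have "n \<in> sites T m \<longleftrightarrow> odd m" using site_source[OF c that(2)] that(1) by blast
    moreover have "\<exists>s'. dm (int m) (n + of_bool s - of_bool s') s' \<in> T"
      using that(1) by (intro exI[of _ s]) simp
    then have "n + of_bool s \<in> sites T (Suc m) \<longleftrightarrow> odd m" using site_target[OF c that(2)] by blast
    ultimately show ?thesis
      using sites_hop(3)[OF T that(2) that(1)] that(2) unfolding joins_def by (simp add: S r)
  qed
  show ?thesis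
  proof (intro equalityI subsetI)
    fix d assume d: "d \<in> T"
    obtain m n s where e: "d = dm m n s" by (rule dm_cases)
    have "0 \<le> m" "m < 2 * int l" using tiling_range[OF c] d e by auto
    then obtain k where "m = int k" "k < 2 * l" by (metis nonneg_int_cases of_nat_less_iff of_nat_mult of_nat_numeral)
    then show "d \<in> tiling_of l w ?p" using J d e by (auto simp: tiling_of_iff)
  next
    fix d assume "d \<in> tiling_of l w ?p"
    then obtain m n s where d: "d = dm (int m) n s" "m < 2 * l" "joins w ?p m n s"
      by (auto simp: tiling_of_def)
    then have "n \<in> sites T m \<longleftrightarrow> odd m" using S[of m] by (simp add: joins_def)
    then obtain s' where s': "dm (int m) n s' \<in> T" using site_source[OF c d(2)] by blast
    then have "s = s'" using joins_source(2)[OF p d(2) d(3)] J[OF s' d(2)] by simp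
    then show "d \<in> T" using s' d(1) by simp
  qed
qed

section \<open>Flips\<close>

text \<open>\<open>hs m n\<close> and \<open>vs m n\<close> tile the same 2 by 2 square, centered on
  the diagonal \<open>m + 1\<close>, with cells \<open>(m, n)\<close>, \<open>(m + 1, n)\<close>,
  \<open>(m + 1, n + 1)\<close> and \<open>(m + 2, n + 1)\<close>.\<close>

definition hs :: "int \<Rightarrow> int \<Rightarrow> domino set" where "hs m n = {dm m n True, dm (m + 1) n True}"

definition vs :: "int \<Rightarrow> int \<Rightarrow> domino set" where "vs m n = {dm m n False, dm (m + 1) (n + 1) False}"

lemma flip_iff:
  "flip T T' \<longleftrightarrow> (\<exists>m n. hs m n \<subseteq> T \<and> T' = (T - hs m n) \<union> vs m n \<or> vs m n \<subseteq> T \<and> T' = (T - vs m n) \<union> hs m n)"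
proof -
  have e: "{Horizontal x y, Horizontal x (y - 1)} = hs (x - y + 1) x"
    "{Vertical x y, Vertical (x + 1) y} = vs (x - y + 1) x" for x y
    by (simp_all add: hs_def vs_def dm_def)
  have sh: "(\<exists>x y. P (x - y + 1) x) \<longleftrightarrow> (\<exists>m n. P m n)" for P :: "int \<Rightarrow> int \<Rightarrow> bool"
  proof
    assume "\<exists>m n. P m n"
    then obtain m n where "P m n" by blast
    then have "P (n - (n - m + 1) + 1) n" by simp
    then show "\<exists>x y. P (x - y + 1) x" by blast
  qed blast
  show ?thesis unfolding flip_def Let_def e by (rule sh)
qed

lemma cells_hs_vs: "\<Union> (cells ` hs m n) = \<Union> (cells ` vs m n)"
  by (auto simp: hs_def vs_def cells_dm)

lemma hs_vs_disjoint: "hs m n \<inter> vs m n = {}"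
  by (simp add: hs_def vs_def)

lemma tiling_disjoint:
  assumes "comb_tiling l T" "d \<in> T" "d' \<in> T" "c \<in> cells d" "c \<in> cells d'"
  shows "d = d'"
  using assms unfolding comb_tiling_def by blast

lemma occ_covered:
  assumes "comb_tiling l T" "dm k x s \<in> T" "(m, n) \<in> cells (dm k x s)"
  shows "occ T m n \<longleftrightarrow> odd k"
proof -
  have "covered T m n" using assms(2,3) unfolding covered_def by blast
  moreover have "k' = k" if "dm k' x' s' \<in> T" "(m, n) \<in> cells (dm k' x' s')" for k' x' s'
    using tiling_unique[OF assms(1) assms(2) that(1) assms(3) that(2)] by simp
  ultimately show ?thesis unfolding occ_def using assms(2,3) by blast
qed

lemma occ_uncovered_change:
  assumes "\<And>d. (m, n) \<in> cells d \<Longrightarrow> d \<in> T \<longleftrightarrow> d \<in> T'"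
  shows "occ T m n \<longleftrightarrow> occ T' m n"
  using assms unfolding occ_def covered_def by blast

section \<open>Effect of a flip on particles and weight\<close>

locale flip_move =
  fixes l :: nat and w :: "sign list" and T :: "domino set" and m n :: int and X Y :: "domino set"
  assumes T: "T \<in> norm_tilings l w" and XT: "X \<subseteq> T"
    and XY: "X = hs m n \<and> Y = vs m n \<or> X = vs m n \<and> Y = hs m n"
begin

definition T' :: "domino set" where "T' = (T - X) \<union> Y"

lemma T_comb: "comb_tiling l T"
  using T by (simp add: norm_tilings_def)

lemma cells_XY: "\<Union> (cells ` X) = \<Union> (cells ` Y)"
  using XY cells_hs_vs[of m n] by (elim disjE conjE) simp_all

lemma covered_T': "covered T' a b \<longleftrightarrow> covered T a b"
proof
  assume "covered T' a b"
  then obtain d where "d \<in> T'" "(a, b) \<in> cells d" by (auto simp: covered_def)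
  then show "covered T a b" using cells_XY XT unfolding covered_def T'_def by blast
next
  assume "covered T a b"
  then obtain d where "d \<in> T" "(a, b) \<in> cells d" by (auto simp: covered_def)
  then show "covered T' a b" using cells_XY unfolding covered_def T'_def by blast
qed

lemma range: "0 \<le> m" "m + 1 < 2 * int l"
proof -
  have "\<exists>s x. dm m n s \<in> T \<and> dm (m + 1) x s \<in> T" using XT XY by (auto simp: hs_def vs_def)
  then show "0 \<le> m" "m + 1 < 2 * int l" using tiling_range[OF T_comb] by blast+
qed

lemma comb_T': "comb_tiling l T'"
proof -
  have disj: "cells d \<inter> cells d' = {}" if "d \<in> T'" "d' \<in> T'" "d \<noteq> d'" for d d'
  proof -
    have TT: "cells d \<inter> cells d' = {}" if "d \<in> T" "d' \<in> T" "d \<noteq> d'" for d d'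
      using T_comb that unfolding comb_tiling_def by blast
    have YT: "cells d \<inter> cells d' = {}" if "d \<in> Y" "d' \<in> T - X" for d d'
    proof -
      have "cells d \<subseteq> \<Union> (cells ` X)" using that(1) cells_XY by blast
      moreover have "cells e \<inter> cells d' = {}" if "e \<in> X" for e
        using TT[of e d'] that \<open>d' \<in> T - X\<close> XT by blast
      ultimately show ?thesis by blast
    qed
    have YY: "cells d \<inter> cells d' = {}" if "d \<in> Y" "d' \<in> Y" "d \<noteq> d'" for d d'
      using that XY by (auto simp: hs_def vs_def cells_dm)
    show ?thesis
      using that TT[of d d'] YT[of d d'] YT[of d' d] YY[of d d'] unfolding T'_def by blast
  qed
  have rng: "0 \<le> a \<and> a < 2 * int l" if "dm a b s \<in> T'" for a b s
  proof (cases "dm a b s \<in> Y")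
    case True
    then have "a = m \<or> a = m + 1" using XY by (auto simp: hs_def vs_def)
    then show ?thesis using range by auto
  next
    case False
    then show ?thesis using that tiling_range[OF T_comb, of a b s] by (auto simp: T'_def)
  qed
  have cov: "covered T' a b" if "1 \<le> a \<and> a < 2 * int l" for a b
    using that T_comb unfolding covered_T' comb_tiling_def by blast
  show ?thesis unfolding comb_tiling_def using disj rng cov by blast
qed

lemma norm_T': "T' \<in> norm_tilings l w"
proof -
  have steep: "comb_steep T'"
  proof -
    obtain B where B: "\<And>a b s. dm a b s \<in> T \<Longrightarrow> (B < b \<longrightarrow> even a) \<and> (b < - B \<longrightarrow> odd a)"
      using T unfolding norm_tilings_def comb_steep_def by blast
    have "(\<bar>B\<bar> + \<bar>n\<bar> + 1 < b \<longrightarrow> even a) \<and> (b < - (\<bar>B\<bar> + \<bar>n\<bar> + 1) \<longrightarrow> odd a)" if "dm a b s \<in> T'" for a b s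
    proof (cases "dm a b s \<in> Y")
      case True
      then have "b = n \<or> b = n + 1" using XY by (auto simp: hs_def vs_def)
      then show ?thesis by auto
    next
      case False
      then show ?thesis using that B[of a b s] by (auto simp: T'_def)
    qed
    then show ?thesis unfolding comb_steep_def by blast
  qed
  have asym: "comb_asym l T' w"
  proof -
    obtain N where N: "\<And>a b. a < 2 * l \<Longrightarrow> if even a then N \<le> b else b \<le> - N \<Longrightarrow> dm (int a) b (shift_at w a) \<in> T"
      using T unfolding norm_tilings_def comb_asym_def by blast
    have "dm (int a) b (shift_at w a) \<in> T'"
      if a: "a < 2 * l" "if even a then \<bar>N\<bar> + \<bar>n\<bar> + 2 \<le> b else b \<le> - (\<bar>N\<bar> + \<bar>n\<bar> + 2)" for a b
    proof -
      have "dm (int a) b (shift_at w a) \<in> T" using N[OF a(1), of b] a(2) by (auto split: if_splits)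
      moreover have "b \<noteq> n" "b \<noteq> n + 1" using a(2) by (auto split: if_splits)
      then have "dm (int a) b (shift_at w a) \<notin> X" using XY by (auto simp: hs_def vs_def)
      ultimately show ?thesis by (simp add: T'_def)
    qed
    then show ?thesis unfolding comb_asym_def by blast
  qed
  show ?thesis
    using T comb_T' steep asym unfolding norm_tilings_def mem_Collect_eq covered_T' by simp
qed

lemma Y_T': "Y \<subseteq> T'"
  by (simp add: T'_def)

text \<open>The extreme cells \<open>(m, n)\<close> and \<open>(m + 2, n + 1)\<close> are covered
  before and after the flip by dominos with first diagonal \<open>m\<close> and
  \<open>m + 1\<close>, respectively, so their occupation cannot change.\<close>

lemma occ_T':
  assumes "(a, b) \<noteq> (m + 1, n)" "(a, b) \<noteq> (m + 1, n + 1)"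
  shows "occ T' a b \<longleftrightarrow> occ T a b"
proof (cases "(a, b) \<in> \<Union> (cells ` X)")
  case True
  have X: "\<exists>s. dm m n s \<in> T" "\<exists>x s. dm (m + 1) x s \<in> T \<and> x + of_bool s = n + 1"
    and Y: "\<exists>s. dm m n s \<in> T'" "\<exists>x s. dm (m + 1) x s \<in> T' \<and> x + of_bool s = n + 1"
    using XT Y_T' XY by (auto simp: hs_def vs_def)
  from True assms consider "(a, b) = (m, n)" | "(a, b) = (m + 2, n + 1)"
    using XY by (auto simp: hs_def vs_def cells_dm)
  then show ?thesis
  proof cases
    case 1
    then show ?thesis
      using X(1) Y(1) occ_covered[OF T_comb, of m n _ a b] occ_covered[OF comb_T', of m n _ a b]
      by (auto simp: cells_dm)
  next
    case 2
    obtain x s where xs: "dm (m + 1) x s \<in> T" "x + of_bool s = n + 1" using X(2) by blast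
    obtain x' s' where xs': "dm (m + 1) x' s' \<in> T'" "x' + of_bool s' = n + 1" using Y(2) by blast
    have "occ T a b \<longleftrightarrow> odd (m + 1)" by (rule occ_covered[OF T_comb xs(1)]) (use 2 xs(2) in \<open>simp add: cells_dm\<close>)
    moreover have "occ T' a b \<longleftrightarrow> odd (m + 1)" by (rule occ_covered[OF comb_T' xs'(1)]) (use 2 xs'(2) in \<open>simp add: cells_dm\<close>)
    ultimately show ?thesis by simp
  qed
next
  case False
  then have F': "(a, b) \<notin> \<Union> (cells ` Y)" unfolding cells_XY .
  have "d \<in> T' \<longleftrightarrow> d \<in> T" if "(a, b) \<in> cells d" for d
    using that False F' unfolding T'_def by blast
  then show ?thesis by (rule occ_uncovered_change)
qed

text \<open>The two central cells lie in dominos with first diagonals \<open>m\<close> and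
  \<open>m + 1\<close>. Hence exactly one of them is occupied, and the flip moves this particle to
  the other.\<close>

lemma occ_center:
  "occ T (m + 1) n \<longleftrightarrow> (X = hs m n) = even m" "occ T (m + 1) (n + 1) \<longleftrightarrow> (X = hs m n) = odd m"
  "occ T' (m + 1) n \<longleftrightarrow> (X = hs m n) = odd m" "occ T' (m + 1) (n + 1) \<longleftrightarrow> (X = hs m n) = even m"
proof -
  have h: "occ S (m + 1) n \<longleftrightarrow> odd (m + 1)" "occ S (m + 1) (n + 1) \<longleftrightarrow> odd m"
    if "comb_tiling l S" "hs m n \<subseteq> S" for S
    using occ_covered[OF that(1), of "m + 1" n True "m + 1" n] occ_covered[OF that(1), of m n True "m + 1" "n + 1"] that(2)
    by (auto simp: hs_def cells_dm)
  have v: "occ S (m + 1) n \<longleftrightarrow> odd m" "occ S (m + 1) (n + 1) \<longleftrightarrow> odd (m + 1)"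
    if "comb_tiling l S" "vs m n \<subseteq> S" for S
    using occ_covered[OF that(1), of m n False "m + 1" n] occ_covered[OF that(1), of "m + 1" "n + 1" False "m + 1" "n + 1"] that(2)
    by (auto simp: vs_def cells_dm)
  have "dm m n True \<in> hs m n" "dm m n True \<notin> vs m n" by (simp_all add: hs_def vs_def)
  then have ne: "hs m n \<noteq> vs m n" by metis
  have "occ T (m + 1) n \<longleftrightarrow> (X = hs m n) = even m \<and> True" "occ T (m + 1) (n + 1) \<longleftrightarrow> (X = hs m n) = odd m"
    "occ T' (m + 1) n \<longleftrightarrow> (X = hs m n) = odd m" "occ T' (m + 1) (n + 1) \<longleftrightarrow> (X = hs m n) = even m"
    using XY h[OF T_comb] v[OF T_comb] h[OF comb_T'] v[OF comb_T'] XT Y_T' ne by auto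
  then show "occ T (m + 1) n \<longleftrightarrow> (X = hs m n) = even m" "occ T (m + 1) (n + 1) \<longleftrightarrow> (X = hs m n) = odd m"
    "occ T' (m + 1) n \<longleftrightarrow> (X = hs m n) = odd m" "occ T' (m + 1) (n + 1) \<longleftrightarrow> (X = hs m n) = even m" by simp_all
qed

end

lemma occ_above_move:
  assumes S: "maya S" and n: "n \<in> S" "n + 1 \<notin> S"
  shows "occ_above (insert (n + 1) (S - {n})) z = occ_above S z + of_bool (z = n + 1)"
proof -
  have fin: "finite {a \<in> S. z \<le> a}" by (rule maya_finite[OF S])
  consider "z \<le> n" | "z = n + 1" | "n + 1 < z" by linarith
  then show ?thesis
  proof cases
    case 1
    then have "{a \<in> insert (n + 1) (S - {n}). z \<le> a} = insert (n + 1) ({a \<in> S. z \<le> a} - {n})" by auto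
    moreover have "card (insert (n + 1) ({a \<in> S. z \<le> a} - {n})) = card {a \<in> S. z \<le> a}"
      using fin n 1 card.remove[of "{a \<in> S. z \<le> a}" n] by simp
    ultimately show ?thesis using 1 by (simp add: occ_above_def)
  next
    case 2
    then have "{a \<in> insert (n + 1) (S - {n}). z \<le> a} = insert (n + 1) {a \<in> S. z \<le> a}" by auto
    then show ?thesis using fin n 2 by (simp add: occ_above_def)
  next
    case 3
    then have "{a \<in> insert (n + 1) (S - {n}). z \<le> a} = {a \<in> S. z \<le> a}" by auto
    then show ?thesis using 3 by (simp add: occ_above_def)
  qed
qed

lemma boxes_update:
  assumes "is_state h"
  shows "boxes (\<lambda>y. h y + c * of_bool (y = x)) = boxes h + c"
proof -
  obtain N where N: "N \<ge> 0" "\<And>n. N \<le> \<bar>n\<bar> \<Longrightarrow> h n = vac n"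
    using state_bound[OF assms] by blast
  have "boxes (\<lambda>y. h y + c * of_bool (y \<in> {x})) = boxes h + c * int (card {x})"
    by (rule boxes_add_indicator[of "N + \<bar>x\<bar> + 1"]) (use N in auto)
  then show ?thesis by simp
qed

text \<open>The moving particle crosses a single cut, the one between \<open>n\<close> and
  \<open>n + 1\<close>, so only the count from \<open>n + 1\<close> on changes.\<close>

lemma (in flip_move) profile_T':
  defines "k \<equiv> nat m" and "c \<equiv> (if (X = hs m n) = even m then 1 else - 1 :: int)"
  shows "profile l w T' = (profile l w T)
    (Suc k := \<lambda>y. profile l w T (Suc k) y + c * of_bool (y = n + 1 - front w (Suc k)))"
proof
  fix j
  have m: "m = int k" using range by (simp add: k_def)
  have kl: "Suc k \<le> 2 * l" using range m by simp
  show "profile l w T' j = ((profile l w T)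
    (Suc k := \<lambda>y. profile l w T (Suc k) y + c * of_bool (y = n + 1 - front w (Suc k)))) j"
  proof (cases "j = Suc k")
    case False
    then have "sites T' j = sites T j" unfolding sites_def using occ_T'[of "int j"] m by auto
    then show ?thesis using False by (simp add: profile_def)
  next
    case True
    let ?S = "sites T (Suc k)" and ?S' = "sites T' (Suc k)"
    have iS: "n \<in> ?S \<longleftrightarrow> c = 1" "n + 1 \<in> ?S \<longleftrightarrow> c \<noteq> 1" "n \<in> ?S' \<longleftrightarrow> c \<noteq> 1" "n + 1 \<in> ?S' \<longleftrightarrow> c = 1"
      using occ_center m by (auto simp: sites_def c_def add.commute)
    have oth: "a \<in> ?S' \<longleftrightarrow> a \<in> ?S" if "a \<noteq> n" "a \<noteq> n + 1" for a
      using occ_T'[of "m + 1" a] that m by (simp add: sites_def add.commute)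
    have ab: "occ_above ?S' z = occ_above ?S z + c * of_bool (z = n + 1)" for z
    proof (cases "c = 1")
      case True
      have "?S' = insert (n + 1) (?S - {n})"
      proof (rule set_eqI)
        fix a show "a \<in> ?S' \<longleftrightarrow> a \<in> insert (n + 1) (?S - {n})"
          using iS oth[of a] True by (cases "a = n"; cases "a = n + 1") simp_all
      qed
      then show ?thesis using occ_above_move[OF maya_sites[OF T kl], of n z] iS True by simp
    next
      case False
      have "?S = insert (n + 1) (?S' - {n})"
      proof (rule set_eqI)
        fix a show "a \<in> ?S \<longleftrightarrow> a \<in> insert (n + 1) (?S' - {n})"
          using iS oth[of a] False by (cases "a = n"; cases "a = n + 1") simp_all
      qed
      then have "occ_above ?S z = occ_above ?S' z + of_bool (z = n + 1)"
        using occ_above_move[OF maya_sites[OF norm_T' kl], of n z] iS False by simp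
      then show ?thesis using False by (simp add: c_def split: if_splits)
    qed
    show ?thesis using True kl unfolding profile_def by (auto simp: ab fun_eq_iff algebra_simps simp del: front.simps)
  qed
qed

definition weight :: "nat \<Rightarrow> sign list \<Rightarrow> domino set \<Rightarrow> int" where
  "weight l w T = wt (steps l w) (profile l w T)"

lemma wt_steps:
  assumes p: "p \<in> paths (steps l w)"
  shows "wt (steps l w) p = (\<Sum>i<2 * l. boxes (p i))"
proof -
  have "(\<Sum>i<L. (int i + 1) * (boxes (p i) - boxes (p (Suc i)))) = (\<Sum>i<L. boxes (p i)) - int L * boxes (p L)" for L
    by (induction L) (simp_all add: algebra_simps)
  moreover have "boxes (p (2 * l)) = 0" using p by (simp add: paths_def)
  ultimately show ?thesis by (simp add: wt_def label_def)
qed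

lemma (in flip_move) weight_T':
  "weight l w T' = weight l w T + (if (X = hs m n) = even m then 1 else - 1)"
proof -
  define k where "k = nat m"
  let ?c = "if (X = hs m n) = even m then 1 else - 1 :: int"
  let ?p = "profile l w T"
  have k: "Suc k < 2 * l" using range by (simp add: k_def)
  have st: "is_state (?p i)" for i using profile_in_paths[OF T] by (simp add: paths_def)
  have p': "profile l w T' = ?p(Suc k := \<lambda>y. ?p (Suc k) y + ?c * of_bool (y = n + 1 - front w (Suc k)))"
    unfolding k_def by (rule profile_T')
  have b: "boxes (profile l w T' i) = boxes (?p i) + (if i = Suc k then ?c else 0)" for i
    unfolding p' using boxes_update[OF st[of "Suc k"], of ?c] by simp
  have "(\<Sum>i<2 * l. boxes (profile l w T' i)) = (\<Sum>i<2 * l. boxes (?p i)) + (\<Sum>i<2 * l. if i = Suc k then ?c else 0)"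
    by (simp only: b sum.distrib)
  also have "(\<Sum>i<2 * l. if i = Suc k then ?c else 0) = ?c" using k by (simp add: sum.delta)
  finally show ?thesis
    unfolding weight_def wt_steps[OF profile_in_paths[OF T]] wt_steps[OF profile_in_paths[OF norm_T']] .
qed

lemma weight_nonneg:
  assumes "T \<in> norm_tilings l w" shows "0 \<le> weight l w T"
proof -
  note p = profile_in_paths[OF assms]
  show ?thesis unfolding weight_def wt_steps[OF p]
    by (rule sum_nonneg) (use p boxes_nonneg in \<open>auto simp: paths_def\<close>)
qed

lemma flip_norm:
  assumes "T \<in> norm_tilings l w" "flip T S"
  shows "S \<in> norm_tilings l w" "weight l w S \<le> weight l w T + 1" "flip S T"
proof -
  obtain m n X Y where X: "X \<subseteq> T" and XY: "X = hs m n \<and> Y = vs m n \<or> X = vs m n \<and> Y = hs m n"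
    and S: "S = (T - X) \<union> Y"
    using assms(2) unfolding flip_iff by blast
  interpret flip_move l w T m n X Y by unfold_locales (use assms(1) X XY in auto)
  have S: "S = T'" by (simp add: S T'_def)
  show "S \<in> norm_tilings l w" unfolding S by (rule norm_T')
  show "weight l w S \<le> weight l w T + 1" unfolding S weight_T' by simp
  \<comment> \<open>The cells of \<open>Y\<close> are occupied in \<open>T\<close> by the dominos of
    \<open>X\<close>; so removing \<open>Y\<close> again restores exactly \<open>T\<close>.\<close>
  have "Y \<inter> T = {}"
  proof -
    have False if d: "d \<in> Y" "d \<in> T" for d
    proof -
      have "d \<notin> X" using d XY hs_vs_disjoint by blast
      moreover obtain c where c: "c \<in> cells d" by (cases d) auto
      then obtain e where "e \<in> X" "c \<in> cells e" using cells_XY d(1) by blast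
      ultimately show False using tiling_disjoint[OF T_comb d(2) _ c] X by blast
    qed
    then show ?thesis by blast
  qed
  then have "T = (S - Y) \<union> X" using X unfolding S T'_def by blast
  moreover have "Y \<subseteq> S" unfolding S by (rule Y_T')
  ultimately show "flip S T" using XY unfolding flip_iff by blast
qed

lemma flips_norm:
  assumes "T \<in> norm_tilings l w" "(flip ^^ k) T S"
  shows "S \<in> norm_tilings l w \<and> weight l w S \<le> weight l w T + int k"
  using assms(2)
proof (induction k arbitrary: S)
  case (Suc k)
  then obtain R where R: "(flip ^^ k) T R" "flip R S" by auto
  then show ?case using Suc.IH[OF R(1)] flip_norm[OF _ R(2)] by fastforce
qed (use assms(1) in auto)

section \<open>Descent to the minimal tiling\<close>

definition lower :: "(int \<Rightarrow> int) \<Rightarrow> int \<Rightarrow> int \<Rightarrow> int" where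
  "lower h x = (\<lambda>y. h y - of_bool (y = x))"

lemma up_lower_upper:
  assumes "up t a b" "a x \<noteq> b x" shows "up t a (lower b x)"
proof -
  have "a y \<le> lower b x y \<and> lower b x y \<le> b y" for y
    using up_le[OF assms(1), of y] assms(2) by (auto simp: lower_def)
  then show ?thesis using assms(1) order_trans by (fastforce simp: up_def hstep_def vstep_def)
qed

text \<open>Lowering the smaller state at \<open>x\<close> endangers only the upper bound on
  \<open>b\<close> that involves \<open>a x\<close>; the second hypothesis says that this bound is
  not tight.\<close>

lemma up_lower_lower:
  assumes "up t a b" "if t then b (x - 1) \<le> a x else b (x + 1) < a x" shows "up t (lower a x) b"
proof (cases t)
  case True
  have ab: "a y \<le> b y" "b y \<le> a (y + 1) + 1" for y
    using assms(1) True by (auto simp: up_def hstep_def)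
  have "lower a x y \<le> b y \<and> b y \<le> lower a x (y + 1) + 1" for y
    using assms(2) True ab[of y] by (cases "y + 1 = x"; cases "y = x") (auto simp: lower_def)
  then show ?thesis using True by (simp add: up_def hstep_def)
next
  case False
  have ab: "a y \<le> b y" "b y \<le> a (y - 1)" for y
    using assms(1) False by (auto simp: up_def vstep_def)
  have "lower a x y \<le> b y \<and> b y \<le> lower a x (y - 1)" for y
    using assms(2) False ab[of y] by (cases "y - 1 = x"; cases "y = x") (auto simp: lower_def)
  then show ?thesis using False by (simp add: up_def vstep_def)
qed

text \<open>The constraints defining paths bound differences of neighbouring values, and
  \<open>- potential / 4\<close> restricted to \<open>p = 0\<close> satisfies all of them strictly. Hence a maximum of the potential
  among the points where \<open>p\<close> exceeds the vacuum is not blocked by any of its neighbours.\<close>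

definition potential :: "(sign \<times> bool \<times> int) list \<Rightarrow> (nat \<Rightarrow> int \<Rightarrow> int) \<Rightarrow> nat \<Rightarrow> int \<Rightarrow> int" where
  "potential ws p m x = 4 * p m x + 2 * x - (\<Sum>i<m. if fst (ws ! i) = Plus then 1 else - 1)"

lemma path_descent:
  assumes p: "p \<in> paths ws" and nz: "p \<noteq> (\<lambda>_. vac)"
  obtains r x where "0 < r" "r < length ws" "p(r := lower (p r) x) \<in> paths ws"
proof -
  let ?L = "length ws"
  have st: "is_state (p i)" for i using p by (simp add: paths_def)
  have ends: "p 0 = vac" "i \<ge> ?L \<Longrightarrow> p i = vac" for i using p by (auto simp: paths_def)
  have tr: "trans_step (ws ! i) (p i) (p (Suc i))" if "i < ?L" for i using p that by (auto simp: paths_def)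
  define D where "D = (SIGMA m:{..?L}. {x. p m x \<noteq> vac x})"
  have D_iff: "(m, x) \<in> D \<longleftrightarrow> vac x < p m x" for m x
    using state_ge_vac[OF st, of x m] ends(2)[of m] by (auto simp: D_def not_le order_le_less intro: ccontr)
  have fin: "finite D" unfolding D_def by (intro finite_SigmaI finite_excess st) simp
  have "D \<noteq> {}"
  proof
    assume "D = {}"
    then have "p i x = vac x" for i x
      using D_iff[of i x] state_ge_vac[OF st, of x i] by (metis antisym_conv2 empty_iff)
    then have "p = (\<lambda>_. vac)" by blast
    then show False using nz by simp
  qed
  define F where "F = (\<lambda>(m, x). potential ws p m x)"
  have "Max (F ` D) \<in> F ` D" using fin \<open>D \<noteq> {}\<close> by (intro Max_in) auto
  then obtain r x where rx: "(r, x) \<in> D" "F (r, x) = Max (F ` D)" by force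
  have top: "potential ws p m y \<le> potential ws p r x" if "vac y < p m y" for m y
  proof -
    have "F (m, y) \<le> F (r, x)" unfolding rx(2) using that fin by (intro Max_ge) (auto simp: D_iff)
    then show ?thesis by (simp add: F_def)
  qed
  have v: "vac x < p r x" using rx(1) D_iff by blast
  have "r \<noteq> 0" using v ends(1) by (intro notI) simp
  then have r: "0 < r" by simp
  have r': "r < ?L" using v ends(2)[of r] by (cases "r < ?L") simp_all
  have vac1: "vac (x + 1) \<le> vac x" "vac (x - 1) \<le> vac x + 1" by (auto simp: vac_def)
  let ?s = "\<lambda>i. if fst (ws ! i) = Plus then 1 else - 1 :: int"
  have "is_state (lower (p r) x)"
  proof -
    \<comment> \<open>Each of the two obstacles within a diagonal would yield a point above the
      vacuum whose potential is larger by 2.\<close>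
    have 1: "p r (x + 1) \<noteq> p r x"
      using top[of "x + 1" r] v vac1 by (auto simp: potential_def)
    have 2: "p r (x - 1) \<noteq> p r x + 1"
      using top[of "x - 1" r] v vac1 by (auto simp: potential_def)
    have l1: "p r (y + 1) \<le> p r y" "p r y \<le> p r (y + 1) + 1" for y using st[of r] by (auto simp: is_state_def)
    have "lower (p r) x (y + 1) \<le> lower (p r) x y \<and> lower (p r) x y \<le> lower (p r) x (y + 1) + 1" for y
    proof -
      consider "y = x" | "y = x - 1" | "y \<noteq> x" "y + 1 \<noteq> x" by linarith
      then show ?thesis
        using l1[of y] 1 2 by cases (auto simp: lower_def)
    qed
    moreover obtain N where "N \<ge> 0" "\<And>n. N \<le> \<bar>n\<bar> \<Longrightarrow> p r n = vac n"
      using state_bound[OF st[of r]] by blast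
    then have "lower (p r) x y = vac y" if "N + \<bar>x\<bar> + 1 \<le> \<bar>y\<bar>" for y
      using that by (auto simp: lower_def)
    ultimately show ?thesis unfolding is_state_def by blast
  qed
  moreover have "trans_step (ws ! i) ((p(r := lower (p r) x)) i) ((p(r := lower (p r) x)) (Suc i))" if i: "i < ?L" for i
  proof -
    \<comment> \<open>Towards a neighbouring diagonal the sign sum shifts the potential by 1. A
      tight bound would then give a point above the vacuum with potential larger by 1: for a smaller
      neighbour directly, for a larger one as \<open>4 - 2 - 1\<close> or \<open>2 - 1\<close>,
      according to the kind of step.\<close>
    have up_case: "up t (p j) (lower (p r) x)"
      if u: "up t (p j) (p r)" and s: "potential ws p j x = potential ws p r x + 4 * (p j x - p r x) + 1" for t j
    proof (rule up_lower_upper[OF u])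
      show "p j x \<noteq> p r x" using top[of x j] v s by auto
    qed
    have low_case: "up t (lower (p r) x) (p j)"
      if u: "up t (p r) (p j)" and s: "\<And>y. potential ws p j y = potential ws p r x + 4 * (p j y - p r x) + 2 * (y - x) - 1" for t j
    proof (rule up_lower_lower[OF u])
      have "p j (x - 1) \<le> p r x" if t
      proof -
        have "p j (x - 1) \<le> p r x + 1" using u that by (auto simp: up_def hstep_def dest: spec[of _ "x - 1"])
        moreover have "p j (x - 1) \<noteq> p r x + 1" using top[of "x - 1" j] v s[of "x - 1"] vac1 by auto
        ultimately show ?thesis by simp
      qed
      moreover have "p j (x + 1) < p r x" if "\<not> t"
      proof -
        have "p j (x + 1) \<le> p r x" using u that by (auto simp: up_def vstep_def dest: spec[of _ "x + 1"])
        moreover have "p j (x + 1) \<noteq> p r x" using top[of "x + 1" j] v s[of "x + 1"] vac1 by auto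
        ultimately show ?thesis by simp
      qed
      ultimately show "if t then p j (x - 1) \<le> p r x else p j (x + 1) < p r x" by simp
    qed
    obtain sg t lb where ws: "ws ! i = (sg, t, lb)" by (cases "ws ! i") auto
    consider "r = i" | "r = Suc i" | "r \<noteq> i" "r \<noteq> Suc i" by blast
    then show ?thesis
    proof cases
      case 1
      show ?thesis
      proof (cases sg)
        case Plus
        then have "up t (p r) (p (Suc i))" using tr[OF i] ws 1 by simp
        then have "up t (lower (p r) x) (p (Suc i))" by (rule low_case) (use 1 ws Plus in \<open>simp add: potential_def\<close>)
        then show ?thesis using 1 ws Plus by simp
      next
        case Minus
        then have "up t (p (Suc i)) (p r)" using tr[OF i] ws 1 by simp
        then have "up t (p (Suc i)) (lower (p r) x)" by (rule up_case) (use 1 ws Minus in \<open>simp add: potential_def\<close>)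
        then show ?thesis using 1 ws Minus by simp
      qed
    next
      case 2
      show ?thesis
      proof (cases sg)
        case Plus
        then have "up t (p i) (p r)" using tr[OF i] ws 2 by simp
        then have "up t (p i) (lower (p r) x)" by (rule up_case) (use 2 ws Plus in \<open>simp add: potential_def\<close>)
        then show ?thesis using 2 ws Plus by simp
      next
        case Minus
        then have "up t (p r) (p i)" using tr[OF i] ws 2 by simp
        then have "up t (lower (p r) x) (p i)" by (rule low_case) (use 2 ws Minus in \<open>simp add: potential_def\<close>)
        then show ?thesis using 2 ws Minus by simp
      qed
    next
      case 3
      then show ?thesis using tr[OF i] by simp
    qed
  qed
  ultimately have "p(r := lower (p r) x) \<in> paths ws"
    using st ends r r' unfolding paths_def by auto
  then show ?thesis using that r r' by blast
qed

text \<open>The original and the lowered path satisfy the same rank inequalities but differ by one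
  at a single point. This makes the inequalities around that point tight and forces the two dominos
  of a square that can be flipped.\<close>

lemma flip_down:
  assumes T: "T \<in> norm_tilings l w" and l: "l > 0" and nz: "profile l w T \<noteq> (\<lambda>_. vac)"
  shows "\<exists>S. flip T S \<and> S \<in> norm_tilings l w \<and> weight l w S = weight l w T - 1"
proof -
  define p where "p = profile l w T"
  have p: "p \<in> paths (steps l w)" unfolding p_def by (rule profile_in_paths[OF T])
  have Tp: "T = tiling_of l w p" unfolding p_def using tiling_of_profile[OF T l] by simp
  obtain r x where r: "0 < r" "r < length (steps l w)" and q: "p(r := lower (p r) x) \<in> paths (steps l w)"
    using path_descent[OF p] nz p_def by metis
  define k where "k = r - 1"
  have k: "r = Suc k" "Suc k < 2 * l" "k < 2 * l" using r by (simp_all add: k_def)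
  \<comment> \<open>Lowering the value at \<open>x\<close> moves the particle at
    \<open>x + front w r\<close> one place to the left, that is from \<open>n + 1\<close> to
    \<open>n\<close>.\<close>
  define n where "n = x + front w r - 1"
  define p' where "p' = p(r := lower (p r) x)"
  have st: "is_state (p i)" for i using p by (simp add: paths_def)
  define K where "K b m z = site_rank w p b m z" for b m z
  have K': "site_rank w p' b m z = K b m z + (if m = Suc k \<and> z = n + 1 then if b then 1 else - 1 else 0)" for b m z
    by (auto simp: site_rank_def K_def p'_def n_def lower_def k(1) simp del: front.simps)
  have S: "K b m (z + 1) = K b m z + of_bool (z \<in> path_sites w p m \<longleftrightarrow> b)" for b m z
    unfolding K_def by (rule rank_step[OF st])
  note hp = rank_hop[OF p, folded K_def]
  note hq = rank_hop[OF q[folded p'_def], unfolded K']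
  have n2: "n + 1 + 1 = n + 2" "n + 2 - 1 = n + 1" by simp_all
  \<comment> \<open>Which pair lowers the weight depends on parity, since south- and west-going
    dominos start on odd diagonals.\<close>
  define X where "X = (if even k then vs (int k) n else hs (int k) n)"
  define Y where "Y = (if even k then hs (int k) n else vs (int k) n)"
  have "X \<subseteq> T"
  proof (cases "even k")
    case True
    have "joins w p k n False"
      using hp(2)[OF k(3), of n] hp(2)[OF k(3), of "n + 1"] hq(1)[OF k(3), of "n + 1"]
        S[of False k n] S[of False "Suc k" n] True unfolding joins_def K_def[symmetric]
      by (auto simp: of_bool_def split: if_splits)
    moreover have "joins w p (Suc k) (n + 1) False"
      using hp(2)[OF k(2), of "n + 1"] hp(2)[OF k(2), of "n + 2"] hq(1)[OF k(2), of "n + 2"]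
        S[of True "Suc k" "n + 1"] S[of True "Suc (Suc k)" "n + 1"] True
      unfolding joins_def K_def[symmetric] n2 by (auto simp: of_bool_def split: if_splits)
    ultimately show ?thesis
      using True k unfolding Tp X_def vs_def by (auto simp: tiling_of_iff intro: exI[of _ "Suc k"])
  next
    case False
    have "joins w p k n True"
      using hp(1)[OF k(3), of "n + 1"] hp(1)[OF k(3), of "n + 2"] hq(2)[OF k(3), of "n + 1"]
        S[of True k n] S[of True "Suc k" "n + 1"] False
      unfolding joins_def K_def[symmetric] n2 by (auto simp: of_bool_def split: if_splits)
    moreover have "joins w p (Suc k) n True"
      using hp(1)[OF k(2), of "n + 1"] hp(1)[OF k(2), of "n + 2"] hq(2)[OF k(2), of "n + 1"]
        S[of False "Suc k" n] S[of False "Suc (Suc k)" "n + 1"] False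
      unfolding joins_def K_def[symmetric] n2 by (auto simp: of_bool_def split: if_splits)
    ultimately show ?thesis
      using False k unfolding Tp X_def hs_def by (auto simp: tiling_of_iff intro: exI[of _ "Suc k"])
  qed
  moreover have XY: "X = hs (int k) n \<and> Y = vs (int k) n \<or> X = vs (int k) n \<and> Y = hs (int k) n"
    by (simp add: X_def Y_def)
  ultimately interpret flip_move l w T "int k" n X Y by unfold_locales (use T in auto)
  have "flip T T'" unfolding flip_iff T'_def using XT XY by blast
  moreover have "(X = hs (int k) n) \<noteq> even (int k)"
  proof -
    have "dm (int k) n True \<in> hs (int k) n" "dm (int k) n True \<notin> vs (int k) n" by (simp_all add: hs_def vs_def)
    then have "hs (int k) n \<noteq> vs (int k) n" by metis
    then show ?thesis by (auto simp: X_def)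
  qed
  then have "weight l w T' = weight l w T - 1" using weight_T' by simp
  ultimately show ?thesis using norm_T' by blast
qed

section \<open>The minimal tiling and reachability by flips\<close>

lemma vac_path_sites: "path_sites w (\<lambda>_. vac) m = {n. n < front w m}"
  by (auto simp: path_sites_def vac_def simp del: front.simps)

text \<open>The prescribed sites imply purity and turn every profile into the vacuum, and a
  normalised tiling is determined by its profile. This also gives the uniqueness behind the definite
  description.\<close>

lemma is_minimal_tiling_iff:
  assumes l: "l > 0" and w: "length w = 2 * l"
  shows "is_minimal_tiling l w T \<longleftrightarrow> T = tiling_of l w (\<lambda>_. vac)"
proof -
  have half: "real_of_int n + 1 / 2 < of_int c \<longleftrightarrow> n < c" for n c by linarith
  have sites_iff: "(\<forall>m\<in>{0..2 * l}. \<forall>x\<in>half_integers. occupied T (x, x - real m) \<longleftrightarrow> x < of_int (front w m)) \<longleftrightarrow>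
      (\<forall>m\<le>2 * l. sites T m = {n. n < front w m})"
  proof -
    have "occupied T (of_int n + 1 / 2, of_int n + 1 / 2 - real m) \<longleftrightarrow> n \<in> sites T m" for n m
      using occupied_iff[of T n "int m"] by (simp add: sites_def)
    then show ?thesis unfolding half_integer_ball half by (auto simp: set_eq_iff simp del: front.simps)
  qed
  have M: "is_minimal_tiling l w T \<longleftrightarrow> comb_tiling l T \<and> comb_steep T \<and> comb_asym l T w \<and>
      (\<forall>m\<le>2 * l. sites T m = {n. n < front w m})"
    unfolding is_minimal_tiling_def sites_iff strip_tiling_iff asymptotic_data_iff[OF w] using steep_iff by blast
  show ?thesis
  proof
    assume "is_minimal_tiling l w T"
    then have c: "comb_tiling l T" "comb_steep T" "comb_asym l T w"
      and s: "\<And>m. m \<le> 2 * l \<Longrightarrow> sites T m = {n. n < front w m}"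
      unfolding M by auto
    have neg: "dm (- 1) n s \<notin> T" for n s using tiling_range[OF c(1)] by force
    have "covered T 0 n \<longleftrightarrow> 0 \<le> n" for n
    proof -
      have "n \<in> sites T 0 \<longleftrightarrow> \<not> covered T 0 n" using neg by (simp add: sites_def occ_iff)
      moreover have "n \<in> sites T 0 \<longleftrightarrow> n < 0" using s[of 0] by simp
      ultimately show ?thesis by (metis not_le)
    qed
    moreover have "covered T (2 * int l) n \<longleftrightarrow> n \<le> front w (2 * l) - 1" for n
      using sites_right_iff_covered[OF c(1) l, of n] s[of "2 * l"] by (simp del: front.simps)
    ultimately have T: "T \<in> norm_tilings l w" unfolding norm_tilings_def using c by blast
    have "profile l w T m = vac" for m
    proof (cases "m \<le> 2 * l")
      case True
      have "{a \<in> {n. n < front w m}. x + front w m \<le> a} = {x + front w m..<front w m}" for x by auto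
      then show ?thesis using True
        by (intro ext) (simp add: profile_def s occ_above_def vac_def del: front.simps)
    qed (simp add: profile_def)
    then have "profile l w T = (\<lambda>_. vac)" by blast
    then show "T = tiling_of l w (\<lambda>_. vac)" using tiling_of_profile[OF T l] by simp
  next
    assume T: "T = tiling_of l w (\<lambda>_. vac)"
    have "T \<in> norm_tilings l w" unfolding T by (rule tiling_of_norm[OF vac_in_paths l])
    moreover have "sites T m = {n. n < front w m}" if "m \<le> 2 * l" for m
      unfolding T sites_tiling_of[OF vac_in_paths that l] vac_path_sites ..
    ultimately show "is_minimal_tiling l w T" unfolding M norm_tilings_def by simp
  qed
qed

lemma minimal_tiling_eq:
  assumes "l > 0" "length w = 2 * l"
  shows "minimal_tiling l w = tiling_of l w (\<lambda>_. vac)"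
  unfolding minimal_tiling_def by (rule the_equality) (simp_all add: is_minimal_tiling_iff[OF assms])

lemma weight_zero:
  assumes T: "T \<in> norm_tilings l w" and w: "weight l w T = 0"
  shows "profile l w T = (\<lambda>_. vac)"
proof
  fix m
  let ?p = "profile l w T"
  note p = profile_in_paths[OF T]
  have st: "is_state (?p i)" for i using p by (simp add: paths_def)
  show "?p m = vac"
  proof (cases "m < 2 * l")
    case True
    have "boxes (?p m) = 0"
      using w True boxes_nonneg[OF st] unfolding weight_def wt_steps[OF p]
      by (subst (asm) sum_nonneg_eq_0_iff) auto
    then have "\<forall>n\<in>{n. ?p m n \<noteq> vac n}. ?p m n - vac n = 0"
      unfolding boxes_def using finite_excess[OF st] state_ge_vac[OF st]
      by (subst (asm) sum_nonneg_eq_0_iff) auto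
    then show ?thesis by (intro ext) auto
  qed (use p in \<open>simp add: paths_def\<close>)
qed

text \<open>Boxes are removed one by one, and the flips are then run backwards, as flipping is
  symmetric.\<close>

lemma reach_from_minimal:
  assumes l: "l > 0"
  shows "T \<in> norm_tilings l w \<Longrightarrow> weight l w T = int k \<Longrightarrow> (flip ^^ k) (tiling_of l w (\<lambda>_. vac)) T"
proof (induction k arbitrary: T)
  case 0
  then show ?case using weight_zero tiling_of_profile[OF _ l] by (metis of_nat_0 relpowp_0_I)
next
  case (Suc k)
  have "profile l w T \<noteq> (\<lambda>_. vac)"
  proof
    assume "profile l w T = (\<lambda>_. vac)"
    then have "weight l w T = 0" by (simp add: weight_def wt_def)
    then show False using Suc.prems(2) by simp
  qed
  then obtain S where S: "flip T S" "S \<in> norm_tilings l w" "weight l w S = weight l w T - 1"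
    using flip_down[OF Suc.prems(1) l] by blast
  then have "(flip ^^ k) (tiling_of l w (\<lambda>_. vac)) S" using Suc by simp
  then show ?case using flip_norm(3)[OF Suc.prems(1) S(1)] by (rule relpowp_Suc_I)
qed

section \<open>Translation classes\<close>

lemma translate_dm: "translate j (dm m n s) = dm m (n + j) s"
  by (auto simp: dm_def)

lemma dm_in_translate: "dm m n s \<in> translate j ` T \<longleftrightarrow> dm m (n - j) s \<in> T"
proof
  assume "dm m n s \<in> translate j ` T"
  then obtain d where d: "d \<in> T" "dm m n s = translate j d" by blast
  obtain m' n' s' where "d = dm m' n' s'" by (rule dm_cases)
  then show "dm m (n - j) s \<in> T" using d by (simp add: translate_dm)
next
  assume "dm m (n - j) s \<in> T"
  then show "dm m n s \<in> translate j ` T" by (rule rev_image_eqI) (simp add: translate_dm)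
qed

lemma covered_translate: "covered (translate j ` T) m n \<longleftrightarrow> covered T m (n - j)"
  unfolding covered_iff dm_in_translate by (simp add: algebra_simps)

lemma translate_translate: "translate i ` translate j ` T = translate (i + j) ` T"
proof -
  have "translate i (translate j d) = translate (i + j) d" for d by (cases d) auto
  then show ?thesis by (simp add: image_image)
qed

lemma translate_0: "translate 0 ` T = T"
proof -
  have "translate 0 d = d" for d by (cases d) auto
  then show ?thesis by simp
qed

lemma pure_steep_iff:
  assumes "length w = 2 * l"
  shows "T \<in> pure_steep_tilings l w \<longleftrightarrow> comb_tiling l T \<and> comb_steep T \<and> comb_asym l T w \<and>
    (\<exists>a b. \<forall>n. (covered T 0 n \<longleftrightarrow> a \<le> n) \<and> (covered T (2 * int l) n \<longleftrightarrow> n \<le> b))"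
  unfolding pure_steep_tilings_def mem_Collect_eq strip_tiling_iff asymptotic_data_iff[OF assms] pure_tiling_iff
  using steep_iff by blast

lemma cells_translate: "(m, n) \<in> cells (translate j d) \<longleftrightarrow> (m, n - j) \<in> cells d"
  by (cases d) auto

lemma comb_tiling_translate:
  assumes "comb_tiling l T" shows "comb_tiling l (translate j ` T)"
proof -
  have "d = d'" if d: "d \<in> translate j ` T" "d' \<in> translate j ` T" and c: "c \<in> cells d" "c \<in> cells d'" for d d' c
  proof -
    obtain e e' where e: "e \<in> T" "d = translate j e" "e' \<in> T" "d' = translate j e'" using d by blast
    obtain m n where "c = (m, n)" by (cases c)
    then have "e = e'" using tiling_disjoint[OF assms e(1,3), of "(m, n - j)"] c e by (simp add: cells_translate)
    then show ?thesis using e by simp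
  qed
  moreover have "covered (translate j ` T) m n" if "1 \<le> m \<and> m < 2 * int l" for m n
    using assms that unfolding covered_translate comb_tiling_def by blast
  moreover have "0 \<le> m \<and> m < 2 * int l" if "dm m n s \<in> translate j ` T" for m n s
    using tiling_range[OF assms, of m "n - j" s] that unfolding dm_in_translate by simp
  ultimately show ?thesis unfolding comb_tiling_def by blast
qed

lemma pure_steep_translate:
  assumes w: "length w = 2 * l" and T: "T \<in> pure_steep_tilings l w"
  shows "translate j ` T \<in> pure_steep_tilings l w"
proof -
  note P = T[unfolded pure_steep_iff[OF w]]
  obtain B where B: "\<And>m n s. dm m n s \<in> T \<Longrightarrow> (B < n \<longrightarrow> even m) \<and> (n < - B \<longrightarrow> odd m)"
    using P unfolding comb_steep_def by blast
  have "(B + \<bar>j\<bar> < n \<longrightarrow> even m) \<and> (n < - (B + \<bar>j\<bar>) \<longrightarrow> odd m)" if "dm m n s \<in> translate j ` T" for m n s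
    using B[of m "n - j" s] that unfolding dm_in_translate by auto
  then have 1: "comb_steep (translate j ` T)" unfolding comb_steep_def by blast
  obtain N where N: "\<And>m n. m < 2 * l \<Longrightarrow> if even m then N \<le> n else n \<le> - N \<Longrightarrow> dm (int m) n (shift_at w m) \<in> T"
    using P unfolding comb_asym_def by blast
  have "dm (int m) n (shift_at w m) \<in> translate j ` T"
    if "m < 2 * l" "if even m then N + \<bar>j\<bar> \<le> n else n \<le> - (N + \<bar>j\<bar>)" for m n
    using N[of m "n - j"] that unfolding dm_in_translate by (auto split: if_splits)
  then have 2: "comb_asym l (translate j ` T) w" unfolding comb_asym_def by blast
  obtain a b where ab: "\<And>n. covered T 0 n \<longleftrightarrow> a \<le> n" "\<And>n. covered T (2 * int l) n \<longleftrightarrow> n \<le> b"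
    using P by blast
  have "(covered (translate j ` T) 0 n \<longleftrightarrow> a + j \<le> n) \<and> (covered (translate j ` T) (2 * int l) n \<longleftrightarrow> n \<le> b + j)" for n
    unfolding covered_translate ab by auto
  then show ?thesis unfolding pure_steep_iff[OF w] using comb_tiling_translate 1 2 P by blast
qed

lemma norm_subset_pure_steep:
  assumes "length w = 2 * l" shows "norm_tilings l w \<subseteq> pure_steep_tilings l w"
  unfolding norm_tilings_def using pure_steep_iff[OF assms] by blast

lemma ex_norm_translate:
  assumes w: "length w = 2 * l" and T: "T \<in> pure_steep_tilings l w"
  obtains j where "translate j ` T \<in> norm_tilings l w"
proof -
  obtain a b where ab: "\<And>n. covered T 0 n \<longleftrightarrow> a \<le> n" "\<And>n. covered T (2 * int l) n \<longleftrightarrow> n \<le> b"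
    using T[unfolded pure_steep_iff[OF w]] by blast
  have "translate (- a) ` T \<in> pure_steep_tilings l w" by (rule pure_steep_translate[OF w T])
  moreover have "covered (translate (- a) ` T) 0 n \<longleftrightarrow> 0 \<le> n" for n
    unfolding covered_translate ab by auto
  ultimately have "translate (- a) ` T \<in> norm_tilings l w"
    unfolding norm_tilings_def pure_steep_iff[OF w] by blast
  then show ?thesis by (rule that)
qed

lemma norm_translate_eq:
  assumes "T \<in> norm_tilings l w" "translate j ` T \<in> norm_tilings l w"
  shows "translate j ` T = T"
proof -
  have "0 \<le> n - j \<longleftrightarrow> 0 \<le> n" for n
    using assms covered_translate[of j T 0 n] by (simp add: norm_tilings_def)
  from this[of 0] this[of j] have "j = 0" by simp
  then show ?thesis by (simp add: translate_0)
qed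

lemma equiv_translation_rel:
  assumes w: "length w = 2 * l"
  shows "equiv (pure_steep_tilings l w) (translation_rel l w)"
proof (rule equivI)
  show "translation_rel l w \<subseteq> pure_steep_tilings l w \<times> pure_steep_tilings l w"
    by (auto simp: translation_rel_def)
  show "refl_on (pure_steep_tilings l w) (translation_rel l w)"
    by (rule refl_onI) (auto simp: translation_rel_def intro!: exI[of _ 0] translate_0[symmetric])
  show "sym (translation_rel l w)"
  proof (rule symI)
    fix T S assume "(T, S) \<in> translation_rel l w"
    then obtain n where n: "T \<in> pure_steep_tilings l w" "S \<in> pure_steep_tilings l w" "S = translate n ` T"
      by (auto simp: translation_rel_def)
    then have "T = translate (- n) ` S" by (simp add: translate_translate translate_0)
    then show "(S, T) \<in> translation_rel l w" using n unfolding translation_rel_def by blast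
  qed
  show "trans (translation_rel l w)"
  proof (rule transI)
    fix T S R assume "(T, S) \<in> translation_rel l w" "(S, R) \<in> translation_rel l w"
    then obtain n m where n: "T \<in> pure_steep_tilings l w" "S = translate n ` T"
        "R \<in> pure_steep_tilings l w" "R = translate m ` S"
      by (auto simp: translation_rel_def)
    then have "R = translate (m + n) ` T" by (simp add: translate_translate)
    then show "(T, R) \<in> translation_rel l w" using n unfolding translation_rel_def by blast
  qed
qed

definition class_of :: "nat \<Rightarrow> sign list \<Rightarrow> domino set \<Rightarrow> domino set set" where
  "class_of l w T = translation_rel l w `` {T}"

lemma class_of_norm:
  assumes "T \<in> norm_tilings l w" "S \<in> class_of l w T" "S \<in> norm_tilings l w"
  shows "S = T"
  using assms norm_translate_eq unfolding class_of_def translation_rel_def by blast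

lemma bij_betw_class_of:
  assumes w: "length w = 2 * l"
  shows "bij_betw (class_of l w) (norm_tilings l w) (pure_steep_classes l w)"
proof -
  note E = equiv_translation_rel[OF w]
  have self: "T \<in> class_of l w T" if "T \<in> pure_steep_tilings l w" for T
    unfolding class_of_def by (rule equiv_class_self[OF E that])
  have "inj_on (class_of l w) (norm_tilings l w)"
    using class_of_norm self norm_subset_pure_steep[OF w] by (intro inj_onI) (metis subsetD)
  moreover have "class_of l w ` norm_tilings l w = pure_steep_classes l w"
  proof (intro equalityI subsetI)
    fix C assume "C \<in> class_of l w ` norm_tilings l w"
    then obtain T where "T \<in> norm_tilings l w" "C = class_of l w T" by blast
    then show "C \<in> pure_steep_classes l w"
      unfolding pure_steep_classes_def class_of_def by (metis quotientI subsetD[OF norm_subset_pure_steep[OF w]])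
  next
    fix C assume "C \<in> pure_steep_classes l w"
    then obtain T where T: "T \<in> pure_steep_tilings l w" "C = class_of l w T"
      unfolding pure_steep_classes_def class_of_def by (auto elim: quotientE)
    obtain j where j: "translate j ` T \<in> norm_tilings l w" using ex_norm_translate[OF w T(1)] by blast
    then have "(T, translate j ` T) \<in> translation_rel l w"
      using T(1) norm_subset_pure_steep[OF w] unfolding translation_rel_def by blast
    then have "C = class_of l w (translate j ` T)"
      unfolding T(2) class_of_def by (rule equiv_class_eq[OF E])
    then show "C \<in> class_of l w ` norm_tilings l w" using j by blast
  qed
  ultimately show ?thesis by (simp add: bij_betw_def)
qed

text \<open>Flips preserve normalisation, so \<open>T\<close> is the only member of its class within
  reach. Its weight is a lower bound because a flip adds at most 1, and the descent attains
  it.\<close>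

lemma flip_number_class_of:
  assumes l: "l > 0" and w: "length w = 2 * l" and T: "T \<in> norm_tilings l w"
  shows "flip_number l w (class_of l w T) = enat (nat (weight l w T))"
proof -
  let ?M = "tiling_of l w (\<lambda>_. vac)"
  have M: "?M \<in> norm_tilings l w" by (rule tiling_of_norm[OF vac_in_paths l])
  have "profile l w ?M = (\<lambda>_. vac)" by (rule profile_tiling_of[OF vac_in_paths l])
  then have M0: "weight l w ?M = 0" by (simp add: weight_def wt_def)
  have "T \<in> class_of l w T"
    unfolding class_of_def using equiv_class_self[OF equiv_translation_rel[OF w]] norm_subset_pure_steep[OF w] T by blast
  moreover have "(flip ^^ nat (weight l w T)) ?M T"
    by (rule reach_from_minimal[OF l T]) (use weight_nonneg[OF T] in simp)
  moreover have "nat (weight l w T) \<le> n" if "S \<in> class_of l w T" "(flip ^^ n) ?M S" for n S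
  proof -
    have S: "S \<in> norm_tilings l w" "weight l w S \<le> int n" using flips_norm[OF M that(2)] M0 by auto
    then have "S = T" using class_of_norm[OF T that(1)] by blast
    then show ?thesis using S by simp
  qed
  ultimately show ?thesis
    unfolding flip_number_def minimal_tiling_eq[OF l w]
    by (intro antisym INF_lower INF_greatest) auto
qed

lemma classes_with_flips_eq:
  assumes l: "l > 0" and w: "length w = 2 * l"
  shows "bij_betw (class_of l w \<circ> tiling_of l w) {p \<in> paths (steps l w). wt (steps l w) p = int n} (classes_with_flips l w n)"
proof -
  have inv: "bij_betw (tiling_of l w) (paths (steps l w)) (norm_tilings l w)"
    by (rule bij_betw_byWitness[where f' = "profile l w"])
      (use l profile_in_paths tiling_of_norm profile_tiling_of tiling_of_profile in auto)
  have "bij_betw (tiling_of l w) {p \<in> paths (steps l w). wt (steps l w) p = int n}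
      {T \<in> norm_tilings l w. weight l w T = int n}"
  proof (rule bij_betw_subset[OF inv])
    show "tiling_of l w ` {p \<in> paths (steps l w). wt (steps l w) p = int n} = {T \<in> norm_tilings l w. weight l w T = int n}"
    proof (intro equalityI subsetI)
      fix T assume "T \<in> {T \<in> norm_tilings l w. weight l w T = int n}"
      then show "T \<in> tiling_of l w ` {p \<in> paths (steps l w). wt (steps l w) p = int n}"
        using profile_in_paths tiling_of_profile[OF _ l] unfolding weight_def
        by (intro image_eqI[of _ _ "profile l w T"]) auto
    qed (use tiling_of_norm[OF _ l] profile_tiling_of[OF _ l] in \<open>auto simp: weight_def\<close>)
  qed auto
  moreover have "bij_betw (class_of l w) {T \<in> norm_tilings l w. weight l w T = int n} (classes_with_flips l w n)"
  proof (rule bij_betw_subset[OF bij_betw_class_of[OF w]])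
    have "enat (nat (weight l w T)) = enat n \<longleftrightarrow> weight l w T = int n" if "T \<in> norm_tilings l w" for T
      using weight_nonneg[OF that] by auto
    then have e: "flip_number l w (class_of l w T) = enat n \<longleftrightarrow> weight l w T = int n"
      if "T \<in> norm_tilings l w" for T
      using that flip_number_class_of[OF l w that] by simp
    have "classes_with_flips l w n = {C \<in> class_of l w ` norm_tilings l w. flip_number l w C = enat n}"
      using bij_betw_class_of[OF w] by (simp add: classes_with_flips_def bij_betw_def)
    then show "class_of l w ` {T \<in> norm_tilings l w. weight l w T = int n} = classes_with_flips l w n"
    proof (intro equalityI subsetI)
      fix C assume "C \<in> class_of l w ` {T \<in> norm_tilings l w. weight l w T = int n}"
      then obtain T where "T \<in> norm_tilings l w" "weight l w T = int n" "C = class_of l w T" by blast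
      then show "C \<in> classes_with_flips l w n" using e[of T] \<open>classes_with_flips l w n = _\<close> by simp
    next
      fix C assume "C \<in> classes_with_flips l w n"
      then obtain T where "T \<in> norm_tilings l w" "C = class_of l w T" "flip_number l w C = enat n"
        using \<open>classes_with_flips l w n = _\<close> by auto
      then show "C \<in> class_of l w ` {T \<in> norm_tilings l w. weight l w T = int n}" using e[of T] by simp
    qed
  qed auto
  ultimately show ?thesis by (rule bij_betw_trans)
qed

section \<open>The product formula\<close>

lemma pair_product_eq:
  "pair_product xs = (\<Prod>a<length xs. \<Prod>b\<in>{Suc a..<length xs}. step_factor (xs ! a) (xs ! b))"
proof (induction xs)
  case (Cons x xs)
  have shift: "(\<Prod>b\<in>{Suc a..<Suc n}. f b) = (\<Prod>b\<in>{a..<n}. f (Suc b))" for a n and f :: "nat \<Rightarrow> rat fps"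
    by (rule prod.shift_bounds_Suc_ivl)
  have "prod_list (map (step_factor x) xs) = (\<Prod>b\<in>{0..<length xs}. step_factor x (xs ! b))"
    by (simp add: prod.list_conv_set_nth)
  also have "\<dots> = (\<Prod>b\<in>{Suc 0..<Suc (length xs)}. step_factor x ((x # xs) ! b))"
    unfolding shift by simp
  finally show ?case
    unfolding pair_product.simps Cons.IH length_Cons prod.lessThan_Suc_shift shift nth_Cons_0 nth_Cons_Suc
    by (simp only:)
qed simp

text \<open>Steps are counted from 0 and letters from 1. Two steps have the same kind exactly if
  their indices have an even difference, and a pair with the adding step first has exponent equal to
  that difference.\<close>

lemma pair_product_steps:
  "pair_product (steps l w) =
      (\<Prod>(i, j)\<in>{(i, j). 1 \<le> i \<and> i < j \<and> j \<le> 2 * l \<and>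
                      letter w i = Plus \<and> letter w j = Minus \<and> odd (j - i)}.
          1 + fps_X ^ (j - i)) *
      (\<Prod>(i, j)\<in>{(i, j). 1 \<le> i \<and> i < j \<and> j \<le> 2 * l \<and>
                      letter w i = Plus \<and> letter w j = Minus \<and> even (j - i)}.
          1 / (1 - fps_X ^ (j - i)))"
    (is "_ = (\<Prod>(i, j)\<in>?A. ?f i j) * (\<Prod>(i, j)\<in>?B. ?g i j)")
proof -
  define P where "P = (SIGMA a:{..<2 * l}. {Suc a..<2 * l})"
  define F where "F = (\<lambda>(a, b). step_factor (steps l w ! a) (steps l w ! b))"
  define A B where "A = {(a, b) \<in> P. letter w (Suc a) = Plus \<and> letter w (Suc b) = Minus \<and> odd (b - a)}"
    and "B = {(a, b) \<in> P. letter w (Suc a) = Plus \<and> letter w (Suc b) = Minus \<and> even (b - a)}"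
  have fin: "finite P" by (simp add: P_def)
  have F: "F (a, b) = (if letter w (Suc a) = Plus \<and> letter w (Suc b) = Minus then pair_factor (even (b - a)) (b - a) else 1)"
    if "(a, b) \<in> P" for a b
  proof -
    have ab: "a < b" "b < 2 * l" using that by (auto simp: P_def)
    then have "(even a = even b) = even (b - a)" by auto
    moreover have "nat (int b + 1 - (int a + 1)) = b - a" using ab by simp
    ultimately show ?thesis using ab
      by (cases "letter w (Suc a)"; cases "letter w (Suc b)") (simp_all add: F_def)
  qed
  have "pair_product (steps l w) = prod F P"
    unfolding pair_product_eq length_steps P_def F_def by (subst prod.Sigma) auto
  also have "\<dots> = prod F (A \<union> B)"
    by (rule prod.mono_neutral_right[OF fin]) (auto simp: A_def B_def F)
  also have "\<dots> = prod F A * prod F B"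
    by (rule prod.union_disjoint) (auto simp: A_def B_def intro: finite_subset[OF _ fin])
  also have "prod F A = (\<Prod>(i, j)\<in>?A. ?f i j)"
    by (rule prod.reindex_bij_witness[of _ "\<lambda>(i, j). (i - 1, j - 1)" "\<lambda>(a, b). (Suc a, Suc b)"])
      (auto simp: A_def F pair_factor_def, auto simp: P_def)
  also have "prod F B = (\<Prod>(i, j)\<in>?B. ?g i j)"
    by (rule prod.reindex_bij_witness[of _ "\<lambda>(i, j). (i - 1, j - 1)" "\<lambda>(a, b). (Suc a, Suc b)"])
      (auto simp: B_def F pair_factor_def, auto simp: P_def)
  finally show ?thesis .
qed

lemma sorted_steps:
  "sorted_wrt (\<lambda>x y. fst x = Plus \<and> fst y = Minus \<longrightarrow> label x < label y) (steps l w)"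
  by (simp add: sorted_wrt_iff_nth_less label_def)

theorem theorem2:
  fixes l :: nat and w :: "sign list"
  assumes "l \<ge> 1" and "length w = 2 * l"
  shows "(\<forall>C\<in>pure_steep_classes l w. flip_number l w C \<noteq> \<infinity>) \<and>
    (\<forall>n. finite (classes_with_flips l w n)) \<and>
    tiling_gf l w =
      (\<Prod>(i, j)\<in>{(i, j). 1 \<le> i \<and> i < j \<and> j \<le> 2 * l \<and>
                      letter w i = Plus \<and> letter w j = Minus \<and> odd (j - i)}.
          1 + fps_X ^ (j - i)) *
      (\<Prod>(i, j)\<in>{(i, j). 1 \<le> i \<and> i < j \<and> j \<le> 2 * l \<and>
                      letter w i = Plus \<and> letter w j = Minus \<and> even (j - i)}.
          1 / (1 - fps_X ^ (j - i)))"
proof -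
  have l: "l > 0" using assms(1) by simp
  note bij = classes_with_flips_eq[OF l assms(2)]
  have gf: "graded (paths (steps l w)) (wt (steps l w))"
    "wgf (paths (steps l w)) (wt (steps l w)) = pair_product (steps l w)"
    using wgf_paths[OF sorted_steps] by auto
  \<comment> \<open>Together with the finiteness that follows, this ensures that no class escapes
    the generating function and that no coefficient is the cardinality of an infinite set.\<close>
  have "flip_number l w C \<noteq> \<infinity>" if C: "C \<in> pure_steep_classes l w" for C
  proof -
    obtain T where "T \<in> norm_tilings l w" "C = class_of l w T"
      using C bij_betw_class_of[OF assms(2)] unfolding bij_betw_def by blast
    then show ?thesis using flip_number_class_of[OF l assms(2)] by simp
  qed
  moreover have "finite (classes_with_flips l w n)" for n
    using gf(1) bij_betw_finite[OF bij[of n]] by (simp add: graded_def)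
  moreover have "tiling_gf l w = pair_product (steps l w)"
    unfolding gf(2)[symmetric] tiling_gf_def wgf_def using bij_betw_same_card[OF bij] by simp
  ultimately show ?thesis unfolding pair_product_steps by blast
qed

end
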